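(* Let $f\in\mathbb R(z)$ be a rational map of degree $d\ge2$ and let $\mathcal J_{\mathbb R}(f)=\mathcal J(f)\cap\hat{\mathbb R}$. The non-wandering set of the dynamical system $f\restriction_{\mathcal J_{\mathbb R}(f)}:\mathcal J_{\mathbb R}(f)\to\mathcal J_{\mathbb R}(f)$ is either the whole circle $\hat{\mathbb R}$ or the union of finitely many intervals and a totally disconnected subsystem. Moreover, this system has a closed subsystem (possibly empty) of the same topological entropy in which preperiodic points of $f$ are dense.
   Context: $\hat{\mathbb R}=\mathbb R\cup\{\infty\}$; $\mathcal J(f)$ is the Julia set of $f$. A subsystem is a forward-invariant subset with the restricted dynamics. *)

theory Defs
  imports "HOL-Analysis.Analysis" "HOL-Computational_Algebra.Polynomial_Factorial"
begin

section \<open>The Riemann sphere as complex option (None = infinity)\<close>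

text \<open>Stereographic embedding of the extended complex plane onto the unit sphere
  of R^3 = C x R. Topology and the chordal metric on the Riemann sphere are pulled back
  along this (homeomorphic) embedding.\<close>

definition stereo :: "complex option \<Rightarrow> complex \<times> real" where
  "stereo z = (case z of
      None \<Rightarrow> (0, 1)
    | Some w \<Rightarrow> ((2 / (1 + (cmod w)\<^sup>2)) *\<^sub>R w, ((cmod w)\<^sup>2 - 1) / ((cmod w)\<^sup>2 + 1)))"

definition chordal :: "complex option \<Rightarrow> complex option \<Rightarrow> real" where
  "chordal z w = dist (stereo z) (stereo w)"

definition rhat :: "complex option set" where
  "rhat = {z. z = None \<or> (\<exists>x::real. z = Some (complex_of_real x))}"

definition rat_map :: "real poly \<Rightarrow> real poly \<Rightarrow> complex option \<Rightarrow> complex option" where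
  "rat_map p q z = (case z of
      Some w \<Rightarrow> (if poly (map_poly complex_of_real q) w \<noteq> 0
                 then Some (poly (map_poly complex_of_real p) w / poly (map_poly complex_of_real q) w)
                 else None)
    | None \<Rightarrow> (if degree p > degree q then None
              else if degree p = degree q then Some (complex_of_real (lead_coeff p / lead_coeff q))
              else Some 0))"

text \<open>Fatou set: points having an open neighbourhood on which the family of iterates
  is equicontinuous with respect to the chordal metric (Beardon's definition).\<close>
definition fatou :: "(complex option \<Rightarrow> complex option) \<Rightarrow> complex option set" where
  "fatou f = {z. \<exists>U. z \<in> U \<and> (\<forall>w\<in>U. \<exists>r>0. {u. chordal u w < r} \<subseteq> U) \<and>
      (\<forall>w\<in>U. \<forall>e>0. \<exists>\<delta>>0. \<forall>n. \<forall>u\<in>U. chordal u w < \<delta> \<longrightarrow>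
          chordal ((f ^^ n) u) ((f ^^ n) w) < e)}"

definition julia :: "(complex option \<Rightarrow> complex option) \<Rightarrow> complex option set" where
  "julia f = UNIV - fatou f"

section \<open>Dynamical notions for a map g restricted to a forward-invariant set X\<close>

definition nonwandering :: "('a \<Rightarrow> 'a) \<Rightarrow> 'a set \<Rightarrow> (('a \<Rightarrow> 'a \<Rightarrow> real)) \<Rightarrow> 'a set" where
  "nonwandering g X \<rho> = {x\<in>X. \<forall>r>0. \<exists>n\<ge>1. \<exists>y\<in>X.
       \<rho> y x < r \<and> \<rho> ((g ^^ n) y) x < r}"

definition preperiodic :: "('a \<Rightarrow> 'a) \<Rightarrow> 'a \<Rightarrow> bool" where
  "preperiodic g x \<longleftrightarrow> (\<exists>m n. n > 0 \<and> (g ^^ (m + n)) x = (g ^^ m) x)"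

definition separated :: "('a \<Rightarrow> 'a) \<Rightarrow> ('a \<Rightarrow> 'a \<Rightarrow> real) \<Rightarrow> nat \<Rightarrow> real \<Rightarrow> 'a set \<Rightarrow> bool" where
  "separated g \<rho> n e S \<longleftrightarrow>
     (\<forall>x\<in>S. \<forall>y\<in>S. x \<noteq> y \<longrightarrow> (\<exists>k<n. \<rho> ((g ^^ k) x) ((g ^^ k) y) > e))"

definition sepnum :: "('a \<Rightarrow> 'a) \<Rightarrow> ('a \<Rightarrow> 'a \<Rightarrow> real) \<Rightarrow> 'a set \<Rightarrow> nat \<Rightarrow> real \<Rightarrow> nat" where
  "sepnum g \<rho> K n e = Sup {card S | S. finite S \<and> S \<subseteq> K \<and> separated g \<rho> n e S}"

definition top_entropy :: "('a \<Rightarrow> 'a) \<Rightarrow> ('a \<Rightarrow> 'a \<Rightarrow> real) \<Rightarrow> 'a set \<Rightarrow> ereal" where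
  "top_entropy g \<rho> K = (if K = {} then 0 else
     (SUP e\<in>{0<..}. limsup (\<lambda>n. ereal (ln (real (sepnum g \<rho> K (Suc n) e)) / real (Suc n)))))"

definition sconnected :: "complex option set \<Rightarrow> bool" where
  "sconnected A \<longleftrightarrow> connected (stereo ` A)"

definition sclosed :: "complex option set \<Rightarrow> bool" where
  "sclosed A \<longleftrightarrow> closed (stereo ` A)"

definition stotally_disconnected :: "complex option set \<Rightarrow> bool" where
  "stotally_disconnected A \<longleftrightarrow> (\<forall>C\<subseteq>A. sconnected C \<longrightarrow> (\<exists>a. C \<subseteq> {a}))"

definition sdense_in :: "complex option set \<Rightarrow> complex option set \<Rightarrow> bool" where
  "sdense_in D A \<longleftrightarrow> D \<subseteq> A \<and> stereo ` A \<subseteq> closure (stereo ` D)"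

end

theory Submission
  imports Defs "HOL-Complex_Analysis.Complex_Analysis"
    "HOL-Computational_Algebra.Fundamental_Theorem_Algebra" "HOL-Real_Asymp.Real_Asymp"
begin

text \<open>The extended real line is the circle of points \<open>[sin \<pi>t : cos \<pi>t]\<close>. The map lifts to a continuous
  \<open>F\<close> on the reals, and the real Julia set pulls back to a closed periodic set \<open>X\<close> with
  \<open>F x \<in> X \<longleftrightarrow> x \<in> X\<close>.

  Nonwandering set: \<open>F\<close> maps every nondegenerate component into another one, and the recurrence of an
  interior point makes each of them periodic. If a cycle of components contained no critical point, its
  return map \<open>H\<close> would be injective, and a point with \<open>H (H x) \<noteq> x\<close> would wander; but \<open>H \<circ> H = id\<close> on an
  interval makes an iterate of the rational map the identity, so that the Julia set is empty. Hence
  there are finitely many components. A point with degenerate component cannot enter the interior of a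
  nondegenerate one, because then its returning neighbours would accumulate on a closed cycle of
  components; so the degenerate points together with the orbits of the finitely many end points form a
  totally disconnected invariant set.

  Subsystem: let \<open>K\<close> be the closure of the preperiodic points in \<open>X\<close>. Complete invariance shows that \<open>F\<close> maps
  gaps of \<open>K\<close> into gaps of \<open>K\<close>. Only finitely many gaps are long modulo translation; a nonrecurrent one
  is visited at most once, and the return map of a recurrent one that meets \<open>X\<close> has no fixed point inside
  it, since the ends of the Fatou interval around such a point would be preperiodic. So positions along
  the returns are monotone, and relative to \<open>K\<close> only polynomially many orbit types occur. If \<open>K\<close> is empty,
  there is no periodic point at all; then the rotation number is irrational, and the same counting
  relative to the limit set of an orbit, on which \<open>F\<close> is monotone, gives entropy zero.\<close>

section \<open>Homogeneous coordinates on the sphere and the real circle\<close>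

text \<open>Passing from the circle to the line makes order and the intermediate value theorem
  available; the price is that returns hold only modulo an integer, hence the many
  \<open>of_int m\<close>. Complete invariance is indispensable for the gaps: a preperiodic point
  strictly inside the image of a gap would have a preimage in the gap, and that preimage must again
  be preperiodic and in \<open>X\<close>. Forward invariance of the Fatou set rests on
  \<open>f\<close> being an open map, at infinity as well. Orbit types are polynomially many because
  the visits to a long gap, recorded by cells of a fixed size, give a bounded code that never
  decreases along a residue class modulo a fixed \<open>q\<close>. Up to time n such a code is
  determined by a fixed number of counts, each at most n, and a polynomial factor disappears in
  ln(.) / n. The limit set used when there are no periodic points is not known to be backward
  invariant. There the order of the orbit, which is that of an irrational rotation, and the
  exclusion of folds take over the role of complete invariance.\<close>

definition proj :: "complex \<Rightarrow> complex \<Rightarrow> complex option" where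
  "proj a b = (if b = 0 then None else Some (a / b))"

text \<open>At \<open>t + 1\<close> both coordinates change sign, which leaves the projective point
  unchanged; hence period 1, with \<open>circ t\<close> at angle 2 pi t on a great circle through
  both poles.\<close>

definition circ :: "real \<Rightarrow> complex option" where
  "circ t = proj (of_real (sin (pi * t))) (of_real (cos (pi * t)))"

text \<open>This is \<open>stereo\<close> in homogeneous coordinates. It is continuous at both
  poles, so a lifted map can be treated without singling out infinity.\<close>

definition hsphere :: "complex \<times> complex \<Rightarrow> complex \<times> real" where
  "hsphere = (\<lambda>(a, b). ((2 / ((cmod a)\<^sup>2 + (cmod b)\<^sup>2)) *\<^sub>R (a * cnj b),
     ((cmod a)\<^sup>2 - (cmod b)\<^sup>2) / ((cmod a)\<^sup>2 + (cmod b)\<^sup>2)))"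

lemma stereo_proj:
  assumes "a \<noteq> 0 \<or> b \<noteq> 0"
  shows "stereo (proj a b) = hsphere (a, b)"
proof (cases "b = 0")
  case True
  then show ?thesis using assms by (simp add: proj_def stereo_def hsphere_def)
next
  case False
  have pos: "(cmod a)\<^sup>2 + (cmod b)\<^sup>2 > 0"
    using False by (simp add: add_nonneg_pos)
  have b2: "(cmod b)\<^sup>2 > 0" using False by simp
  have e1: "1 + (cmod a / cmod b)\<^sup>2 = ((cmod a)\<^sup>2 + (cmod b)\<^sup>2) / (cmod b)\<^sup>2"
    using False by (simp add: field_simps power_divide)
  have e2: "(cmod a / cmod b)\<^sup>2 - 1 = ((cmod a)\<^sup>2 - (cmod b)\<^sup>2) / (cmod b)\<^sup>2"
    using False by (simp add: field_simps power_divide)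
  have bb: "complex_of_real ((cmod b)\<^sup>2) = b * cnj b" by (simp only: complex_norm_square)
  have "(2 / (1 + (cmod a / cmod b)\<^sup>2)) *\<^sub>R (a / b)
     = (2 / ((cmod a)\<^sup>2 + (cmod b)\<^sup>2)) *\<^sub>R (complex_of_real ((cmod b)\<^sup>2) * (a / b))"
    unfolding e1 by (simp add: scaleR_conv_of_real)
  also have "complex_of_real ((cmod b)\<^sup>2) * (a / b) = a * cnj b"
    unfolding bb using False by simp
  finally have 1: "(2 / (1 + (cmod a / cmod b)\<^sup>2)) *\<^sub>R (a / b)
     = (2 / ((cmod a)\<^sup>2 + (cmod b)\<^sup>2)) *\<^sub>R (a * cnj b)" .
  have "((cmod a / cmod b)\<^sup>2 - 1) / ((cmod a / cmod b)\<^sup>2 + 1)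
      = ((cmod a)\<^sup>2 - (cmod b)\<^sup>2) / ((cmod a)\<^sup>2 + (cmod b)\<^sup>2)"
    unfolding e2 add.commute[of "(cmod a / cmod b)\<^sup>2" 1] e1 using b2 by simp
  then show ?thesis using False 1
    by (simp add: proj_def stereo_def hsphere_def norm_divide)
qed

lemma proj_scale: "k \<noteq> 0 \<Longrightarrow> proj (k * a) (k * b) = proj a b"
  by (simp add: proj_def)

lemma proj_exists: obtains a b where "a \<noteq> 0 \<or> b \<noteq> 0" "z = proj a b"
  by (cases z) (metis proj_def one_neq_zero, metis proj_def div_by_1 one_neq_zero)

text \<open>For a finite point w the two entries are w and 1 times the same factor 2 / (1 + |w|^2),
  so this inverts \<open>stereo\<close> off the north pole.\<close>

lemma proj_north: "snd (stereo z) \<noteq> 1 \<Longrightarrow>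
    z = proj (fst (stereo z)) (of_real (1 - snd (stereo z)))"
proof (cases z)
  case (Some w)
  have pos: "1 + (cmod w)\<^sup>2 > 0" by (simp add: add_pos_nonneg)
  have h: "1 - snd (stereo z) = 2 / (1 + (cmod w)\<^sup>2)"
    using Some pos by (simp add: stereo_def field_simps)
  have "fst (stereo z) = of_real (2 / (1 + (cmod w)\<^sup>2)) * w"
    using Some by (simp add: stereo_def scaleR_conv_of_real)
  then have "proj (fst (stereo z)) (of_real (1 - snd (stereo z)))
      = proj (of_real (2 / (1 + (cmod w)\<^sup>2)) * w) (of_real (2 / (1 + (cmod w)\<^sup>2)) * 1)"
    using h by simp
  also have "\<dots> = proj w 1"
    using pos by (intro proj_scale) (simp add: complex_eq_iff less_imp_neq[symmetric])
  finally show ?thesis using Some by (simp add: proj_def)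
qed (simp add: stereo_def)

text \<open>The complementary chart: it covers infinity and omits only 0. Here the common factor of
  w and 1 is 2 cnj w / (1 + |w|^2).\<close>

lemma proj_south: "snd (stereo z) \<noteq> -1 \<Longrightarrow>
    z = proj (of_real (1 + snd (stereo z))) (cnj (fst (stereo z)))"
proof (cases z)
  case None
  then show ?thesis by (simp add: stereo_def proj_def)
next
  case (Some w)
  assume ne: "snd (stereo z) \<noteq> -1"
  have pos: "1 + (cmod w)\<^sup>2 > 0" by (simp add: add_pos_nonneg)
  have h: "1 + snd (stereo z) = 2 * (cmod w)\<^sup>2 / (1 + (cmod w)\<^sup>2)"
    using Some pos by (simp add: stereo_def field_simps)
  have w: "w \<noteq> 0" using ne h by auto
  have ww: "complex_of_real ((cmod w)\<^sup>2) = cnj w * w" by (simp only: complex_norm_square mult.commute)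
  have "complex_of_real (1 + snd (stereo z)) = (of_real (2 / (1 + (cmod w)\<^sup>2)) * cnj w) * w"
    unfolding h using ww by (simp add: field_simps)
  moreover have "cnj (fst (stereo z)) = (of_real (2 / (1 + (cmod w)\<^sup>2)) * cnj w) * 1"
    using Some by (simp add: stereo_def scaleR_conv_of_real)
  ultimately have "proj (of_real (1 + snd (stereo z))) (cnj (fst (stereo z)))
     = proj ((of_real (2 / (1 + (cmod w)\<^sup>2)) * cnj w) * w) ((of_real (2 / (1 + (cmod w)\<^sup>2)) * cnj w) * 1)"
    by simp
  also have "\<dots> = proj w 1"
    using pos w by (intro proj_scale) (simp add: complex_eq_iff less_imp_neq[symmetric])
  finally show ?thesis using Some by (simp add: proj_def)
qed

lemma stereo_inj: "stereo z = stereo w \<Longrightarrow> z = w"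
  by (metis proj_north proj_south one_neq_neg_one)

lemma continuous_hsphere:
  "a \<noteq> 0 \<or> b \<noteq> 0 \<Longrightarrow> isCont hsphere (a, b)"
  unfolding hsphere_def case_prod_beta
  by (intro continuous_intros) (auto simp: sum_power2_eq_zero_iff)

lemma chordal_commute: "chordal z w = chordal w z"
  by (simp add: chordal_def dist_commute)

lemma chordal_triangle: "chordal x z \<le> chordal x y + chordal y z"
  by (simp add: chordal_def dist_triangle)

lemma chordal_self [simp]: "chordal z z = 0"
  by (simp add: chordal_def)

lemma chordal_nonneg [simp]: "chordal z w \<ge> 0"
  by (simp add: chordal_def)

lemma chordal_eq_0: "chordal z w = 0 \<longleftrightarrow> z = w"
  using stereo_inj by (auto simp: chordal_def)

lemma stereo_circ:
  "stereo (circ t) = (of_real (sin (2 * pi * t)), - cos (2 * pi * t))"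
proof -
  have sc: "(sin (pi*t))\<^sup>2 + (cos (pi*t))\<^sup>2 = 1" by simp
  have "sin (pi*t) \<noteq> 0 \<or> cos (pi*t) \<noteq> 0" using sc by (metis power_zero_numeral add_0 zero_neq_one)
  then have "stereo (circ t) = hsphere (of_real (sin (pi*t)), of_real (cos (pi*t)))"
    unfolding circ_def by (intro stereo_proj) simp
  also have "\<dots> = (2 *\<^sub>R of_real (sin (pi*t) * cos (pi*t)), (sin (pi*t))\<^sup>2 - (cos (pi*t))\<^sup>2)"
    by (simp add: hsphere_def)
  also have "\<dots> = (of_real (sin (2 * pi * t)), - cos (2 * pi * t))"
    using sin_double[of "pi*t"] cos_double[of "pi*t"] by (simp add: scaleR_conv_of_real mult.assoc)
  finally show ?thesis .
qed

lemma chordal_circ: "chordal (circ s) (circ t) = 2 * \<bar>sin (pi * (s - t))\<bar>"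
proof -
  have "(chordal (circ s) (circ t))\<^sup>2 = (sin (2 * pi * s) - sin (2 * pi * t))\<^sup>2 + (cos (2 * pi * s) - cos (2 * pi * t))\<^sup>2"
    unfolding chordal_def stereo_circ dist_Pair_Pair
    by (simp add: dist_real_def power2_commute dist_norm flip: of_real_diff)
  also have "\<dots> = 2 - 2 * cos (2 * pi * s - 2 * pi * t)"
    unfolding cos_diff power2_diff
    using sin_cos_squared_add[of "2 * pi * s"] sin_cos_squared_add[of "2 * pi * t"]
    by (simp add: algebra_simps)
  also have "2 * pi * s - 2 * pi * t = 2 * (pi * (s - t))" by (simp add: algebra_simps)
  also have "2 - 2 * cos (2 * (pi*(s-t))) = (2 * \<bar>sin (pi * (s - t))\<bar>)\<^sup>2"
    by (simp add: power_mult_distrib cos_double cos_squared_eq)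
  finally show ?thesis by (subst (asm) power2_eq_iff_nonneg) auto
qed

text \<open>The chord length 2 |sin (pi (s - t))| is at most 2 pi |s - t|. The 8 is a crude bound
  for 2 pi and is the origin of the later scales \<open>e / 8\<close> and
  \<open>e / 32\<close>.\<close>

lemma chordal_circ_le: "chordal (circ s) (circ t) \<le> 8 * \<bar>s - t\<bar>"
proof -
  have "\<bar>sin (pi * (s - t))\<bar> \<le> \<bar>pi * (s - t)\<bar>" by (rule abs_sin_x_le_abs_x)
  also have "\<dots> = pi * \<bar>s - t\<bar>" by (simp add: abs_mult)
  also have "\<dots> \<le> 4 * \<bar>s - t\<bar>" using pi_less_4 by (intro mult_right_mono) auto
  finally show ?thesis unfolding chordal_circ by simp
qed

lemma circ_eq_iff: "circ s = circ t \<longleftrightarrow> (\<exists>m::int. s = t + of_int m)"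
proof -
  have "circ s = circ t \<longleftrightarrow> sin (pi * (s - t)) = 0"
    using chordal_eq_0[of "circ s" "circ t"] by (simp add: chordal_circ)
  also have "\<dots> \<longleftrightarrow> (\<exists>m::int. pi * (s - t) = of_int m * pi)"
    by (simp add: sin_zero_iff_int2)
  also have "\<dots> \<longleftrightarrow> (\<exists>m::int. s = t + of_int m)"
    by (simp add: mult.commute[of _ pi] diff_eq_eq add.commute)
  finally show ?thesis .
qed

lemma circ_add_int [simp]: "circ (t + of_int m) = circ t"
  by (auto simp: circ_eq_iff)

lemma circ_diff_int [simp]: "circ (t - of_int m) = circ t"
  using circ_add_int[of "t - of_int m" m] by simp

lemma chordal_circ_small:
  assumes "\<epsilon> > 0"
  obtains \<delta> where "\<delta> > 0" "\<And>s t. chordal (circ s) (circ t) < \<delta> \<Longrightarrow> \<exists>m::int. \<bar>s - t - of_int m\<bar> < \<epsilon>"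
proof -
  have "isCont arcsin 0" by (intro isCont_arcsin) auto
  then obtain d where d: "d > 0" "\<And>x. \<bar>x\<bar> < d \<Longrightarrow> \<bar>arcsin x\<bar> < pi * \<epsilon>"
    using assms unfolding continuous_at_eps_delta dist_real_def
    by (metis arcsin_0 diff_zero mult_pos_pos pi_gt_zero)
  show ?thesis
  proof (rule that[of "d"])
    fix s t assume a: "chordal (circ s) (circ t) < d"
    \<comment> \<open>Rounding leaves a remainder of at most 1/2, so that \<open>pi * x\<close>
      stays in the range where \<open>arcsin\<close> inverts \<open>sin\<close>.\<close>
    define m where "m = round (s - t)"
    define x where "x = s - t - of_int m"
    have x: "\<bar>x\<bar> \<le> 1/2" unfolding x_def m_def using of_int_round_abs_le[of "s-t"] by (simp add: abs_minus_commute)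
    have "circ s = circ (t + x)" unfolding x_def circ_eq_iff by (auto intro!: exI[of _ m])
    then have "2 * \<bar>sin (pi * x)\<bar> < d" using a by (simp add: chordal_circ)
    then have "\<bar>arcsin (sin (pi * x))\<bar> < pi * \<epsilon>" by (intro d) auto
    moreover have "arcsin (sin (pi * x)) = pi * x"
      proof (rule arcsin_sin)
      show "- (pi / 2) \<le> pi * x" using mult_left_mono[of "-1/2" x pi] x by (simp add: abs_le_iff)
      show "pi * x \<le> pi / 2" using mult_left_mono[of x "1/2" pi] x by (simp add: abs_le_iff)
    qed
    ultimately have "\<bar>x\<bar> < \<epsilon>" by (simp add: abs_mult)
    then show "\<exists>m::int. \<bar>s - t - of_int m\<bar> < \<epsilon>" unfolding x_def by blast
  qed (use d in auto)
qed

lemma circ_in_rhat [simp]: "circ t \<in> rhat"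
  unfolding circ_def rhat_def proj_def by (auto simp flip: of_real_divide)

lemma circ_surj:
  assumes "z \<in> rhat"
  obtains t where "0 \<le> t" "t < 1" "z = circ t"
proof -
  have "\<exists>t. z = circ t"
  proof (cases z)
    case None
    then have "z = circ (1/2)" by (simp add: circ_def proj_def)
    then show ?thesis ..
  next
    case (Some w)
    then obtain x where x: "w = complex_of_real x" using assms by (auto simp: rhat_def)
    have "z = circ (arctan x / pi)"
      using Some x cos_arctan_not_zero[of x] tan_arctan[of x] unfolding tan_def
      by (simp add: circ_def proj_def flip: of_real_divide)
    then show ?thesis ..
  qed
  then obtain t where "z = circ t" ..
  then have "z = circ (frac t)" unfolding circ_eq_iff by (simp add: frac_def circ_eq_iff[symmetric])
  then show ?thesis using that frac_lt_1 frac_ge_0 by blast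
qed

lemma continuous_stereo_circ: "continuous_on S (\<lambda>t. stereo (circ t))"
  unfolding stereo_circ by (intro continuous_intros)

section \<open>Rational maps in homogeneous coordinates\<close>

text \<open>Homogenization in degree \<open>d\<close>, which may exceed the degree of
  \<open>p\<close>: numerator and denominator are given the same degree, so that together they act
  on projective points.\<close>

definition hom :: "nat \<Rightarrow> real poly \<Rightarrow> complex \<Rightarrow> complex \<Rightarrow> complex" where
  "hom d p a b = (\<Sum>i\<le>d. of_real (coeff p i) * a ^ i * b ^ (d - i))"

abbreviation cpoly :: "real poly \<Rightarrow> complex poly" where
  "cpoly \<equiv> map_poly complex_of_real"

lemma cpoly_add: "cpoly (a + b) = cpoly a + cpoly b"
  by (intro poly_eqI) (simp add: coeff_map_poly)

lemma cpoly_mult: "cpoly (a * b) = cpoly a * cpoly b"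
  by (intro poly_eqI) (simp add: coeff_map_poly coeff_mult)

lemma hom_nonzero:
  assumes "b \<noteq> 0" "degree p \<le> d"
  shows "hom d p a b = b ^ d * poly (cpoly p) (a / b)"
proof -
  have "poly (cpoly p) (a / b) = (\<Sum>i\<le>d. of_real (coeff p i) * (a / b) ^ i)"
  proof -
    have "poly (cpoly p) (a / b) = (\<Sum>i\<le>degree p. of_real (coeff p i) * (a / b) ^ i)"
      by (simp add: poly_altdef coeff_map_poly degree_map_poly)
    also have "\<dots> = (\<Sum>i\<le>d. of_real (coeff p i) * (a / b) ^ i)"
      using assms(2) by (intro sum.mono_neutral_left) (auto simp: coeff_eq_0)
    finally show ?thesis .
  qed
  moreover have *: "of_real (coeff p i) * a ^ i * b ^ (d - i) = b ^ d * (of_real (coeff p i) * (a / b) ^ i)"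
    if "i \<le> d" for i
    using assms(1) that by (simp add: power_divide power_diff field_simps)
  have "hom d p a b = (\<Sum>i\<le>d. b ^ d * (of_real (coeff p i) * (a / b) ^ i))"
    unfolding hom_def by (intro sum.cong refl *) simp
  ultimately show ?thesis by (simp add: sum_distrib_left)
qed

lemma hom_infinity: "hom d p a 0 = of_real (coeff p d) * a ^ d"
  unfolding hom_def by (subst sum.remove[of _ d]) (auto intro!: sum.neutral)

lemma hom_of_real: "\<exists>r. hom d p (of_real a) (of_real b) = of_real r"
  unfolding hom_def by (intro exI[of _ "\<Sum>i\<le>d. coeff p i * a ^ i * b ^ (d - i)"]) simp

lemma continuous_hom [continuous_intros]:
  "continuous F a \<Longrightarrow> continuous F b \<Longrightarrow> continuous F (\<lambda>x. hom d p (a x) (b x))"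
  unfolding hom_def by (intro continuous_intros)

lemma continuous_on_hom [continuous_intros]:
  "continuous_on S a \<Longrightarrow> continuous_on S b \<Longrightarrow> continuous_on S (\<lambda>x. hom d p (a x) (b x))"
  unfolding hom_def by (intro continuous_intros)

lemma holomorphic_on_hom [holomorphic_intros]:
  "a holomorphic_on S \<Longrightarrow> b holomorphic_on S \<Longrightarrow> (\<lambda>x. hom d p (a x) (b x)) holomorphic_on S"
  unfolding hom_def by (intro holomorphic_intros)

lemma poly_bezout:
  fixes p q :: "'a::field poly"
  assumes "coprime p q"
  shows "\<exists>u v. u * p + v * q = 1"
  using assms
\<comment> \<open>The measure places \<open>q = 0\<close> strictly below the nonzero constants,
  which the degree alone does not.\<close>
proof (induction "if q = 0 then 0 else Suc (degree q)" arbitrary: p q rule: less_induct)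
  case less
  show ?case
  proof (cases "q = 0")
    case True
    then have "p dvd 1" using less.prems by simp
    then show ?thesis by (metis add.right_neutral dvdE mult.commute mult_zero_right)
  next
    case False
    have "coprime q (p mod q)"
      using less.prems False by (simp add: coprime_commute)
    moreover have "p mod q = 0 \<or> degree (p mod q) < degree q"
      using degree_mod_less[OF False] by blast
    ultimately obtain u v where "u * q + v * (p mod q) = 1"
      using less.hyps[of "p mod q" q] False by (cases "p mod q = 0") auto
    then have "u * q + v * (p - (p div q) * q) = 1"
      by (metis minus_div_mult_eq_mod)
    then have "v * p + (u - v * (p div q)) * q = 1" by (simp add: algebra_simps)
    then show ?thesis by blast
  qed
qed

locale rational_map =
  fixes p q :: "real poly" and d :: nat
  assumes coprime: "coprime p q" and q0: "q \<noteq> 0"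
    and deg: "d = max (degree p) (degree q)" and d2: "d \<ge> 2"
begin

abbreviation f where "f \<equiv> rat_map p q"

text \<open>A Bezout identity over the reals persists over the complex numbers and would read 0 = 1
  at a common root.\<close>

lemma no_common_root: "poly (cpoly p) w = 0 \<Longrightarrow> poly (cpoly q) w \<noteq> 0"
proof
  assume a: "poly (cpoly p) w = 0" "poly (cpoly q) w = 0"
  obtain u v where "u * p + v * q = 1"
    using poly_bezout[OF coprime] by blast
  then have "cpoly u * cpoly p + cpoly v * cpoly q = 1"
    by (metis cpoly_add cpoly_mult map_poly_1' of_real_1)
  then have "poly (cpoly u * cpoly p + cpoly v * cpoly q) w = 1" by simp
  then show False using a by simp
qed

lemma hom_no_common_zero:
  assumes "a \<noteq> 0 \<or> b \<noteq> 0"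
  shows "hom d p a b \<noteq> 0 \<or> hom d q a b \<noteq> 0"
proof (cases "b = 0")
  case True
  have "coeff p d \<noteq> 0 \<or> coeff q d \<noteq> 0"
    using deg d2 by (metis leading_coeff_0_iff degree_0 max_def not_numeral_le_zero)
  then show ?thesis using True assms by (simp add: hom_infinity)
next
  case False
  then show ?thesis using no_common_root[of "a/b"] deg by (simp add: hom_nonzero)
qed

lemma rat_map_proj:
  assumes "a \<noteq> 0 \<or> b \<noteq> 0"
  shows "f (proj a b) = proj (hom d p a b) (hom d q a b)"
proof (cases "b = 0")
  case True
  consider "degree p > degree q" | "degree p = degree q" | "degree p < degree q" by linarith
  then show ?thesis
  proof cases
    case 1
    then have "coeff q d = 0" using deg by (intro coeff_eq_0) auto
    then show ?thesis using True 1 by (simp add: proj_def rat_map_def hom_infinity)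
  next
    case 2
    then show ?thesis using True assms q0 deg by (auto simp: proj_def rat_map_def hom_infinity)
  next
    case 3
    then have "coeff p d = 0" "coeff q d \<noteq> 0" using deg q0 by (auto intro: coeff_eq_0)
    then show ?thesis using True assms 3 by (auto simp: proj_def rat_map_def hom_infinity)
  qed
next
  case False
  then show ?thesis using deg by (simp add: proj_def rat_map_def hom_nonzero)
qed

text \<open>A finite value c is taken at the roots of p - c q. Were this polynomial zero, either
  \<open>p\<close> and \<open>q\<close> would both be constant, against \<open>d2\<close>, or a
  complex root of \<open>q\<close> would be a common root.\<close>

lemma finite_fibre: "finite {z. f z = v}"
proof -
  have *: "\<exists>r. r \<noteq> 0 \<and> (\<forall>w. f (Some w) = v \<longrightarrow> poly r w = 0)"
  proof (cases v)
    case None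
    then show ?thesis using q0 by (intro exI[of _ "cpoly q"]) (auto simp: rat_map_def map_poly_eq_0_iff)
  next
    case (Some c)
    have "cpoly p - smult c (cpoly q) \<noteq> 0"
    proof
      assume "cpoly p - smult c (cpoly q) = 0"
      then have e: "cpoly p = smult c (cpoly q)" by simp
      show False
      proof (cases "degree q = 0")
        case True
        then have "degree (cpoly p) = 0" unfolding e
          by (metis degree_map_poly degree_smult_le le_zero_eq of_real_eq_0_iff)
        then show False using True deg d2 by (simp add: degree_map_poly)
      next
        case False
        then have "degree (cpoly q) \<noteq> 0" by (simp add: degree_map_poly)
        then obtain w where "poly (cpoly q) w = 0"
          using fundamental_theorem_of_algebra_alt[of "cpoly q"] by (metis degree_pCons_0)
        then show False using e no_common_root[of w] by simp
      qed
    qed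
    then show ?thesis using Some
      by (intro exI[of _ "cpoly p - smult c (cpoly q)"]) (auto simp: rat_map_def field_simps split: if_splits)
  qed
  then obtain r where r: "r \<noteq> 0" "\<And>w. f (Some w) = v \<Longrightarrow> poly r w = 0" by blast
  have "{z. f z = v} \<subseteq> insert None (Some ` {w. poly r w = 0})"
    using r(2) by (auto simp: image_iff) (metis option.exhaust)
  then show ?thesis using poly_roots_finite[OF r(1)] finite_subset by blast
qed

text \<open>Substitution into the homogeneous forms keeps the pair free of common zeros, with no
  bookkeeping of degrees. Nothing is said about the iterate at infinity; that value is recovered
  later by continuity.\<close>

lemma iterate_polys:
  "\<exists>A B :: complex poly. \<forall>w. (poly A w \<noteq> 0 \<or> poly B w \<noteq> 0) \<and> (f ^^ k) (Some w) = proj (poly A w) (poly B w)"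
proof (induction k)
  case 0
  show ?case by (intro exI[of _ "[:0, 1:]"] exI[of _ "1"]) (simp add: proj_def)
next
  case (Suc k)
  then obtain A B where AB: "\<And>w. poly A w \<noteq> 0 \<or> poly B w \<noteq> 0"
      "\<And>w. (f ^^ k) (Some w) = proj (poly A w) (poly B w)" by blast
  let ?H = "\<lambda>r. (\<Sum>i\<le>d. smult (of_real (coeff r i)) (A ^ i * B ^ (d - i)))"
  have "poly (?H r) w = hom d r (poly A w) (poly B w)" for r w
    by (simp add: hom_def poly_sum mult.assoc)
  then show ?case
    using hom_no_common_zero[OF AB(1)] rat_map_proj[OF AB(1)] AB(2)
    by (intro exI[of _ "?H p"] exI[of _ "?H q"]) simp
qed

text \<open>On each of the two hemispherical charts the map lifts to a map of homogeneous coordinates.\<close>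

lemma stereo_rat_map_continuous:
  "\<exists>\<Psi>. isCont \<Psi> (stereo z) \<and> (\<forall>\<^sub>F y in nhds (stereo z). \<forall>v. stereo v = y \<longrightarrow> stereo (f v) = \<Psi> y)"
proof (cases "snd (stereo z) = 1")
  case False
  define \<Psi> where "\<Psi> = (\<lambda>y::complex \<times> real. hsphere (hom d p (fst y) (of_real (1 - snd y)), hom d q (fst y) (of_real (1 - snd y))))"
  have nz: "hom d p a (of_real (1 - h)) \<noteq> 0 \<or> hom d q a (of_real (1 - h)) \<noteq> 0" if "h \<noteq> 1" for a and h :: real
    using that by (intro hom_no_common_zero) (simp add: complex_eq_iff)
  have "isCont \<Psi> (stereo z)" unfolding \<Psi>_def
    by (rule isCont_o2[where g = hsphere])
       (use nz[OF False] in \<open>auto intro!: continuous_intros continuous_hsphere\<close>)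
  moreover have "stereo (f v) = \<Psi> (stereo v)" if "snd (stereo v) \<noteq> 1" for v
  proof -
    have "f v = f (proj (fst (stereo v)) (of_real (1 - snd (stereo v))))" using proj_north[OF that] by simp
    also have "\<dots> = proj (hom d p (fst (stereo v)) (of_real (1 - snd (stereo v)))) (hom d q (fst (stereo v)) (of_real (1 - snd (stereo v))))"
      using that by (intro rat_map_proj) (simp add: complex_eq_iff)
    finally show ?thesis unfolding \<Psi>_def using stereo_proj[OF nz[OF that]] by simp
  qed
  moreover have "\<forall>\<^sub>F y in nhds (stereo z). snd y \<noteq> 1"
    using False by (intro eventually_nhds_in_open[of "{y. snd y \<noteq> 1}", simplified])
      (auto intro!: open_Collect_neq continuous_intros)
  ultimately show ?thesis by (auto intro!: exI[of _ \<Psi>] elim!: eventually_mono)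
next
  case True
  then have ne: "snd (stereo z) \<noteq> -1" by simp
  define \<Psi> where "\<Psi> = (\<lambda>y::complex \<times> real. hsphere (hom d p (of_real (1 + snd y)) (cnj (fst y)), hom d q (of_real (1 + snd y)) (cnj (fst y))))"
  have nz: "hom d p (of_real (1 + h)) a \<noteq> 0 \<or> hom d q (of_real (1 + h)) a \<noteq> 0" if "h \<noteq> -1" for a and h :: real
    using that by (intro hom_no_common_zero) (auto simp: complex_eq_iff)
  have "isCont \<Psi> (stereo z)" unfolding \<Psi>_def
    by (rule isCont_o2[where g = hsphere])
       (use nz[OF ne] in \<open>auto intro!: continuous_intros continuous_hsphere\<close>)
  moreover have "stereo (f v) = \<Psi> (stereo v)" if "snd (stereo v) \<noteq> -1" for v
  proof -
    have "f v = f (proj (of_real (1 + snd (stereo v))) (cnj (fst (stereo v))))" using proj_south[OF that] by simp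
    also have "\<dots> = proj (hom d p (of_real (1 + snd (stereo v))) (cnj (fst (stereo v)))) (hom d q (of_real (1 + snd (stereo v))) (cnj (fst (stereo v))))"
      using that by (intro rat_map_proj) (auto simp: complex_eq_iff)
    finally show ?thesis unfolding \<Psi>_def using stereo_proj[OF nz[OF that]] by simp
  qed
  moreover have "\<forall>\<^sub>F y in nhds (stereo z). snd y \<noteq> -1"
    using ne by (intro eventually_nhds_in_open[of "{y. snd y \<noteq> -1}", simplified])
      (auto intro!: open_Collect_neq continuous_intros)
  ultimately show ?thesis by (auto intro!: exI[of _ \<Psi>] elim!: eventually_mono)
qed

lemma rat_map_continuous:
  assumes "e > 0"
  obtains \<delta> where "\<delta> > 0" "\<And>v. chordal v z < \<delta> \<Longrightarrow> chordal (f v) (f z) < e"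
proof -
  obtain \<Psi> where \<Psi>: "isCont \<Psi> (stereo z)"
    "\<forall>\<^sub>F y in nhds (stereo z). \<forall>v. stereo v = y \<longrightarrow> stereo (f v) = \<Psi> y"
    using stereo_rat_map_continuous by blast
  obtain d1 where d1: "d1 > 0" "\<And>y. dist y (stereo z) < d1 \<Longrightarrow> \<forall>v. stereo v = y \<longrightarrow> stereo (f v) = \<Psi> y"
    using \<Psi>(2) unfolding eventually_nhds_metric by blast
  obtain d2 where d2: "d2 > 0" "\<And>y. dist y (stereo z) < d2 \<Longrightarrow> dist (\<Psi> y) (\<Psi> (stereo z)) < e"
    using \<Psi>(1) assms unfolding continuous_at_eps_delta by blast
  show ?thesis
  proof (rule that[of "min d1 d2"])
    fix v assume v: "chordal v z < min d1 d2"
    then have "stereo (f v) = \<Psi> (stereo v)" "stereo (f z) = \<Psi> (stereo z)"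
      using d1(2)[of "stereo v"] d1(2)[of "stereo z"] d1(1) by (auto simp: chordal_def)
    then show "chordal (f v) (f z) < e" using d2(2)[of "stereo v"] v by (auto simp: chordal_def)
  qed (use d1 d2 in auto)
qed

lemma rat_map_iterate_continuous:
  assumes "e > 0"
  obtains \<delta> where "\<delta> > 0" "\<And>v. chordal v z < \<delta> \<Longrightarrow> chordal ((f ^^ k) v) ((f ^^ k) z) < e"
proof -
  have "\<exists>\<delta>>0. \<forall>v. chordal v z < \<delta> \<longrightarrow> chordal ((f ^^ k) v) ((f ^^ k) z) < e"
    using assms
  proof (induction k arbitrary: e)
    case 0
    then show ?case by auto
  next
    case (Suc k)
    obtain \<delta> where \<delta>: "\<delta> > 0" "\<And>v. chordal v ((f ^^ k) z) < \<delta> \<Longrightarrow> chordal (f v) (f ((f ^^ k) z)) < e"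
      using rat_map_continuous[OF Suc.prems] by blast
    then show ?case using Suc.IH[OF \<delta>(1)] by auto
  qed
  then show ?thesis using that by blast
qed

end

section \<open>Complete invariance of the Julia set\<close>

lemma near_proj_affine:
  fixes c :: complex
  assumes "\<eta> > 0"
  obtains \<delta> where "\<delta> > 0" "\<And>v. chordal v (proj c 1) < \<delta> \<Longrightarrow> \<exists>c'. dist c' c < \<eta> \<and> v = proj c' 1"
proof -
  have ne: "snd (stereo (Some c)) \<noteq> 1"
    by (simp add: stereo_def divide_eq_eq add_nonneg_eq_0_iff)
  have pr: "proj c 1 = Some c" by (simp add: proj_def)
  define \<Phi> where "\<Phi> = (\<lambda>y::complex \<times> real. fst y / of_real (1 - snd y))"
  have v: "v = proj (\<Phi> (stereo v)) 1" if "snd (stereo v) \<noteq> 1" for v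
    using proj_north[OF that] that by (simp add: proj_def \<Phi>_def complex_eq_iff)
  have "isCont \<Phi> (stereo (Some c))"
    unfolding \<Phi>_def using ne by (intro continuous_intros) (auto simp: complex_eq_iff)
  then obtain d1 where d1: "d1 > 0" "\<And>y. dist y (stereo (Some c)) < d1 \<Longrightarrow> dist (\<Phi> y) (\<Phi> (stereo (Some c))) < \<eta>"
    using assms unfolding continuous_at_eps_delta by blast
  have \<Phi>c: "\<Phi> (stereo (Some c)) = c" using v[OF ne] by (simp add: proj_def)
  have "open {y::complex \<times> real. snd y \<noteq> 1}"
    by (intro open_Collect_neq continuous_intros)
  then obtain d2 where "d2 > 0" "ball (stereo (Some c)) d2 \<subseteq> {y. snd y \<noteq> 1}"
    using ne by (metis mem_Collect_eq openE)
  then have d2: "d2 > 0" "\<And>y. dist y (stereo (Some c)) < d2 \<Longrightarrow> snd y \<noteq> 1"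
    by (auto simp: subset_iff dist_commute)
  show ?thesis
  proof (rule that[of "min d1 d2"])
    fix v assume "chordal v (proj c 1) < min d1 d2"
    then have "dist (stereo v) (stereo (Some c)) < d1" "snd (stereo v) \<noteq> 1"
      using d2(2) by (auto simp: pr chordal_def)
    then show "\<exists>c'. dist c' c < \<eta> \<and> v = proj c' 1"
      using d1(2)[of "stereo v"] v[of v] \<Phi>c by (metis (no_types))
  qed (use d1 d2 in auto)
qed

definition sphere_inv :: "complex option \<Rightarrow> complex option" where
  "sphere_inv z = (case z of None \<Rightarrow> Some 0 | Some w \<Rightarrow> if w = 0 then None else Some (1 / w))"

lemma sphere_inv_proj: "a \<noteq> 0 \<or> b \<noteq> 0 \<Longrightarrow> sphere_inv (proj a b) = proj b a"
  by (auto simp: sphere_inv_def proj_def)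

text \<open>On the sphere the inversion is conjugation of the first coordinate combined with
  reflection of the height. Being an isometry, it transfers the open mapping property from finite
  values to infinite ones.\<close>

lemma chordal_sphere_inv: "chordal (sphere_inv z) (sphere_inv w) = chordal z w"
proof -
  have *: "stereo (sphere_inv z) = (cnj (fst (stereo z)), - snd (stereo z))" for z
  proof -
    obtain a b where ab: "a \<noteq> 0 \<or> b \<noteq> 0" "z = proj a b" by (rule proj_exists)
    then have "stereo (sphere_inv z) = hsphere (b, a)" "stereo z = hsphere (a, b)"
      using stereo_proj[of b a] stereo_proj[of a b] by (auto simp: sphere_inv_proj)
    then show ?thesis by (simp add: hsphere_def add.commute mult.commute minus_divide_left)
  qed
  have "dist (cnj x, - s) (cnj y, - t) = dist (x, s) (y, t)" for x y and s t :: real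
    unfolding dist_Pair_Pair by (simp add: dist_norm abs_minus_commute flip: complex_cnj_diff)
  then show ?thesis unfolding chordal_def * by simp
qed

lemma chordal_proj_eventually:
  fixes a b :: "complex \<Rightarrow> complex"
  assumes "isCont a x" "isCont b x" "a x \<noteq> 0 \<or> b x \<noteq> 0" "\<epsilon> > 0"
  shows "\<forall>\<^sub>F y in nhds x. chordal (proj (a y) (b y)) (proj (a x) (b x)) < \<epsilon>"
proof -
  have c: "isCont (\<lambda>y. (a y, b y)) x" using assms by (intro continuous_intros)
  have "isCont (\<lambda>y. hsphere (a y, b y)) x"
    using isCont_o2[OF c continuous_hsphere[OF assms(3)]] .
  then have "\<forall>\<^sub>F y in nhds x. dist (hsphere (a y, b y)) (hsphere (a x, b x)) < \<epsilon>"
    using assms(4) unfolding continuous_at_eps_delta eventually_nhds_metric by metis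
  moreover have "open (- {(0::complex, 0::complex)})" by auto
  then have "\<forall>\<^sub>F y in nhds x. (a y, b y) \<in> - {(0,0)}"
    using c assms(3) tendsto_at_iff_tendsto_nhds[of "\<lambda>y. (a y, b y)" x]
    by (intro topological_tendstoD[where l = "(a x, b x)"]) (auto simp: continuous_at)
  ultimately show ?thesis
  proof eventually_elim
    case (elim y)
    then show ?case using stereo_proj[of "a y" "b y"] stereo_proj[OF assms(3)] by (auto simp: chordal_def)
  qed
qed

lemma fatouE:
  assumes "z \<in> fatou f"
  obtains U where "z \<in> U" "\<And>w. w \<in> U \<Longrightarrow> \<exists>r>0. {u. chordal u w < r} \<subseteq> U"
    "\<And>w e. w \<in> U \<Longrightarrow> e > 0 \<Longrightarrow> \<exists>\<delta>>0. \<forall>n. \<forall>u\<in>U. chordal u w < \<delta> \<longrightarrow> chordal ((f ^^ n) u) ((f ^^ n) w) < e"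
proof -
  from assms obtain U where U: "z \<in> U \<and> (\<forall>w\<in>U. \<exists>r>0. {u. chordal u w < r} \<subseteq> U) \<and>
      (\<forall>w\<in>U. \<forall>e>0. \<exists>\<delta>>0. \<forall>n. \<forall>u\<in>U. chordal u w < \<delta> \<longrightarrow>
          chordal ((f ^^ n) u) ((f ^^ n) w) < e)"
    unfolding fatou_def by (elim CollectE exE)
  show thesis
    by (rule that[OF conjunct1[OF U] bspec[OF conjunct1[OF conjunct2[OF U]]]
          bspec[OF conjunct2[OF conjunct2[OF U]], THEN spec, THEN mp]])
qed

lemma fatouI:
  assumes "z \<in> U" "\<And>w. w \<in> U \<Longrightarrow> \<exists>r>0. {u. chordal u w < r} \<subseteq> U"
    "\<And>w e. w \<in> U \<Longrightarrow> e > 0 \<Longrightarrow> \<exists>\<delta>>0. \<forall>n. \<forall>u\<in>U. chordal u w < \<delta> \<longrightarrow> chordal ((f ^^ n) u) ((f ^^ n) w) < e"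
  shows "z \<in> fatou f"
  unfolding fatou_def by (intro CollectI exI[of _ U] conjI ballI allI impI assms)

context rational_map begin

text \<open>Finite fibres prevent the quotient of \<open>A\<close> and \<open>B\<close> from being
  constant on a ball, so the open mapping theorem applies to it.\<close>

lemma open_at_in_chart:
  fixes A B :: "complex \<Rightarrow> complex" and \<gamma> :: "complex \<Rightarrow> complex option"
  assumes hol: "A holomorphic_on UNIV" "B holomorphic_on UNIV"
    and inj: "inj \<gamma>" and cont: "\<forall>\<^sub>F w in nhds w0. chordal (\<gamma> w) (\<gamma> w0) < \<epsilon>"
    and g: "\<And>w. g (\<gamma> w) = proj (A w) (B w)"
    and fin: "\<And>v. finite {z. g z = v}"
    and nz: "B w0 \<noteq> 0"
  obtains \<delta> where "\<delta> > 0" "\<And>v. chordal v (g (\<gamma> w0)) < \<delta> \<Longrightarrow> \<exists>z. chordal z (\<gamma> w0) < \<epsilon> \<and> g z = v"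
proof -
  have "open {w. B w \<noteq> 0}"
    using holomorphic_on_imp_continuous_on[OF hol(2)] by (intro open_Collect_neq) auto
  then have "\<forall>\<^sub>F w in nhds w0. B w \<noteq> 0" using nz eventually_nhds_in_open[of "{w. B w \<noteq> 0}" w0] by simp
  with cont have "\<forall>\<^sub>F w in nhds w0. B w \<noteq> 0 \<and> chordal (\<gamma> w) (\<gamma> w0) < \<epsilon>" by eventually_elim auto
  then obtain r where r: "r > 0" "\<And>w. w \<in> ball w0 r \<Longrightarrow> B w \<noteq> 0 \<and> chordal (\<gamma> w) (\<gamma> w0) < \<epsilon>"
    unfolding eventually_nhds_metric by (auto simp: dist_commute)
  let ?h = "\<lambda>w. A w / B w"
  have "?h holomorphic_on ball w0 r"
    using r hol by (intro holomorphic_intros) (auto intro: holomorphic_on_subset)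
  moreover have "\<not> ?h constant_on ball w0 r"
  proof
    assume "?h constant_on ball w0 r"
    then obtain c where c: "\<And>w. w \<in> ball w0 r \<Longrightarrow> ?h w = c" unfolding constant_on_def by blast
    have "\<gamma> ` ball w0 r \<subseteq> {z. g z = Some c}" using c r by (auto simp: g proj_def)
    then have "finite (\<gamma> ` ball w0 r)" using fin finite_subset by blast
    then have "finite (ball w0 r)" using inj by (simp add: finite_image_iff inj_on_subset)
    moreover have "w0 islimpt ball w0 r" using r(1) by (simp add: open_imp_islimpt)
    ultimately show False using islimpt_finite by blast
  qed
  ultimately have "open (?h ` ball w0 r)"
    by (intro open_mapping_thm[of ?h "ball w0 r" "ball w0 r"]) auto
  moreover have "?h w0 \<in> ?h ` ball w0 r" using r(1) by simp
  ultimately obtain \<eta> where \<eta>: "\<eta> > 0" "\<And>c. dist c (?h w0) < \<eta> \<Longrightarrow> c \<in> ?h ` ball w0 r"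
    unfolding open_dist by blast
  have gw: "g (\<gamma> w) = proj (?h w) 1" if "B w \<noteq> 0" for w using that by (simp add: g proj_def)
  obtain \<delta> where \<delta>: "\<delta> > 0" "\<And>v. chordal v (proj (?h w0) 1) < \<delta> \<Longrightarrow> \<exists>c'. dist c' (?h w0) < \<eta> \<and> v = proj c' 1"
    using near_proj_affine[OF \<eta>(1)] by blast
  show ?thesis
  proof (rule that[OF \<delta>(1)])
    fix v assume "chordal v (g (\<gamma> w0)) < \<delta>"
    then obtain c where c: "dist c (?h w0) < \<eta>" "v = proj c 1" using \<delta>(2)[of v] gw[OF nz] by auto
    then obtain w where "w \<in> ball w0 r" "c = ?h w" using \<eta>(2) by blast
    then show "\<exists>z. chordal z (\<gamma> w0) < \<epsilon> \<and> g z = v"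
      using r(2)[of w] gw[of w] c by blast
  qed
qed

lemma rat_map_open:
  assumes "\<epsilon> > 0"
  obtains \<delta> where "\<delta> > 0" "\<And>v. chordal v (f z) < \<delta> \<Longrightarrow> \<exists>u. chordal u z < \<epsilon> \<and> f u = v"
proof -
  note result = that
  have *: thesis
    if hol: "a holomorphic_on UNIV" "b holomorphic_on UNIV" and nz: "\<And>w. a w \<noteq> 0 \<or> b w \<noteq> 0"
      and inj: "inj (\<lambda>w. proj (a w) (b w))" and z: "z = proj (a w0) (b w0)" for a b w0
  proof -
    let ?A = "\<lambda>w. hom d p (a w) (b w)" and ?B = "\<lambda>w. hom d q (a w) (b w)"
    let ?\<gamma> = "\<lambda>w. proj (a w) (b w)"
    have holAB: "?A holomorphic_on UNIV" "?B holomorphic_on UNIV" using hol by (auto intro!: holomorphic_intros)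
    have cab: "isCont a w0" "isCont b w0"
      using hol by (auto dest!: holomorphic_on_imp_continuous_on simp: continuous_on_eq_continuous_at)
    have cont: "\<forall>\<^sub>F w in nhds w0. chordal (?\<gamma> w) (?\<gamma> w0) < \<epsilon>"
      by (intro chordal_proj_eventually cab nz assms)
    have g: "f (?\<gamma> w) = proj (?A w) (?B w)" for w by (rule rat_map_proj[OF nz])
    \<comment> \<open>Either \<open>f\<close> or its inversion has a finite value at the point; the
      chart lemma is applied to that one.\<close>
    consider "?B w0 \<noteq> 0" | "?A w0 \<noteq> 0" using hom_no_common_zero[OF nz] by blast
    then show thesis
    proof cases
      case 1
      show thesis
        by (rule open_at_in_chart[OF holAB inj cont g finite_fibre 1]) (rule result, auto simp: z)
    next
      case 2
      let ?g = "\<lambda>z. sphere_inv (f z)"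
      have inv: "sphere_inv (sphere_inv y) = y" for y by (auto simp: sphere_inv_def split: option.splits)
      have g': "?g (?\<gamma> w) = proj (?B w) (?A w)" for w
        unfolding g using hom_no_common_zero[OF nz] by (intro sphere_inv_proj)
      have "{z. ?g z = v} = {z. f z = sphere_inv v}" for v using inv by metis
      then have fin: "finite {z. ?g z = v}" for v using finite_fibre by simp
      obtain \<delta> where \<delta>: "\<delta> > 0" "\<And>v. chordal v (?g (?\<gamma> w0)) < \<delta> \<Longrightarrow> \<exists>z. chordal z (?\<gamma> w0) < \<epsilon> \<and> ?g z = v"
        using open_at_in_chart[OF holAB(2,1) inj cont g' fin 2] by blast
      show thesis
      proof (rule result[OF \<delta>(1)])
        fix v assume "chordal v (f z) < \<delta>"
        then have "chordal (sphere_inv v) (?g (?\<gamma> w0)) < \<delta>" by (simp add: chordal_sphere_inv z)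
        then obtain u where "chordal u (?\<gamma> w0) < \<epsilon>" "?g u = sphere_inv v" using \<delta>(2) by blast
        then show "\<exists>u. chordal u z < \<epsilon> \<and> f u = v" unfolding z using inv by metis
      qed
    qed
  qed
  show thesis
  proof (cases z)
    case None
    show thesis
    proof (rule *[of "\<lambda>_. 1" "\<lambda>w. w" 0])
      show "inj (\<lambda>w::complex. proj 1 w)" by (rule injI) (auto simp: proj_def split: if_splits)
    qed (use None in \<open>auto simp: proj_def\<close>)
  next
    case (Some w)
    show thesis
    proof (rule *[of "\<lambda>w. w" "\<lambda>_. 1" w])
      show "inj (\<lambda>w::complex. proj w 1)" by (rule injI) (auto simp: proj_def)
    qed (use Some in \<open>auto simp: proj_def\<close>)
  qed
qed

text \<open>Backwards, the preimage of an equicontinuity neighbourhood works by continuity.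
  Forwards, its image works because \<open>f\<close> is open, which provides preimages close to the
  given point.\<close>

lemma fatou_iff: "f z \<in> fatou f \<longleftrightarrow> z \<in> fatou f"
proof
  assume "f z \<in> fatou f"
  then obtain U where U: "f z \<in> U" "\<And>w. w \<in> U \<Longrightarrow> \<exists>r>0. {u. chordal u w < r} \<subseteq> U"
    "\<And>w e. w \<in> U \<Longrightarrow> e > 0 \<Longrightarrow> \<exists>\<delta>>0. \<forall>n. \<forall>u\<in>U. chordal u w < \<delta> \<longrightarrow> chordal ((f ^^ n) u) ((f ^^ n) w) < e"
    by (rule fatouE) blast
  let ?V = "f -` U"
  have "\<exists>r>0. {u. chordal u w < r} \<subseteq> ?V" if w: "w \<in> ?V" for w
  proof -
    obtain r where r: "r > 0" "{u. chordal u (f w) < r} \<subseteq> U" using U(2) w by blast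
    obtain \<delta> where \<delta>: "\<delta> > 0" "\<And>v. chordal v w < \<delta> \<Longrightarrow> chordal (f v) (f w) < r"
      using rat_map_continuous[OF r(1)] by blast
    show ?thesis using \<delta> r by blast
  qed
  moreover have "\<exists>\<delta>>0. \<forall>n. \<forall>u\<in>?V. chordal u w < \<delta> \<longrightarrow> chordal ((f ^^ n) u) ((f ^^ n) w) < e"
    if w: "w \<in> ?V" "e > 0" for w e
  proof -
    obtain r where r: "r > 0" "\<And>n u. u \<in> U \<Longrightarrow> chordal u (f w) < r \<Longrightarrow> chordal ((f ^^ n) u) ((f ^^ n) (f w)) < e"
      using U(3)[of "f w" e] w by blast
    obtain \<delta> where \<delta>: "\<delta> > 0" "\<And>v. chordal v w < \<delta> \<Longrightarrow> chordal (f v) (f w) < r"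
      using rat_map_continuous[OF r(1)] by blast
    \<comment> \<open>The bound by \<open>e\<close> serves n = 0, the only iterate that does not
      pass through \<open>U\<close>.\<close>
    have "chordal ((f ^^ n) u) ((f ^^ n) w) < e" if "u \<in> ?V" "chordal u w < min \<delta> e" for n u
    proof (cases n)
      case (Suc k)
      then show ?thesis using r(2)[of "f u" k] \<delta>(2)[of u] that by (simp add: funpow_swap1)
    qed (use that in simp)
    then show ?thesis using \<delta>(1) w(2) by (intro exI[of _ "min \<delta> e"]) auto
  qed
  moreover have "z \<in> ?V" using U(1) by simp
  ultimately show "z \<in> fatou f" by (intro fatouI[of z ?V])
next
  assume "z \<in> fatou f"
  then obtain U where U: "z \<in> U" "\<And>w. w \<in> U \<Longrightarrow> \<exists>r>0. {u. chordal u w < r} \<subseteq> U"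
    "\<And>w e. w \<in> U \<Longrightarrow> e > 0 \<Longrightarrow> \<exists>\<delta>>0. \<forall>n. \<forall>u\<in>U. chordal u w < \<delta> \<longrightarrow> chordal ((f ^^ n) u) ((f ^^ n) w) < e"
    by (rule fatouE) blast
  let ?V = "f ` U"
  have "\<exists>r>0. {u. chordal u v < r} \<subseteq> ?V" if v: "v \<in> ?V" for v
  proof -
    obtain w where w: "w \<in> U" "v = f w" using v by blast
    obtain r where r: "r > 0" "{u. chordal u w < r} \<subseteq> U" using U(2) w by blast
    obtain \<delta> where \<delta>: "\<delta> > 0" "\<And>v. chordal v (f w) < \<delta> \<Longrightarrow> \<exists>u. chordal u w < r \<and> f u = v"
      using rat_map_open[OF r(1)] by blast
    show ?thesis using \<delta> r w(2) by blast
  qed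
  moreover have "\<exists>\<delta>>0. \<forall>n. \<forall>u\<in>?V. chordal u v < \<delta> \<longrightarrow> chordal ((f ^^ n) u) ((f ^^ n) v) < e"
    if v: "v \<in> ?V" "e > 0" for v e
  proof -
    obtain w where w: "w \<in> U" "v = f w" using v by blast
    obtain r1 where r1: "r1 > 0" "{u. chordal u w < r1} \<subseteq> U" using U(2) w by blast
    obtain r where r: "r > 0" "\<And>n u. u \<in> U \<Longrightarrow> chordal u w < r \<Longrightarrow> chordal ((f ^^ n) u) ((f ^^ n) w) < e"
      using U(3)[of w e] w v by blast
    obtain \<delta> where \<delta>: "\<delta> > 0" "\<And>v. chordal v (f w) < \<delta> \<Longrightarrow> \<exists>u. chordal u w < min r r1 \<and> f u = v"
      using rat_map_open[of "min r r1"] r(1) r1(1) by auto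
    have "chordal ((f ^^ n) u) ((f ^^ n) v) < e" if "chordal u v < \<delta>" for n u
    proof -
      have "\<exists>u'. chordal u' w < min r r1 \<and> f u' = u" using \<delta>(2) that w by simp
      then obtain u' where u': "chordal u' w < min r r1" "f u' = u" by blast
      then have "chordal ((f ^^ Suc n) u') ((f ^^ Suc n) w) < e" using r1 by (intro r(2)) auto
      then show ?thesis using u'(2) w(2) by (simp add: funpow_swap1)
    qed
    then show ?thesis using \<delta>(1) by blast
  qed
  moreover have "f z \<in> ?V" using U(1) by simp
  ultimately show "f z \<in> fatou f" by (intro fatouI[of "f z" ?V])
qed

lemma julia_iff: "f z \<in> julia f \<longleftrightarrow> z \<in> julia f"
  by (simp add: julia_def fatou_iff)

lemma fatou_open: "z \<in> fatou f \<Longrightarrow> \<exists>r>0. {u. chordal u z < r} \<subseteq> fatou f"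
proof (erule fatouE)
  fix U assume U: "z \<in> U" "\<And>w. w \<in> U \<Longrightarrow> \<exists>r>0. {u. chordal u w < r} \<subseteq> U"
    "\<And>w e. w \<in> U \<Longrightarrow> e > 0 \<Longrightarrow> \<exists>\<delta>>0. \<forall>n. \<forall>u\<in>U. chordal u w < \<delta> \<longrightarrow> chordal ((f ^^ n) u) ((f ^^ n) w) < e"
  obtain r where r: "r > 0" "{u. chordal u z < r} \<subseteq> U" using U(2)[OF U(1)] by blast
  have "u \<in> fatou f" if "u \<in> U" for u by (rule fatouI[OF that U(2,3)])
  then show "\<exists>r>0. {u. chordal u z < r} \<subseteq> fatou f" using r by (intro exI[of _ r]) auto
qed

text \<open>There are at most n different iterates, and a finite family of continuous maps is
  equicontinuous.\<close>

lemma iterate_id_julia_empty: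
  assumes n: "n \<ge> 1" and id: "\<And>z. (f ^^ n) z = z"
  shows "julia f = {}"
proof -
  have m: "(f ^^ k) z = (f ^^ (k mod n)) z" for k z
  proof -
    have "((f ^^ n) ^^ j) z = z" for j z by (induction j) (auto simp: id)
    then have "(f ^^ (n * (k div n))) z = z" for z by (simp add: funpow_mult)
    then show ?thesis by (metis comp_apply funpow_add mod_mult_div_eq)
  qed
  have "\<exists>\<delta>>0. \<forall>k u. chordal u w < \<delta> \<longrightarrow> chordal ((f ^^ k) u) ((f ^^ k) w) < e" if e: "e > 0" for w e
  proof -
    have "\<exists>\<delta>>0. \<forall>u. chordal u w < \<delta> \<longrightarrow> chordal ((f ^^ k) u) ((f ^^ k) w) < e" for k
      using rat_map_iterate_continuous[OF e] by metis
    then obtain D where D: "\<And>k. D k > 0" "\<And>k u. chordal u w < D k \<Longrightarrow> chordal ((f ^^ k) u) ((f ^^ k) w) < e"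
      by metis
    have "chordal ((f ^^ k) u) ((f ^^ k) w) < e" if "chordal u w < Min (D ` {..<n})" for k u
    proof -
      have "k mod n < n" using n by simp
      then have "Min (D ` {..<n}) \<le> D (k mod n)" by simp
      then show ?thesis using D(2)[of u "k mod n"] that m[of k] by simp
    qed
    moreover have "Min (D ` {..<n}) > 0" using n D(1) by (subst Min_gr_iff) (auto simp: lessThan_empty_iff)
    ultimately show ?thesis by blast
  qed
  then have "z \<in> fatou f" for z by (intro fatouI[of z UNIV]) (auto intro: gt_ex)
  then show ?thesis by (auto simp: julia_def)
qed

end

section \<open>The lift to the real line\<close>

lemma continuous_int_valued_const:
  fixes \<phi> :: "real \<Rightarrow> real"
  assumes "continuous_on UNIV \<phi>" "\<And>t. \<phi> t \<in> \<int>"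
  shows "\<phi> s = \<phi> t"
proof -
  have *: False if lt: "\<phi> s < \<phi> t" for s t
  proof -
    have "connected (range \<phi>)" using assms(1) by (intro connected_continuous_image) auto
    then have "{\<phi> s..\<phi> t} \<subseteq> range \<phi>" by (intro connected_contains_Icc) auto
    moreover have "\<phi> t \<ge> \<phi> s + 1"
    proof -
      obtain i j where "\<phi> s = of_int i" "\<phi> t = of_int j" using assms(2) Ints_cases by metis
      then show ?thesis using lt by simp
    qed
    ultimately obtain u where u: "\<phi> u = \<phi> s + 1/2" by (auto simp: subset_iff image_iff) (smt (verit) field_sum_of_halves)
    obtain i j where "\<phi> s = of_int i" "\<phi> u = of_int j" using assms(2) Ints_cases by metis
    with u have "real_of_int (2 * j) = of_int (2 * i + 1)" by simp
    then have "2 * j = 2 * i + 1" by (simp only: of_int_eq_iff)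
    then show False by presburger
  qed
  show ?thesis by (rule linorder_cases[of "\<phi> s" "\<phi> t"]) (auto dest: *)
qed

context rational_map begin

text \<open>On the circle the two forms take real values \<open>P\<close> and \<open>Q\<close>
  without common zero, so Q + i P is a nonvanishing function on the contractible real line and has a
  continuous logarithm. Its imaginary part divided by pi is the lift; \<open>D\<close> is the degree
  of the circle map.\<close>

lemma circle_lift_exists:
  obtains F :: "real \<Rightarrow> real" and D :: int
  where "continuous_on UNIV F" "\<And>t. f (circ t) = circ (F t)" "\<And>t. F (t + 1) = F t + of_int D"
proof -
  define P where "P t = (SOME r. hom d p (of_real (sin (pi * t))) (of_real (cos (pi * t))) = of_real r)" for t
  define Q where "Q t = (SOME r. hom d q (of_real (sin (pi * t))) (of_real (cos (pi * t))) = of_real r)" for t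
  have P: "hom d p (of_real (sin (pi * t))) (of_real (cos (pi * t))) = of_real (P t)" for t
    unfolding P_def by (rule someI_ex[OF hom_of_real])
  have Q: "hom d q (of_real (sin (pi * t))) (of_real (cos (pi * t))) = of_real (Q t)" for t
    unfolding Q_def by (rule someI_ex[OF hom_of_real])
  have sc: "complex_of_real (sin (pi * t)) \<noteq> 0 \<or> complex_of_real (cos (pi * t)) \<noteq> 0" for t
    using sin_cos_squared_add[of "pi * t"] by (auto simp del: sin_cos_squared_add)
  have PQ: "P t \<noteq> 0 \<or> Q t \<noteq> 0" for t
    using hom_no_common_zero[OF sc[of t]] unfolding P Q by simp
  have fc: "f (circ t) = proj (of_real (P t)) (of_real (Q t))" for t
    unfolding circ_def using rat_map_proj[OF sc[of t]] unfolding P Q .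
  define g where "g t = of_real (Q t) + \<i> * of_real (P t)" for t
  have "continuous_on UNIV (\<lambda>t. complex_of_real (P t))" "continuous_on UNIV (\<lambda>t. complex_of_real (Q t))"
    unfolding P[symmetric] Q[symmetric] by (intro continuous_intros)+
  then have "continuous_on UNIV g" unfolding g_def by (intro continuous_on_add continuous_on_mult continuous_on_const)
  moreover have "g t \<noteq> 0" for t using PQ[of t] by (auto simp: g_def complex_eq_iff)
  ultimately obtain h where h: "continuous_on UNIV h" "\<And>t. g t = exp (h t)"
    using continuous_logarithm_on_contractible[of UNIV g] by auto
  define F where "F t = Im (h t) / pi" for t
  have 1: "continuous_on UNIV F" unfolding F_def using h(1) by (intro continuous_intros) auto
  have 2: "f (circ t) = circ (F t)" for t
  proof -
    have "Q t = Re (g t)" "P t = Im (g t)" by (simp_all add: g_def)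
    then have "Q t = exp (Re (h t)) * cos (pi * F t)" "P t = exp (Re (h t)) * sin (pi * F t)"
      unfolding h F_def by (simp_all add: Re_exp Im_exp)
    then show ?thesis unfolding fc[of t] using proj_scale[of "of_real (exp (Re (h t)))"] by (simp add: circ_def)
  qed
  have "circ (F (t + 1)) = circ (F t)" for t
    using circ_add_int[of t 1] 2 by (metis of_int_1)
  then have "\<exists>m::int. F (t + 1) = F t + of_int m" for t by (simp add: circ_eq_iff)
  then have "F (t + 1) - F t \<in> \<int>" for t by (metis Ints_of_int add_diff_cancel_left')
  moreover have "continuous_on UNIV (\<lambda>t. F (t + 1) - F t)"
    by (intro continuous_intros continuous_on_compose2[OF 1]) (auto intro: continuous_on_subset[OF 1])
  ultimately have c: "F (t + 1) - F t = F (0 + 1) - F 0" for t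
    by (intro continuous_int_valued_const)
  obtain D where "F (0 + 1) - F 0 = of_int D" using \<open>F (0 + 1) - F 0 \<in> \<int>\<close> Ints_cases by blast
  then have "F (t + 1) = F t + of_int D" for t using c[of t] by linarith
  then show thesis using that 1 2 by blast
qed

section \<open>Fibres and critical points of the lift\<close>

lemma infinite_circ_Icc:
  assumes "s < t"
  shows "infinite (circ ` {s..t})"
proof -
  \<comment> \<open>The interval may be longer than a period; a piece shorter than 1 is enough for
    injectivity.\<close>
  define t' where "t' = min t (s + 1/2)"
  have "inj_on circ {s..t'}"
  proof (rule inj_onI)
    fix x y assume xy: "x \<in> {s..t'}" "y \<in> {s..t'}" "circ x = circ y"
    then obtain m :: int where m: "x = y + of_int m" by (auto simp: circ_eq_iff)
    then have "\<bar>real_of_int m\<bar> < 1" using xy by (auto simp: t'_def)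
    then show "x = y" using m by simp
  qed
  moreover have "infinite {s..t'}" using assms by (simp add: t'_def)
  ultimately have "infinite (circ ` {s..t'})" by (simp add: finite_image_iff)
  moreover have "circ ` {s..t'} \<subseteq> circ ` {s..t}" by (auto simp: t'_def)
  ultimately show ?thesis using finite_subset by blast
qed

lemma lift_nonconst:
  assumes "\<And>t. f (circ t) = circ (F t)" "s < t"
  shows "\<exists>u\<in>{s..t}. F u \<noteq> F s"
proof (rule ccontr)
  assume "\<not> ?thesis"
  then have "circ ` {s..t} \<subseteq> {z. f z = circ (F s)}" using assms(1) by auto
  then show False using finite_fibre infinite_circ_Icc[OF assms(2)] finite_subset by blast
qed

text \<open>If p' q = p q', the Bezout identity yields p | p' and q | q'. By degree both derivatives
  vanish, so \<open>p\<close> and \<open>q\<close> are constant, against \<open>d2\<close>.\<close>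

lemma pderiv_wronskian_nonzero: "pderiv p * q - p * pderiv q \<noteq> 0"
proof
  assume "pderiv p * q - p * pderiv q = 0"
  then have e: "pderiv p * q = p * pderiv q" by simp
  obtain u v where uv: "u * p + v * q = 1" using poly_bezout[OF coprime] by blast
  have "pderiv p = p * (u * pderiv p) + v * (pderiv p * q)"
    using arg_cong[OF uv, of "\<lambda>r. pderiv p * r"] by (simp add: algebra_simps)
  also have "\<dots> = p * (u * pderiv p + v * pderiv q)" unfolding e by (simp add: algebra_simps)
  finally have 1: "p dvd pderiv p" by (metis dvd_triv_left)
  have "pderiv q = q * (v * pderiv q) + u * (p * pderiv q)"
    using arg_cong[OF uv, of "\<lambda>r. pderiv q * r"] by (simp add: algebra_simps)
  also have "\<dots> = q * (u * pderiv p + v * pderiv q)" unfolding e[symmetric] by (simp add: algebra_simps)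
  finally have 2: "q dvd pderiv q" by (metis dvd_triv_left)
  note 1 2
  then have "pderiv p = 0" "pderiv q = 0"
    using dvd_imp_degree_le[of p "pderiv p"] dvd_imp_degree_le[of q "pderiv q"]
    by (metis degree_pderiv diff_is_0_eq' diff_le_self le_antisym le_zero_eq n_not_Suc_n not_less_eq_eq pderiv_eq_0_iff Suc_pred' bot_nat_0.not_eq_extremum)+
  then show False using deg d2 by (simp add: pderiv_eq_0_iff)
qed

text \<open>Infinity and the real poles are included so that off this set both the coordinate
  \<open>tan\<close> and the quotient of the polynomials are regular.\<close>

definition critical :: "complex option set" where
  "critical = insert None ((\<lambda>x. Some (of_real x)) ` {x. poly q x = 0 \<or> poly (pderiv p * q - p * pderiv q) x = 0})"

lemma finite_critical: "finite critical"
proof -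
  have "finite {x. poly q x = 0}" "finite {x. poly (pderiv p * q - p * pderiv q) x = 0}"
    using poly_roots_finite q0 pderiv_wronskian_nonzero by blast+
  then show ?thesis unfolding critical_def by (simp add: Collect_disj_eq)
qed

lemma circ_tan: "cos (pi * t) \<noteq> 0 \<Longrightarrow> circ t = Some (of_real (tan (pi * t)))"
  by (simp add: circ_def proj_def tan_def)

text \<open>In the coordinate \<open>tan (pi * x)\<close> equal values of \<open>F\<close> become
  equal values of p / q at two different reals. Rolle then gives a zero of the derivative, whose
  numerator is excluded from vanishing.\<close>

lemma lift_inj_off_critical:
  assumes F: "\<And>t. f (circ t) = circ (F t)" and nc: "circ ` {s..t} \<inter> critical = {}"
  shows "inj_on F {s..t}"
proof (rule linorder_inj_onI')
  fix u v assume uv: "u \<in> {s..t}" "v \<in> {s..t}" "u < v"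
  have cos: "cos (pi * x) \<noteq> 0" if "x \<in> {u..v}" for x
  proof -
    have "x \<in> {s..t}" using uv that by auto
    then have "circ x \<notin> critical" using nc by blast
    then show ?thesis by (auto simp: critical_def circ_def proj_def)
  qed
  define T where "T x = tan (pi * x)" for x
  have good: "poly q (T x) \<noteq> 0" "poly (pderiv p * q - p * pderiv q) (T x) \<noteq> 0" if "x \<in> {u..v}" for x
  proof -
    have "x \<in> {s..t}" using uv that by auto
    then have "circ x \<notin> critical" using nc by blast
    then show "poly q (T x) \<noteq> 0" "poly (pderiv p * q - p * pderiv q) (T x) \<noteq> 0"
      unfolding circ_tan[OF cos[OF that]] critical_def T_def by blast+
  qed
  have cT: "continuous_on {u..v} T"
    unfolding T_def by (intro continuous_intros) (use cos in auto)
  have fT: "f (circ x) = Some (of_real (poly p (T x) / poly q (T x)))" if "x \<in> {u..v}" for x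
  proof -
    have r: "poly (cpoly r) (of_real y) = of_real (poly r y)" for r y
      by (simp add: poly_altdef coeff_map_poly degree_map_poly)
    show ?thesis unfolding circ_tan[OF cos[OF that]] using good(1)[OF that] by (simp add: rat_map_def T_def r)
  qed
  show "F u \<noteq> F v"
  proof
    assume "F u = F v"
    then have "f (circ u) = f (circ v)" using F by simp
    then have e: "poly p (T u) / poly q (T u) = poly p (T v) / poly q (T v)"
      using fT[of u] fT[of v] uv by (simp del: of_real_divide)
    have "circ u \<noteq> circ v"
    proof
      assume "circ u = circ v"
      then obtain m :: int where m: "v = u + of_int m" by (metis circ_eq_iff)
      then have "m \<ge> 1" using uv by simp
      then have "v \<ge> u + 1" using m by simp
      \<comment> \<open>An interval of length 1 contains a half-integer, where \<open>circ\<close>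
        is infinity and the cosine vanishes.\<close>
      moreover define x :: real where "x = of_int \<lceil>u - 1/2\<rceil> + 1/2"
      have "u \<le> x" "x < u + 1" unfolding x_def by linarith+
      ultimately have "cos (pi * x) \<noteq> 0" using cos by simp
      moreover have "pi * x = of_int (2 * \<lceil>u - 1/2\<rceil> + 1) * (pi / 2)" unfolding x_def by (simp add: algebra_simps)
      then have "cos (pi * x) = 0" unfolding cos_zero_iff_int by (intro exI[of _ "2 * \<lceil>u - 1/2\<rceil> + 1"]) auto
      ultimately show False by simp
    qed
    then have "T u \<noteq> T v" using circ_tan[OF cos[of u]] circ_tan[OF cos[of v]] uv by (auto simp: T_def)
    define a b where "a = min (T u) (T v)" and "b = max (T u) (T v)"
    have ab: "a < b" and e': "poly p a / poly q a = poly p b / poly q b"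
      using \<open>T u \<noteq> T v\<close> e by (auto simp: a_def b_def min_def max_def)
    have conn: "connected (T ` {u..v})" using cT by (intro connected_continuous_image) auto
    have "a \<in> T ` {u..v}" "b \<in> T ` {u..v}" unfolding a_def b_def min_def max_def using uv by auto
    then have sub: "{a..b} \<subseteq> T ` {u..v}" using connected_contains_Icc[OF conn] by blast
    have "\<exists>z. a < z \<and> z < b \<and> ((\<lambda>x. poly p x / poly q x) has_real_derivative 0) (at z)"
    proof (rule Rolle[OF ab e'])
      have q: "poly q x \<noteq> 0" if "x \<in> {a..b}" for x using good(1) sub that by blast
      show "continuous_on {a..b} (\<lambda>x. poly p x / poly q x)" using q by (intro continuous_intros) auto
      show "(\<lambda>x. poly p x / poly q x) differentiable at x" if "a < x" "x < b" for x
        using q[of x] that by (intro differentiable_divide poly_differentiable) auto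
    qed
    then obtain z where z: "a < z" "z < b" "((\<lambda>x. poly p x / poly q x) has_real_derivative 0) (at z)" by blast
    then obtain x where x: "x \<in> {u..v}" "z = T x" using sub subsetD[OF sub, of z] by auto
    have q: "poly q z \<noteq> 0" using good(1) x by simp
    have "((\<lambda>x. poly p x / poly q x) has_real_derivative
       (poly (pderiv p) z * poly q z - poly p z * poly (pderiv q) z) / (poly q z * poly q z)) (at z)"
      using q by (intro DERIV_divide poly_DERIV)
    then have "(poly (pderiv p) z * poly q z - poly p z * poly (pderiv q) z) / (poly q z * poly q z) = 0"
      using z(3) DERIV_unique by blast
    then show False using good(2)[OF x(1)] x q by simp
  qed
qed

text \<open>Fixing an arc gives A(z) - z B(z) infinitely many roots, so it is zero and the iterate
  is the identity on the whole sphere.\<close>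

lemma iterate_not_id_on_julia:
  assumes F: "continuous_on UNIV F" "\<And>t. f (circ t) = circ (F t)"
    and n: "n \<ge> 1" and st: "s < t" and J: "circ s \<in> julia f"
  shows "\<exists>u\<in>{s..t}. (f ^^ n) (circ u) \<noteq> circ u"
proof (rule ccontr)
  assume "\<not> ?thesis"
  then have id: "\<And>u. u \<in> {s..t} \<Longrightarrow> (f ^^ n) (circ u) = circ u" by blast
  obtain A B where AB: "\<And>w. poly A w \<noteq> 0 \<or> poly B w \<noteq> 0"
      "\<And>w. (f ^^ n) (Some w) = proj (poly A w) (poly B w)" using iterate_polys by metis
  define R where "R = A - [:0, 1:] * B"
  have R: "poly R w = 0 \<longleftrightarrow> (f ^^ n) (Some w) = Some w" for w
    using AB(1)[of w] by (auto simp: R_def AB(2) proj_def field_simps)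
  have "circ ` {s..t} \<subseteq> insert None (Some ` {w. poly R w = 0})"
  proof
    fix z assume "z \<in> circ ` {s..t}"
    then have "(f ^^ n) z = z" using id by blast
    then show "z \<in> insert None (Some ` {w. poly R w = 0})" by (cases z) (auto simp: R)
  qed
  then have "infinite {w. poly R w = 0}" using infinite_circ_Icc[OF st] finite_subset by blast
  then have "R = 0" using poly_roots_finite by blast
  then have some: "(f ^^ n) (Some w) = Some w" for w unfolding R[symmetric] by simp
  have it: "(f ^^ k) (circ t) = circ ((F ^^ k) t)" for k t
    by (induction k) (auto simp: F(2))
  have cFk: "continuous_on UNIV (F ^^ k)" for k
    by (induction k) (auto intro: continuous_on_compose2[OF F(1)] simp: id_def)
  \<comment> \<open>The polynomial identity covers finite points only. At infinity both sides agree
    as limits along the circle for t tending to 1/2.\<close>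
  have none: "(f ^^ n) None = None"
  proof -
    have half: "circ (1/2) = None" by (simp add: circ_def proj_def)
    have ne: "circ t \<noteq> None" if "dist t (1/2) < 1/2" "t \<noteq> 1/2" for t
    proof
      assume "circ t = None"
      then have "circ t = circ (1/2)" using half by simp
      then obtain m :: int where m: "t = 1/2 + of_int m" by (auto simp: circ_eq_iff)
      then have "\<bar>real_of_int m\<bar> < 1" using that(1) by (simp add: dist_real_def)
      then show False using m that(2) by simp
    qed
    have c1: "isCont (\<lambda>t. stereo (circ t)) x" for x
      using continuous_stereo_circ[of UNIV] by (simp add: continuous_on_eq_continuous_at)
    have "isCont (F ^^ n) (1/2)" using cFk by (simp add: continuous_on_eq_continuous_at)
    then have "isCont (\<lambda>t. stereo (circ ((F ^^ n) t))) (1/2)"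
      by (rule isCont_o2[where g = "\<lambda>t. stereo (circ t)"]) (rule c1)
    then have l1: "(\<lambda>t. stereo (circ ((F ^^ n) t))) \<midarrow>1/2\<rightarrow> stereo (circ ((F ^^ n) (1/2)))" by (rule isContD)
    have l2: "(\<lambda>t. stereo (circ t)) \<midarrow>1/2\<rightarrow> stereo (circ (1/2))" using c1 by (rule isContD)
    have "\<forall>\<^sub>F t in at (1/2). stereo (circ t) = stereo (circ ((F ^^ n) t))"
      unfolding eventually_at
    proof (intro exI[of _ "1/2"] conjI ballI impI)
      fix t :: real assume "t \<noteq> 1/2 \<and> dist t (1/2) < 1/2"
      then obtain w where "circ t = Some w" using ne[of t] by auto
      then show "stereo (circ t) = stereo (circ ((F ^^ n) t))" using some it[of n t] by metis
    qed auto
    then have "(\<lambda>t. stereo (circ ((F ^^ n) t))) \<midarrow>1/2\<rightarrow> stereo (circ (1/2))"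
      using l2 by (rule Lim_transform_eventually[rotated])
    then have "stereo (circ ((F ^^ n) (1/2))) = stereo (circ (1/2))" using l1 LIM_unique by blast
    then have "circ ((F ^^ n) (1/2)) = circ (1/2)" by (rule stereo_inj)
    then show ?thesis using it[of n "1/2"] half by metis
  qed
  have "(f ^^ n) z = z" for z using some none by (cases z) auto
  then have "julia f = {}" using iterate_id_julia_empty[OF n] by blast
  then show False using J by blast
qed

end

section \<open>Lifts of circle maps with a completely invariant set\<close>

lemma floor_eq_imp_close:
  fixes v w \<epsilon> :: real
  assumes "\<epsilon> > 0" "\<lfloor>v / \<epsilon>\<rfloor> = \<lfloor>w / \<epsilon>\<rfloor>"
  shows "\<bar>v - w\<bar> < \<epsilon>"
proof -
  have "\<bar>v / \<epsilon> - w / \<epsilon>\<bar> < 1" using assms(2) by linarith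
  then have "\<bar>v - w\<bar> / \<epsilon> < 1" using assms(1) by (simp add: abs_divide flip: diff_divide_distrib)
  then show ?thesis using assms(1) by (simp add: field_simps)
qed

text \<open>The dynamics below sees a rational map through these properties, and for the finiteness
  of the intervals also through those of \<open>circle_lift_critical\<close>. What is kept here of
  the finiteness of fibres is \<open>nonconst\<close>.\<close>

locale circle_lift =
  fixes f :: "complex option \<Rightarrow> complex option" and F :: "real \<Rightarrow> real" and D :: int and X :: "real set"
  assumes contF: "continuous_on UNIV F"
    and f_circ: "\<And>t. f (circ t) = circ (F t)"
    and F_shift1: "\<And>t. F (t + 1) = F t + of_int D"
    and closedX: "closed X"
    and X_shift1: "\<And>t. t + 1 \<in> X \<longleftrightarrow> t \<in> X"
    and F_X: "\<And>t. F t \<in> X \<longleftrightarrow> t \<in> X"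
    and nonconst: "\<And>s t. s < t \<Longrightarrow> \<exists>u\<in>{s..t}. F u \<noteq> F s"
begin

lemma F_shift: "F (t + of_int m) = F t + of_int (D * m)"
proof (induction m rule: int_induct[of _ 0])
  case (step1 i)
  then show ?case using F_shift1[of "t + of_int i"] by (simp add: algebra_simps)
next
  case (step2 i)
  then show ?case using F_shift1[of "t + of_int (i - 1)"] by (simp add: algebra_simps)
qed auto

lemma Fk_shift: "(F ^^ k) (t + of_int m) = (F ^^ k) t + of_int (D ^ k * m)"
proof (induction k)
  case (Suc k)
  then show ?case using F_shift[of "(F ^^ k) t" "D ^ k * m"] by (simp add: mult.assoc)
qed auto

lemma Fk_shift_diff: "(F ^^ k) (t - of_int m) = (F ^^ k) t - of_int (D ^ k * m)"
  using Fk_shift[of k t "- m"] by simp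

lemma X_shift: "t + of_int m \<in> X \<longleftrightarrow> t \<in> X"
proof (induction m rule: int_induct[of _ 0])
  case (step1 i)
  then show ?case using X_shift1[of "t + of_int i"] by (simp add: algebra_simps)
next
  case (step2 i)
  then show ?case using X_shift1[of "t + of_int (i - 1)"] by (simp add: algebra_simps)
qed auto

lemma X_shift_diff: "t - of_int m \<in> X \<longleftrightarrow> t \<in> X"
  using X_shift[of t "- m"] by simp

lemma fk_circ: "(f ^^ k) (circ t) = circ ((F ^^ k) t)"
  by (induction k) (auto simp: f_circ)

lemma contFk: "continuous_on S (F ^^ k)"
proof -
  have "continuous_on UNIV (F ^^ k)"
    by (induction k) (auto intro: continuous_on_compose2[OF contF] simp: id_def)
  then show ?thesis using continuous_on_subset by blast
qed

lemma contF': "continuous_on S F"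
  using contFk[of S 1] by simp

lemma Fk_X: "(F ^^ k) t \<in> X \<longleftrightarrow> t \<in> X"
  by (induction k) (auto simp: F_X)

lemma circ_in_X: "circ t \<in> circ ` X \<longleftrightarrow> t \<in> X"
proof
  assume "circ t \<in> circ ` X"
  then obtain s where "s \<in> X" "circ t = circ s" by auto
  then show "t \<in> X" using X_shift by (auto simp: circ_eq_iff)
qed auto

lemma Fk_near:
  assumes "r > 0"
  obtains \<delta> where "\<delta> > 0" "\<And>u. \<bar>u - t\<bar> < \<delta> \<Longrightarrow> \<bar>(F ^^ k) u - (F ^^ k) t\<bar> < r"
  using contFk[of UNIV k] assms unfolding continuous_on_iff dist_real_def by (metis UNIV_I)

end

section \<open>Components of the nonwandering set\<close>

context circle_lift begin

definition Om :: "real set" where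
  "Om = {t. circ t \<in> nonwandering f (circ ` X) chordal}"

text \<open>The starting point of a near-return can be translated next to \<open>t\<close> itself;
  its image can then only be required to be near \<open>t\<close> modulo an integer.\<close>

lemma Om_iff: "t \<in> Om \<longleftrightarrow> t \<in> X \<and>
   (\<forall>r>0. \<exists>n\<ge>1. \<exists>y\<in>X. \<exists>m::int. \<bar>y - t\<bar> < r \<and> \<bar>(F ^^ n) y - t - of_int m\<bar> < r)"
  (is "_ \<longleftrightarrow> _ \<and> ?R")
proof -
  have "?R" if nw: "\<forall>r>0. \<exists>n\<ge>1. \<exists>y\<in>circ ` X. chordal y (circ t) < r \<and> chordal ((f ^^ n) y) (circ t) < r"
  proof (intro allI impI)
    fix r :: real assume "r > 0"
    then obtain \<delta> where \<delta>: "\<delta> > 0" "\<And>s t. chordal (circ s) (circ t) < \<delta> \<Longrightarrow> \<exists>m::int. \<bar>s - t - of_int m\<bar> < r"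
      using chordal_circ_small by blast
    obtain n y0 where y0: "n \<ge> 1" "y0 \<in> X" "chordal (circ y0) (circ t) < \<delta>" "chordal ((f ^^ n) (circ y0)) (circ t) < \<delta>"
      using nw \<delta>(1) by blast
    then obtain m0 :: int where m0: "\<bar>y0 - t - of_int m0\<bar> < r" using \<delta>(2) by blast
    define y where "y = y0 - of_int m0"
    have "circ y = circ y0" by (simp add: y_def)
    then have "chordal (circ ((F ^^ n) y)) (circ t) < \<delta>" using y0(4) fk_circ by metis
    then obtain m :: int where "\<bar>(F ^^ n) y - t - of_int m\<bar> < r" using \<delta>(2) by blast
    moreover have "y \<in> X" "\<bar>y - t\<bar> < r" using y0(2) m0 by (auto simp: y_def X_shift_diff)
    ultimately show "\<exists>n\<ge>1. \<exists>y\<in>X. \<exists>m::int. \<bar>y - t\<bar> < r \<and> \<bar>(F ^^ n) y - t - of_int m\<bar> < r"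
      using y0(1) by blast
  qed
  moreover have "\<forall>r>0. \<exists>n\<ge>1. \<exists>y\<in>circ ` X. chordal y (circ t) < r \<and> chordal ((f ^^ n) y) (circ t) < r" if "?R"
  proof (intro allI impI)
    fix r :: real assume "r > 0"
    then obtain n y and m :: int where y: "n \<ge> 1" "y \<in> X" "\<bar>y - t\<bar> < r / 8" "\<bar>(F ^^ n) y - t - of_int m\<bar> < r / 8"
      using \<open>?R\<close>[rule_format, of "r / 8"] by auto
    have "chordal (circ y) (circ t) < r" using chordal_circ_le[of y t] y(3) by simp
    moreover have "chordal ((f ^^ n) (circ y)) (circ t) = chordal (circ ((F ^^ n) y - of_int m)) (circ t)"
      by (simp add: fk_circ)
    moreover have "\<dots> < r"
    proof -
      have "\<bar>(F ^^ n) y - of_int m - t\<bar> < r / 8" using y(4) by linarith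
      then have "8 * \<bar>(F ^^ n) y - of_int m - t\<bar> < r" by simp
      then show ?thesis by (rule le_less_trans[OF chordal_circ_le])
    qed
    ultimately show "\<exists>n\<ge>1. \<exists>y\<in>circ ` X. chordal y (circ t) < r \<and> chordal ((f ^^ n) y) (circ t) < r"
      using y(1,2) by (metis imageI)
  qed
  ultimately show ?thesis unfolding Om_def nonwandering_def mem_Collect_eq circ_in_X by blast
qed

lemma Om_X: "t \<in> Om \<Longrightarrow> t \<in> X" by (simp add: Om_iff)

lemma Om_shift: "t + of_int m \<in> Om \<longleftrightarrow> t \<in> Om"
  by (simp add: Om_def)

lemma Om_shift_diff: "t - of_int m \<in> Om \<longleftrightarrow> t \<in> Om"
  by (simp add: Om_def)

lemma Om_closed: "closed Om"
  unfolding closure_subset_eq[symmetric]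
proof
  fix t assume "t \<in> closure Om"
  then have ap: "\<exists>s\<in>Om. \<bar>s - t\<bar> < e" if "e > 0" for e
    using that by (auto simp: closure_approachable dist_real_def)
  have "t \<in> X" using \<open>t \<in> closure Om\<close> Om_X closedX closure_minimal[of Om X] by blast
  moreover have "\<exists>n\<ge>1. \<exists>y\<in>X. \<exists>m::int. \<bar>y - t\<bar> < r \<and> \<bar>(F ^^ n) y - t - of_int m\<bar> < r" if r: "r > 0" for r
  proof -
    obtain s where s: "s \<in> Om" "\<bar>s - t\<bar> < r / 2" using ap[of "r / 2"] r by auto
    obtain n y and m :: int where y: "n \<ge> 1" "y \<in> X" "\<bar>y - s\<bar> < r / 2" "\<bar>(F ^^ n) y - s - of_int m\<bar> < r / 2"
      using s(1) r unfolding Om_iff by (meson half_gt_zero)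
    have "\<bar>y - t\<bar> < r" "\<bar>(F ^^ n) y - t - of_int m\<bar> < r" using s(2) y(3,4) by linarith+
    then show ?thesis using y(1,2) by blast
  qed
  ultimately show "t \<in> Om" unfolding Om_iff by blast
qed

lemma Om_F: assumes "t \<in> Om" shows "F t \<in> Om"
proof -
  have "\<exists>n\<ge>1. \<exists>y\<in>X. \<exists>m::int. \<bar>y - F t\<bar> < r \<and> \<bar>(F ^^ n) y - F t - of_int m\<bar> < r" if r: "r > 0" for r
  proof -
    obtain \<delta> where \<delta>: "\<delta> > 0" "\<And>u. \<bar>u - t\<bar> < \<delta> \<Longrightarrow> \<bar>F u - F t\<bar> < r"
      using Fk_near[OF r, of t 1] by auto
    obtain n y and m :: int where y: "n \<ge> 1" "y \<in> X" "\<bar>y - t\<bar> < \<delta>" "\<bar>(F ^^ n) y - t - of_int m\<bar> < \<delta>"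
      using assms \<delta>(1) unfolding Om_iff by meson
    have "\<bar>F ((F ^^ n) y - of_int m) - F t\<bar> < r" using \<delta>(2)[of "(F ^^ n) y - of_int m"] y(4) by (simp add: algebra_simps)
    then have "\<bar>(F ^^ n) (F y) - F t - of_int (D * m)\<bar> < r"
      using Fk_shift_diff[of 1 "(F ^^ n) y" m] by (simp add: funpow_swap1 algebra_simps)
    then show ?thesis using y(1) \<delta>(2)[OF y(3)] y(2) F_X by blast
  qed
  then show ?thesis using assms unfolding Om_iff[of "F t"] F_X by (simp add: Om_X)
qed

lemma Om_Fk: "t \<in> Om \<Longrightarrow> (F ^^ k) t \<in> Om"
  by (induction k) (auto simp: Om_F)

definition cc :: "real \<Rightarrow> real set" where "cc t = connected_component_set Om t"

text \<open>Integer translates of a component have the same \<open>cl\<close>; finiteness and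
  periodicity of components are statements about these classes.\<close>

definition cl :: "real \<Rightarrow> complex option set" where "cl t = circ ` cc t"

definition Nd :: "real set" where "Nd = {t \<in> Om. \<exists>u \<in> cc t. u \<noteq> t}"

lemma cc_self: "t \<in> Om \<Longrightarrow> t \<in> cc t"
  by (simp add: cc_def connected_component_refl_eq)

lemma cc_sub: "cc t \<subseteq> Om"
  by (simp add: cc_def connected_component_subset)

lemma cc_conn: "connected (cc t)"
  by (simp add: cc_def)

lemma cc_eq: "u \<in> cc t \<Longrightarrow> cc u = cc t"
  unfolding cc_def by (metis connected_component_eq)

lemma cc_maximal: "connected S \<Longrightarrow> S \<subseteq> Om \<Longrightarrow> t \<in> S \<Longrightarrow> S \<subseteq> cc t"
  unfolding cc_def by (intro connected_component_maximal)

lemma cc_shift_sub: "(\<lambda>u. u + of_int m) ` cc t \<subseteq> cc (t + of_int m)"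
proof (cases "t \<in> Om")
  case True
  show ?thesis
    by (rule cc_maximal)
      (use cc_self[OF True] cc_sub[of t] Om_shift in \<open>auto intro!: connected_continuous_image continuous_intros cc_conn\<close>)
next
  case False
  then show ?thesis by (simp add: cc_def connected_component_eq_empty[THEN iffD2])
qed

lemma cl_shift: "cl (t + of_int m) = cl t"
proof -
  have *: "cl t \<subseteq> cl (t + of_int m)" for t m
  proof
    fix z assume "z \<in> cl t"
    then obtain u where "u \<in> cc t" "z = circ u" by (auto simp: cl_def)
    then have "u + of_int m \<in> cc (t + of_int m)" "z = circ (u + of_int m)" using cc_shift_sub[of m t] by auto
    then show "z \<in> cl (t + of_int m)" unfolding cl_def by blast
  qed
  show ?thesis using *[of t m] *[of "t + of_int m" "- m"] by auto
qed

lemma cl_shift_diff: "cl (t - of_int m) = cl t"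
  using cl_shift[of t "- m"] by simp

lemma cl_cong_cc: "u \<in> cc t \<Longrightarrow> cl u = cl t"
  by (simp add: cl_def cc_eq)

lemma circ_in_cl: "circ x \<in> cl t \<longleftrightarrow> (\<exists>m::int. x - of_int m \<in> cc t)"
  unfolding cl_def image_iff circ_eq_iff by (metis add_diff_cancel_right' diff_add_cancel)

lemma cl_eqI: assumes "circ x \<in> cl s" "circ x \<in> cl t" shows "cl s = cl t"
proof -
  obtain m n :: int where "x - of_int m \<in> cc s" "x - of_int n \<in> cc t" using assms circ_in_cl by blast
  then have "cl (x - of_int m) = cl s" "cl (x - of_int n) = cl t" by (simp_all add: cl_cong_cc)
  then show ?thesis by (simp add: cl_shift_diff)
qed

lemma cl_self: "t \<in> Om \<Longrightarrow> circ t \<in> cl t"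
  by (auto simp: cl_def cc_self)

lemma F_cc: "t \<in> Om \<Longrightarrow> F ` cc t \<subseteq> cc (F t)"
  using cc_sub[of t]
  by (intro cc_maximal connected_continuous_image contF' cc_conn) (auto simp: cc_self Om_F)

lemma Fk_cc: "t \<in> Om \<Longrightarrow> (F ^^ k) ` cc t \<subseteq> cc ((F ^^ k) t)"
  using cc_sub[of t]
  by (intro cc_maximal connected_continuous_image contFk cc_conn) (auto simp: cc_self Om_Fk)

lemma cl_Fk_cong:
  assumes "s \<in> Om" "t \<in> Om" "cl s = cl t"
  shows "cl ((F ^^ k) s) = cl ((F ^^ k) t)"
proof -
  have "circ s \<in> cl t" using cl_self[OF assms(1)] assms(3) by simp
  then obtain m :: int where m: "s - of_int m \<in> cc t" unfolding circ_in_cl by blast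
  then have "(F ^^ k) (s - of_int m) \<in> cc ((F ^^ k) t)" using Fk_cc[OF assms(2)] by blast
  then show ?thesis using cl_cong_cc Fk_shift_diff cl_shift_diff by metis
qed

lemma Nd_Om: "t \<in> Nd \<Longrightarrow> t \<in> Om" by (simp add: Nd_def)

lemma Nd_cc: assumes "t \<in> Nd" "u \<in> cc t" shows "u \<in> Nd"
proof -
  have "u \<in> Om" using assms(2) cc_sub by blast
  moreover have "\<exists>v\<in>cc t. v \<noteq> u"
  proof (cases "u = t")
    case True
    then show ?thesis using assms(1) by (simp add: Nd_def)
  next
    case False
    then show ?thesis using cc_self[OF Nd_Om[OF assms(1)]] by (intro bexI[of _ t]) auto
  qed
  ultimately show ?thesis unfolding Nd_def using cc_eq[OF assms(2)] by simp
qed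

lemma Nd_shift: assumes "t \<in> Nd" shows "t + of_int m \<in> Nd"
proof -
  obtain u where "u \<in> cc t" "u \<noteq> t" using assms by (auto simp: Nd_def)
  then have "u + of_int m \<in> cc (t + of_int m)" "u + of_int m \<noteq> t + of_int m" using cc_shift_sub[of m t] by auto
  moreover have "t + of_int m \<in> Om" using Nd_Om[OF assms] by (simp add: Om_shift)
  ultimately show ?thesis unfolding Nd_def by blast
qed

lemma Nd_circ_cl: assumes "t \<in> Nd" "circ u \<in> cl t" shows "u \<in> Nd"
proof -
  obtain m :: int where "u - of_int m \<in> cc t" using assms(2) circ_in_cl by blast
  then have "u - of_int m \<in> Nd" using Nd_cc[OF assms(1)] by blast
  then show ?thesis using Nd_shift[of "u - of_int m" m] by simp
qed

lemma Icc_sub_cc: assumes "u \<in> cc t" "v \<in> cc t" shows "{u..v} \<subseteq> cc t"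
  using connected_contains_Icc[OF cc_conn] assms by blast

text \<open>A nondegenerate component contains an interval, which \<open>nonconst\<close> keeps from
  collapsing to a point.\<close>

lemma Nd_F: assumes "t \<in> Nd" shows "F t \<in> Nd"
proof -
  obtain u where u: "u \<in> cc t" "u \<noteq> t" using assms by (auto simp: Nd_def)
  have "\<exists>a b. a < b \<and> {a..b} \<subseteq> cc t"
    using u Icc_sub_cc cc_self[OF Nd_Om[OF assms]] by (metis linorder_neqE)
  then obtain a b where ab: "a < b" "{a..b} \<subseteq> cc t" by blast
  then obtain c where c: "c \<in> {a..b}" "F c \<noteq> F a" using nonconst by blast
  have "c \<in> cc t" "a \<in> cc t" using ab c(1) by auto
  then have "F c \<in> cc (F t)" "F a \<in> cc (F t)" using F_cc[OF Nd_Om[OF assms]] by auto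
  moreover have "F c \<noteq> F t \<or> F a \<noteq> F t" using c(2) by metis
  ultimately show ?thesis using Om_F[OF Nd_Om[OF assms]] unfolding Nd_def by blast
qed

lemma Nd_Fk: "t \<in> Nd \<Longrightarrow> (F ^^ k) t \<in> Nd"
  by (induction k) (auto simp: Nd_F)

lemma Icc_Nd: assumes "s < t" "{s..t} \<subseteq> Om" "u \<in> {s..t}" shows "u \<in> Nd"
proof -
  have "{s..t} \<subseteq> cc u" using assms by (intro cc_maximal) auto
  then show ?thesis using assms unfolding Nd_def
    by (metis (mono_tags, lifting) atLeastAtMost_iff less_imp_le mem_Collect_eq not_le order_refl subsetD)
qed

end

text \<open>If \<open>H x > x\<close>, continuity puts \<open>H y\<close> above y, and above x by a
  fixed amount, for all y near x; monotonicity then keeps all later iterates above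
  \<open>H y\<close>. The other case is symmetric. The side of x is recorded for use with
  order-reversing maps.\<close>

lemma monotone_wander:
  fixes H :: "real \<Rightarrow> real"
  assumes maps: "H ` C \<subseteq> C" and mono: "\<And>u v. u \<in> C \<Longrightarrow> v \<in> C \<Longrightarrow> u < v \<Longrightarrow> H u < H v"
    and cont: "continuous_on C H" and x: "x \<in> C" and ne: "H x \<noteq> x"
  obtains r where "r > 0" "\<And>y j. y \<in> C \<Longrightarrow> \<bar>y - x\<bar> < r \<Longrightarrow> j \<ge> 1 \<Longrightarrow>
      \<bar>(H ^^ j) y - x\<bar> \<ge> r \<and> ((H ^^ j) y > x \<longleftrightarrow> H x > x)"
proof -
  define e where "e = \<bar>H x - x\<bar>"
  have e: "e > 0" using ne by (simp add: e_def)
  obtain d where d: "d > 0" "\<And>y. y \<in> C \<Longrightarrow> \<bar>y - x\<bar> < d \<Longrightarrow> \<bar>H y - H x\<bar> < e / 2"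
    using cont x e unfolding continuous_on_iff dist_real_def by (meson half_gt_zero)
  define r where "r = min d (e / 2)"
  have Hj: "(H ^^ j) y \<in> C" if "y \<in> C" for j y using that maps by (induction j) auto
  have mono': "u \<le> v \<Longrightarrow> H u \<le> H v" if "u \<in> C" "v \<in> C" for u v
    using mono[OF that] by (cases "u = v") auto
  have main: "\<bar>(H ^^ j) y - x\<bar> \<ge> r \<and> ((H ^^ j) y > x \<longleftrightarrow> H x > x)"
    if y: "y \<in> C" "\<bar>y - x\<bar> < r" "j \<ge> 1" for y j
  proof -
    have y1: "\<bar>H y - H x\<bar> < e / 2" "\<bar>y - x\<bar> < e / 2" using d(2)[OF y(1)] y(2) by (auto simp: r_def)
    show ?thesis
    proof (cases "H x > x")
      case True
      then have up: "H y > y" "H y > x + e / 2" using y1 unfolding e_def by (auto simp: abs_if field_simps split: if_splits)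
      have "(H ^^ j) y \<ge> H y" using y(3)
      proof (induction j rule: dec_induct)
        case (step n)
        have "H y \<ge> y" using up by simp
        then have "(H ^^ n) y \<ge> y" using step by linarith
        then show ?case using mono'[OF y(1) Hj[OF y(1)]] by simp
      qed auto
      then show ?thesis using up True e by (auto simp: r_def min_le_iff_disj abs_if)
    next
      case False
      then have up: "H y < y" "H y < x - e / 2" using y1 ne unfolding e_def by (auto simp: abs_if field_simps split: if_splits)
      have "(H ^^ j) y \<le> H y" using y(3)
      proof (induction j rule: dec_induct)
        case (step n)
        have "H y \<le> y" using up by simp
        then have "(H ^^ n) y \<le> y" using step by linarith
        then show ?case using mono'[OF Hj[OF y(1)] y(1)] by simp
      qed auto
      then show ?thesis using up False e by (auto simp: r_def min_le_iff_disj abs_if)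
    qed
  qed
  show ?thesis by (rule that[of r]) (use main d(1) e in \<open>auto simp: r_def\<close>)
qed

text \<open>An increasing \<open>H\<close> is covered by \<open>monotone_wander\<close>. For a
  decreasing one the even returns are iterates of the increasing map \<open>H \<circ> H\<close>,
  which explains the hypothesis \<open>H (H x) \<noteq> x\<close>; odd returns are excluded by the
  reversal of order.\<close>

lemma injective_wander:
  fixes H :: "real \<Rightarrow> real"
  assumes C: "connected C" and maps: "H ` C \<subseteq> C" and inj: "inj_on H C"
    and cont: "continuous_on C H" and x: "x \<in> C" and ne: "H (H x) \<noteq> x"
  obtains r where "r > 0" "\<And>y j. y \<in> C \<Longrightarrow> \<bar>y - x\<bar> < r \<Longrightarrow> j \<ge> 1 \<Longrightarrow> \<bar>(H ^^ j) y - x\<bar> \<ge> r"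
proof -
  have "(\<forall>u\<in>C. \<forall>v\<in>C. u < v \<longrightarrow> H u < H v) \<or> (\<forall>u\<in>C. \<forall>v\<in>C. u < v \<longrightarrow> H v < H u)"
    using inj C cont injective_eq_monotone_map[of C H]
    by (auto simp: is_interval_connected_1 monotone_on_def)
  then show thesis
  proof
    assume inc: "\<forall>u\<in>C. \<forall>v\<in>C. u < v \<longrightarrow> H u < H v"
    have "H x \<noteq> x" using ne by auto
    show thesis
      by (rule monotone_wander[OF maps _ cont x \<open>H x \<noteq> x\<close>]) (use inc that in auto)
  next
    assume dec: "\<forall>u\<in>C. \<forall>v\<in>C. u < v \<longrightarrow> H v < H u"
    have Hj: "(H ^^ j) y \<in> C" if "y \<in> C" for j y using that maps by (induction j) auto
    have dec_odd: "(H ^^ Suc (2 * i)) v < (H ^^ Suc (2 * i)) u" if "u \<in> C" "v \<in> C" "u < v" for u v i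
    proof (induction i)
      case (Suc i)
      let ?a = "(H ^^ Suc (2 * i)) v" and ?b = "(H ^^ Suc (2 * i)) u"
      have "?a \<in> C" "?b \<in> C" using that Hj by blast+
      then have "H ?b < H ?a" "H ?a \<in> C" "H ?b \<in> C" using dec Suc maps by auto
      then have "H (H ?a) < H (H ?b)" using dec by blast
      then show ?case by simp
    qed (use dec that in auto)
    let ?G = "H ^^ 2"
    have G: "?G z = H (H z)" for z by (simp add: numeral_2_eq_2)
    have Gmaps: "?G ` C \<subseteq> C" using Hj by blast
    have Gmono: "?G u < ?G v" if "u \<in> C" "v \<in> C" "u < v" for u v
    proof -
      have "H v < H u" "H v \<in> C" "H u \<in> C" using that dec maps by auto
      then show ?thesis using dec unfolding G by blast
    qed
    have Gcont: "continuous_on C ?G" unfolding G[abs_def]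
      using continuous_on_compose2[OF cont cont maps] by (simp add: numeral_2_eq_2 comp_def)
    have Gne: "?G x \<noteq> x" using ne G by simp
    obtain r where r: "r > 0" "\<And>y j. y \<in> C \<Longrightarrow> \<bar>y - x\<bar> < r \<Longrightarrow> j \<ge> 1 \<Longrightarrow>
      \<bar>(?G ^^ j) y - x\<bar> \<ge> r \<and> ((?G ^^ j) y > x \<longleftrightarrow> ?G x > x)"
      using monotone_wander[OF Gmaps Gmono Gcont x Gne] by blast
    show thesis
    proof (rule that[OF r(1)])
      fix y j assume y: "y \<in> C" "\<bar>y - x\<bar> < r" "(j::nat) \<ge> 1"
      show "\<bar>(H ^^ j) y - x\<bar> \<ge> r"
      proof (rule ccontr)
        assume "\<not> ?thesis"
        then have z: "\<bar>(H ^^ j) y - x\<bar> < r" by simp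
        show False
        proof (cases "even j")
          case True
          then obtain i where i: "j = 2 * i" by blast
          then have "(H ^^ j) y = (?G ^^ i) y" by (simp add: funpow_mult)
          then show False using r(2)[of y i] y z i by auto
        next
          case False
          then obtain i where i: "j = Suc (2 * i)" by (metis oddE Suc_eq_plus1)
          \<comment> \<open>\<open>w\<close> and \<open>(H ^^ j) w\<close> are iterates of
            \<open>?G\<close> at \<open>y\<close> and \<open>z\<close>, so both lie at distance at
            least \<open>r\<close> from \<open>x\<close> on the same side. But \<open>H ^^ j\<close>
            reverses order and takes \<open>y\<close> to \<open>z\<close>, so it takes
            \<open>w\<close> to the opposite side of \<open>z\<close>.\<close>
          define z w where "z = (H ^^ j) y" and "w = (H ^^ j) z"
          have C': "z \<in> C" "w \<in> C" using Hj y(1) unfolding z_def w_def by blast+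
          have "w = (?G ^^ j) y"
            unfolding w_def z_def by (simp add: funpow_mult mult_2 funpow_add)
          then have w: "\<bar>w - x\<bar> \<ge> r" "w > x \<longleftrightarrow> ?G x > x" using r(2)[of y j] y by auto
          have "(H ^^ j) w = (?G ^^ j) z"
            unfolding w_def by (simp add: funpow_mult mult_2 funpow_add)
          then have w': "\<bar>(H ^^ j) w - x\<bar> \<ge> r" "(H ^^ j) w > x \<longleftrightarrow> ?G x > x"
            using r(2)[of z j] y C' z unfolding z_def by auto
          have o: "u \<in> C \<Longrightarrow> v \<in> C \<Longrightarrow> u < v \<Longrightarrow> (H ^^ j) v < (H ^^ j) u" for u v
            unfolding i by (rule dec_odd)
          show False
          proof (cases "?G x > x")
            case True
            then have "y < w" using w y(2) by linarith
            then have "(H ^^ j) w < z" using o[OF y(1) C'(2)] unfolding z_def by blast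
            then show False using True w' z unfolding z_def by linarith
          next
            case False
            then have "w < y" using w y(2) by linarith
            then have "z < (H ^^ j) w" using o[OF C'(2) y(1)] unfolding z_def by blast
            then show False using False w' z unfolding z_def by linarith
          qed
        qed
      qed
    qed
  qed
qed

lemma finite_of_periodic:
  assumes "n \<ge> (1::nat)" "\<And>i. a (i + n) = a i"
  shows "finite (range (a :: nat \<Rightarrow> 'b))"
proof -
  have "a (i + n * k) = a i" for i k
  proof (induction k)
    case (Suc k)
    then show ?case using assms(2)[of "i + n * k"] by (simp add: algebra_simps)
  qed simp
  then have "a i = a (i mod n)" for i by (metis mod_mult_div_eq)
  then have "range a \<subseteq> a ` {..<n}" using assms(1) by (force simp: image_iff)
  then show ?thesis using finite_surj by blast
qed

section \<open>Finiteness of the cycles of nondegenerate components\<close>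

locale circle_lift_critical = circle_lift +
  fixes B :: "complex option set"
  assumes finB: "finite B"
    and inj_off_B: "\<And>s t. circ ` {s..t} \<inter> B = {} \<Longrightarrow> inj_on F {s..t}"
    and iterate_ne: "\<And>n s t. n \<ge> 1 \<Longrightarrow> s < t \<Longrightarrow> s \<in> X \<Longrightarrow> \<exists>u\<in>{s..t}. (f ^^ n) (circ u) \<noteq> circ u"
    and Om_ne: "Om \<noteq> UNIV"
begin

text \<open>The translates of a point outside \<open>Om\<close> trap each component in an open
  interval of length 1. The bound on the length makes \<open>circ\<close> injective on a
  component.\<close>

lemma cc_Icc:
  assumes "t \<in> Om"
  obtains a b where "cc t = {a..b}" "a \<le> t" "t \<le> b" "b < a + 1"
proof -
  obtain t0 where t0: "t0 \<notin> Om" using Om_ne by blast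
  define m where "m = \<lfloor>t - t0\<rfloor>"
  define u where "u = t0 + of_int m"
  have u: "u \<notin> Om" "u + 1 \<notin> Om" using t0 Om_shift Om_shift[of "u" 1] unfolding u_def by auto
  have ut: "u \<le> t" "t < u + 1" unfolding u_def m_def by linarith+
  have bd: "cc t \<subseteq> {u<..<u+1}"
  proof
    fix x assume x: "x \<in> cc t"
    have "{x..t} \<subseteq> Om" "{t..x} \<subseteq> Om" using Icc_sub_cc x cc_self[OF assms] cc_sub by blast+
    then have "u \<notin> {x..t}" "u + 1 \<notin> {t..x}" using u by blast+
    then show "x \<in> {u<..<u+1}" using ut by auto
  qed
  then have "bounded (cc t)" by (rule bounded_subset[rotated]) simp
  moreover have "closed (cc t)" unfolding cc_def using Om_closed by (rule closed_connected_component)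
  ultimately have "compact (cc t)" by (simp add: compact_eq_bounded_closed)
  then obtain a b where ab: "cc t = {a..b}" using cc_conn connected_compact_interval_1 by blast
  have "t \<in> {a..b}" using cc_self[OF assms] ab by simp
  then have "a \<in> cc t" "b \<in> cc t" using ab by auto
  then have "a \<in> {u<..<u+1}" "b \<in> {u<..<u+1}" using bd by blast+
  then show thesis using that[OF ab] \<open>t \<in> {a..b}\<close> by auto
qed

text \<open>Recurrence is applied to the midpoint with half the length as radius, so that a
  neighbour and its translated return both lie in the component.\<close>

lemma cl_periodic:
  assumes "t \<in> Nd"
  shows "\<exists>n\<ge>1. cl ((F ^^ n) t) = cl t"
proof -
  obtain a b where ab: "cc t = {a..b}" "a \<le> t" "t \<le> b" "b < a + 1" using cc_Icc[OF Nd_Om[OF assms]] .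
  have "a < b" using assms ab by (auto simp: Nd_def)
  define x r where "x = (a + b) / 2" and "r = (b - a) / 2"
  have x: "x \<in> cc t" "r > 0" using ab \<open>a < b\<close> by (auto simp: x_def r_def)
  then have "x \<in> Om" using cc_sub by blast
  then obtain n y and m :: int where y: "n \<ge> 1" "y \<in> X" "\<bar>y - x\<bar> < r" "\<bar>(F ^^ n) y - x - of_int m\<bar> < r"
    using x(2) unfolding Om_iff by meson
  have "y \<in> cc t" "(F ^^ n) y - of_int m \<in> cc t" using y(3,4) unfolding ab(1) x_def r_def by (auto simp: field_simps abs_less_iff)
  moreover have "(F ^^ n) y \<in> cc ((F ^^ n) t)" using Fk_cc[OF Nd_Om[OF assms]] \<open>y \<in> cc t\<close> by blast
  ultimately have "cl ((F ^^ n) t) = cl t" using cl_cong_cc cl_shift_diff by metis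
  then show ?thesis using y(1) by blast
qed

lemma cl_orbit_periodic:
  assumes "t \<in> Nd" "cl ((F ^^ n) t) = cl t"
  shows "cl ((F ^^ (k + n * j)) t) = cl ((F ^^ k) t)"
proof (induction j)
  case (Suc j)
  have "cl ((F ^^ (k + n * j)) ((F ^^ n) t)) = cl ((F ^^ (k + n * j)) t)"
    by (rule cl_Fk_cong) (use assms Nd_Om Om_Fk in auto)
  moreover have "(F ^^ (k + n * Suc j)) t = (F ^^ (k + n * j)) ((F ^^ n) t)"
    by (metis add.assoc comp_apply funpow_add mult_Suc_right add.commute)
  ultimately show ?case using Suc by simp
qed simp

lemma Fk_inj_on:
  assumes t: "t \<in> Om" and nB: "\<And>k. cl ((F ^^ k) t) \<inter> B = {}"
  shows "inj_on (F ^^ k) (cc t)"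
proof (induction k)
  case (Suc k)
  obtain a b where ab: "cc ((F ^^ k) t) = {a..b}" using cc_Icc[OF Om_Fk[OF t]] by blast
  have "circ ` {a..b} \<inter> B = {}" using nB[of k] unfolding cl_def ab .
  then have "inj_on F {a..b}" by (rule inj_off_B)
  then have "inj_on F ((F ^^ k) ` cc t)" using Fk_cc[OF t, of k] ab inj_on_subset by metis
  then show ?case unfolding funpow.simps by (rule comp_inj_on[OF Suc])
qed auto

lemma cl_orbit_meets_B:
  assumes t: "t \<in> Nd"
  shows "\<exists>k. cl ((F ^^ k) t) \<inter> B \<noteq> {}"
proof (rule ccontr)
  assume "\<not> ?thesis"
  then have nB: "\<And>k. cl ((F ^^ k) t) \<inter> B = {}" by blast
  have tO: "t \<in> Om" using t Nd_Om by blast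
  \<comment> \<open>The least period makes every later return to the component an iterate of
    \<open>H\<close>.\<close>
  define n where "n = (LEAST n. n \<ge> 1 \<and> cl ((F ^^ n) t) = cl t)"
  have n: "n \<ge> 1" "cl ((F ^^ n) t) = cl t"
    using LeastI_ex[OF cl_periodic[OF t]] unfolding n_def by blast+
  have nmin: "i = 0" if "i < n" "cl ((F ^^ i) t) = cl t" for i
    using not_less_Least[of i "\<lambda>n. n \<ge> 1 \<and> cl ((F ^^ n) t) = cl t"] that unfolding n_def by auto
  obtain a b where ab: "cc t = {a..b}" "a \<le> t" "t \<le> b" "b < a + 1" using cc_Icc[OF tO] .
  have "a < b" using t ab by (auto simp: Nd_def)
  have "circ ((F ^^ n) t) \<in> cl t" using cl_self[OF Om_Fk[OF tO]] n(2) by metis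
  then obtain m :: int where m: "(F ^^ n) t - of_int m \<in> cc t" unfolding circ_in_cl by blast
  define H where "H = (\<lambda>x. (F ^^ n) x - of_int m)"
  have inj: "inj_on H (cc t)" using Fk_inj_on[OF tO nB, of n] unfolding H_def inj_on_def by auto
  have cont: "continuous_on (cc t) H" unfolding H_def by (intro continuous_intros contFk)
  have maps: "H ` cc t \<subseteq> cc t"
  proof -
    have "connected (H ` cc t)" using cont cc_conn by (rule connected_continuous_image)
    moreover have "H ` cc t \<subseteq> Om" using cc_sub Om_Fk Om_shift_diff unfolding H_def by blast
    moreover have "H t \<in> H ` cc t" using cc_self[OF tO] by blast
    ultimately have "H ` cc t \<subseteq> cc (H t)" by (intro cc_maximal)
    then show ?thesis using cc_eq m unfolding H_def by blast
  qed
  have circH: "circ (H x) = (f ^^ n) (circ x)" for x by (simp add: H_def fk_circ)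
  have circHj: "circ ((H ^^ j) x) = (f ^^ (n * j)) (circ x)" for j x
    by (induction j) (simp_all add: circH funpow_add)
  \<comment> \<open>A point of the middle third is away from the ends, so a neighbourhood of it lies
    in the component.\<close>
  define a' b' where "a' = (2 * a + b) / 3" and "b' = (a + 2 * b) / 3"
  have a'b': "a < a'" "a' < b'" "b' < b" using \<open>a < b\<close> by (auto simp: a'_def b'_def)
  have "a' \<in> cc t" using ab(1) a'b' by simp
  then have "a' \<in> X" using cc_sub Om_X by blast
  then obtain x where x: "x \<in> {a'..b'}" "(f ^^ (2 * n)) (circ x) \<noteq> circ x"
    using iterate_ne[of "2 * n" a' b'] n(1) a'b' by auto
  have xC: "x \<in> cc t" using x(1) a'b' ab(1) by auto
  have ne: "H (H x) \<noteq> x" using circHj[of 2 x] x(2) by (auto simp: numeral_2_eq_2 mult.commute)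
  obtain r where r: "r > 0" "\<And>y j. y \<in> cc t \<Longrightarrow> \<bar>y - x\<bar> < r \<Longrightarrow> j \<ge> 1 \<Longrightarrow> \<bar>(H ^^ j) y - x\<bar> \<ge> r"
    using injective_wander[OF cc_conn maps inj cont xC ne] by blast
  define r' where "r' = min r (min (x - a) (b - x))"
  have r': "r' > 0" using r(1) x(1) a'b' by (auto simp: r'_def)
  have "x \<in> Om" using xC cc_sub by blast
  then obtain k y and m' :: int where y: "k \<ge> 1" "y \<in> X" "\<bar>y - x\<bar> < r'" "\<bar>(F ^^ k) y - x - of_int m'\<bar> < r'"
    using r' unfolding Om_iff by meson
  have yC: "y \<in> cc t" "(F ^^ k) y - of_int m' \<in> cc t"
    using y(3,4) unfolding ab(1) r'_def by auto
  have "(F ^^ k) y \<in> cc ((F ^^ k) t)" using Fk_cc[OF tO] yC(1) by blast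
  then have "cl ((F ^^ k) t) = cl t" using yC(2) cl_cong_cc cl_shift_diff by metis
  then have "cl ((F ^^ (k mod n)) t) = cl t"
    using cl_orbit_periodic[OF t n(2), of "k mod n" "k div n"] by simp
  then have "k mod n = 0" using n(1) by (intro nmin) auto
  then obtain j where j: "k = n * j" by auto
  then have "j \<ge> 1" using y(1) by (cases j) auto
  have "circ ((H ^^ j) y) = circ ((F ^^ k) y - of_int m')" by (simp add: circHj j fk_circ)
  then obtain l :: int where l: "(H ^^ j) y = (F ^^ k) y - of_int m' + of_int l" unfolding circ_eq_iff by blast
  \<comment> \<open>A component is shorter than 1, so two of its points that agree modulo integers
    coincide.\<close>
  have "(H ^^ j) y \<in> cc t" using yC(1) maps by (induction j) auto
  then have "\<bar>real_of_int l\<bar> < 1" using yC(2) l ab(1,4) by auto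
  then have "(H ^^ j) y = (F ^^ k) y - of_int m'" using l by simp
  then show False using r(2)[OF yC(1) _ \<open>j \<ge> 1\<close>] y(3,4) unfolding r'_def by auto
qed

text \<open>Different classes are disjoint, so those meeting \<open>B\<close> inject into
  \<open>B\<close>. Every class reaches one of them and, being periodic, lies on its finite
  cycle.\<close>

lemma finite_intervals: "finite (cl ` Nd)"
proof -
  define J where "J = {I \<in> cl ` Nd. I \<inter> B \<noteq> {}}"
  have "finite J"
  proof -
    have "\<forall>I\<in>J. \<exists>z. z \<in> I \<inter> B" by (auto simp: J_def)
    then obtain h where h: "\<And>I. I \<in> J \<Longrightarrow> h I \<in> I \<inter> B" by metis
    have "inj_on h J"
    proof (rule inj_onI)
      fix I I' assume I: "I \<in> J" "I' \<in> J" "h I = h I'"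
      obtain s t where st: "I = cl s" "I' = cl t" using I by (auto simp: J_def)
      have "h I \<in> cl s" "h I \<in> cl t" using h[OF I(1)] h[OF I(2)] I(3) st by auto
      moreover obtain x where "h I = circ x" using \<open>h I \<in> cl s\<close> by (auto simp: cl_def)
      ultimately show "I = I'" using cl_eqI st by metis
    qed
    moreover have "h ` J \<subseteq> B" using h by blast
    ultimately show ?thesis using finB finite_subset finite_imageD by metis
  qed
  have "\<forall>I\<in>J. \<exists>s. s \<in> Nd \<and> cl s = I" by (auto simp: J_def)
  then obtain \<sigma> where \<sigma>: "\<And>I. I \<in> J \<Longrightarrow> \<sigma> I \<in> Nd \<and> cl (\<sigma> I) = I" by metis
  have fin: "finite (range (\<lambda>i. cl ((F ^^ i) s)))" if s: "s \<in> Nd" for s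
  proof -
    obtain n where n: "n \<ge> 1" "cl ((F ^^ n) s) = cl s" using cl_periodic[OF s] by blast
    show ?thesis by (rule finite_of_periodic[OF n(1)]) (use cl_orbit_periodic[OF s n(2), of _ 1] in simp)
  qed
  have "cl ` Nd \<subseteq> (\<Union>I\<in>J. range (\<lambda>i. cl ((F ^^ i) (\<sigma> I))))"
  proof
    fix I assume "I \<in> cl ` Nd"
    then obtain t where t: "t \<in> Nd" "I = cl t" by blast
    obtain k where k: "cl ((F ^^ k) t) \<inter> B \<noteq> {}" using cl_orbit_meets_B[OF t(1)] by blast
    define I' where "I' = cl ((F ^^ k) t)"
    have I': "I' \<in> J" using k Nd_Fk[OF t(1)] by (auto simp: J_def I'_def)
    obtain n where n: "n \<ge> 1" "cl ((F ^^ n) t) = cl t" using cl_periodic[OF t(1)] by blast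
    \<comment> \<open>From the class \<open>k\<close> steps ahead, \<open>n * k - k\<close> further
      steps complete full turns of the cycle and lead back to the class of \<open>t\<close>.\<close>
    have le: "k \<le> n * k" using n(1) by simp
    have "I = cl ((F ^^ (n * k)) t)" using cl_orbit_periodic[OF t(1) n(2), of 0 k] t(2) by simp
    also have "\<dots> = cl ((F ^^ (n * k - k)) ((F ^^ k) t))" using le by (metis comp_apply funpow_add le_add_diff_inverse2)
    also have "\<dots> = cl ((F ^^ (n * k - k)) (\<sigma> I'))"
      using \<sigma>[OF I'] I'_def by (intro cl_Fk_cong) (auto intro: Nd_Om Nd_Fk t(1))
    finally show "I \<in> (\<Union>I\<in>J. range (\<lambda>i. cl ((F ^^ i) (\<sigma> I))))" using I' by blast
  qed
  moreover have "finite (\<Union>I\<in>J. range (\<lambda>i. cl ((F ^^ i) (\<sigma> I))))"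
    using \<open>finite J\<close> fin \<sigma> by blast
  ultimately show ?thesis using finite_subset by blast
qed

end

text \<open>Two omitted points, \<open>circ t0\<close> and \<open>circ u\<close>, split the circle
  into arcs with \<open>circ s\<close> on one and \<open>circ t\<close> on the other; an affine
  function changing sign between the arcs would have a zero on \<open>C\<close>.\<close>

lemma connected_circle_contains_arc:
  assumes conn: "connected (stereo ` C)" and C: "C \<subseteq> rhat" and t0: "circ t0 \<notin> C"
    and st: "t0 < s" "s < t" "t < t0 + 1" "circ s \<in> C" "circ t \<in> C" and u: "s < u" "u < t"
  shows "circ u \<in> C"
proof (rule ccontr)
  assume uC: "circ u \<notin> C"
  (* g vanishes on the chord through circ t0 and circ u *)
  define g :: "complex \<times> real \<Rightarrow> real" where
    "g y = cos (pi * (u - t0)) - (cos (pi * (u + t0)) * (- snd y) + sin (pi * (u + t0)) * Re (fst y))" for y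
  have g: "g (stereo (circ x)) = 2 * sin (pi * (x - t0)) * sin (pi * (x - u))" for x
  proof -
    have "2 * sin (pi * (x - t0)) * sin (pi * (x - u)) = cos (pi * (x - t0) - pi * (x - u)) - cos (pi * (x - t0) + pi * (x - u))"
      by (simp add: cos_diff cos_add)
    also have "pi * (x - t0) - pi * (x - u) = pi * (u - t0)" by (simp add: algebra_simps)
    also have "pi * (x - t0) + pi * (x - u) = 2 * pi * x - pi * (u + t0)" by (simp add: algebra_simps)
    also have "cos (2 * pi * x - pi * (u + t0)) = cos (pi * (u + t0)) * cos (2 * pi * x) + sin (pi * (u + t0)) * sin (2 * pi * x)"
      by (simp only: cos_diff mult.commute)
    finally show ?thesis unfolding g_def stereo_circ by simp
  qed
  have "continuous_on (stereo ` C) g" unfolding g_def by (intro continuous_intros)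
  then have conn': "connected (g ` stereo ` C)" using conn connected_continuous_image by blast
  have pos: "sin (pi * x) > 0" if "0 < x" "x < 1" for x
    using that by (intro sin_gt_zero) (auto simp: mult_less_cancel_left1)
  have "sin (pi * (s - t0)) > 0" "sin (pi * (t - t0)) > 0" "sin (pi * (t - u)) > 0" "sin (pi * (u - s)) > 0"
    using st u by (auto intro!: pos)
  moreover have "sin (pi * (s - u)) = - sin (pi * (u - s))"
    by (metis minus_diff_eq mult_minus_right sin_minus)
  ultimately have "g (stereo (circ s)) < 0" "g (stereo (circ t)) > 0"
    unfolding g by (auto simp: mult_less_0_iff)
  then have "0 \<in> g ` stereo ` C"
    using connectedD_interval[OF conn', of "g (stereo (circ s))" "g (stereo (circ t))" 0] st by auto
  then obtain z where z: "z \<in> C" "g (stereo z) = 0" by auto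
  then obtain x where x: "z = circ x" using C circ_surj by blast
  then have "sin (pi * (x - t0)) = 0 \<or> sin (pi * (x - u)) = 0" using z(2) g by simp
  then have "chordal (circ x) (circ t0) = 0 \<or> chordal (circ x) (circ u) = 0" by (simp add: chordal_circ)
  then show False using z(1) x t0 uC by (auto simp: chordal_eq_0)
qed

section \<open>Decomposition of the nonwandering set\<close>

context circle_lift_critical begin

lemma nonwandering_circ: "circ t \<in> nonwandering f (circ ` X) chordal \<longleftrightarrow> t \<in> Om"
  by (simp add: Om_def)

lemma cl_closed:
  assumes "s \<in> Om"
  shows "closed {x. circ x \<in> cl s}"
proof -
  obtain a b where ab: "cc s = {a..b}" using cc_Icc[OF assms] by blast
  have "compact ((\<lambda>t. stereo (circ t)) ` {a..b})"
    by (intro compact_continuous_image continuous_stereo_circ) auto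
  then have "closed ((\<lambda>t. stereo (circ t)) -` ((\<lambda>t. stereo (circ t)) ` {a..b}))"
    using compact_imp_closed closed_vimage[OF _ continuous_stereo_circ] by blast
  moreover have "{x. circ x \<in> cl s} = (\<lambda>t. stereo (circ t)) -` ((\<lambda>t. stereo (circ t)) ` {a..b})"
  proof -
    have e: "stereo (circ x) = stereo (circ t) \<longleftrightarrow> circ x = circ t" for x t by (metis stereo_inj)
    show ?thesis unfolding cl_def ab vimage_def image_iff e ..
  qed
  ultimately show ?thesis by simp
qed

lemma degenerate_avoids_interiors:
  assumes t: "t \<in> Om" "t \<notin> Nd" and s: "s \<in> Nd" and ab: "cc s = {a..b}"
  shows "\<not> (a < F t - of_int m \<and> F t - of_int m < b)"
proof
  assume as: "a < F t - of_int m \<and> F t - of_int m < b"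
  obtain n where n: "n \<ge> 1" "cl ((F ^^ n) s) = cl s" using cl_periodic[OF s] by blast
  have sO: "s \<in> Om" using s Nd_Om by blast
  define e where "e = min (F t - of_int m - a) (b - (F t - of_int m))"
  have "e > 0" using as by (simp add: e_def)
  then obtain \<delta> where \<delta>: "\<delta> > 0" "\<And>u. \<bar>u - t\<bar> < \<delta> \<Longrightarrow> \<bar>F u - F t\<bar> < e"
    using Fk_near[of e t 1] by auto
  define W where "W = (\<Union>i\<in>{..<n}. {x. circ x \<in> cl ((F ^^ i) s)})"
  have "closed W" unfolding W_def by (intro closed_UN ballI cl_closed Om_Fk sO) auto
  moreover have "\<exists>y\<in>W. dist y t < r" if r: "r > 0" for r
  proof -
    obtain k y and l :: int where y: "k \<ge> 1" "y \<in> X" "\<bar>y - t\<bar> < min r \<delta>" "\<bar>(F ^^ k) y - t - of_int l\<bar> < min r \<delta>"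
      using t(1) r \<delta>(1) unfolding Om_iff by (meson min_less_iff_conj)
    have "\<bar>F y - F t\<bar> < e" using \<delta>(2) y(3) by simp
    then have Fy: "F y - of_int m \<in> cc s" unfolding ab e_def by auto
    \<comment> \<open>Recurrence only supplies \<open>y\<close> in \<open>X\<close>; its image is
      nonwandering because it has entered a component of \<open>Om\<close>.\<close>
    then have FyO: "F y \<in> Om" using cc_sub Om_shift_diff by blast
    have "cl (F y) = cl s" using cl_cong_cc[OF Fy] by (simp add: cl_shift_diff)
    then have "cl ((F ^^ (k - 1)) (F y)) = cl ((F ^^ (k - 1)) s)" by (rule cl_Fk_cong[OF FyO sO])
    moreover have "(F ^^ (k - 1)) (F y) = (F ^^ k) y" using y(1) by (metis Suc_pred' funpow_swap1 funpow.simps(2) comp_apply less_eq_Suc_le One_nat_def)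
    moreover have "cl ((F ^^ (k - 1)) s) = cl ((F ^^ ((k - 1) mod n)) s)"
      using cl_orbit_periodic[OF s n(2), of "(k - 1) mod n" "(k - 1) div n"] by simp
    ultimately have "cl ((F ^^ k) y) = cl ((F ^^ ((k - 1) mod n)) s)" by simp
    moreover have "(F ^^ k) y \<in> Om" using Om_Fk[OF FyO, of "k - 1"] \<open>(F ^^ (k - 1)) (F y) = (F ^^ k) y\<close> by simp
    then have "circ ((F ^^ k) y - of_int l) \<in> cl ((F ^^ k) y)" by (simp add: cl_self)
    ultimately have "(F ^^ k) y - of_int l \<in> W" unfolding W_def using n(1) by (auto intro!: bexI[of _ "(k - 1) mod n"])
    moreover have "dist ((F ^^ k) y - of_int l) t < r" using y(4) by (simp add: dist_real_def algebra_simps)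
    ultimately show ?thesis by blast
  qed
  ultimately have "t \<in> W" by (metis closed_approachable)
  then obtain i where "circ t \<in> cl ((F ^^ i) s)" unfolding W_def by blast
  then have "t \<in> Nd" using Nd_circ_cl[OF Nd_Fk[OF s]] by blast
  then show False using t(2) by simp
qed

theorem nonwandering_decomposition:
  "\<exists>\<I> T. finite \<I> \<and> (\<forall>I\<in>\<I>. sconnected I) \<and>
     T \<subseteq> circ ` X \<and> f ` T \<subseteq> T \<and> stotally_disconnected T \<and>
     nonwandering f (circ ` X) chordal = \<Union>\<I> \<union> T"
proof -
  have "\<forall>I\<in>cl ` Nd. \<exists>s. s \<in> Nd \<and> cl s = I" by auto
  then obtain \<sigma> where \<sigma>: "\<And>I. I \<in> cl ` Nd \<Longrightarrow> \<sigma> I \<in> Nd \<and> cl (\<sigma> I) = I" by metis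
  define S where "S = \<sigma> ` cl ` Nd"
  have S: "finite S" "S \<subseteq> Nd" "\<And>t. t \<in> Nd \<Longrightarrow> \<exists>s\<in>S. cl s = cl t"
    using finite_intervals \<sigma> by (auto simp: S_def)
  have "\<forall>s\<in>S. \<exists>a b. cc s = {a..b} \<and> a \<le> s \<and> s \<le> b" using S(2) Nd_Om cc_Icc by (metis subsetD)
  then obtain lo hi where lohi: "\<And>s. s \<in> S \<Longrightarrow> cc s = {lo s..hi s} \<and> lo s \<le> s \<and> s \<le> hi s" by metis
  define E where "E = lo ` S \<union> hi ` S"
  have "finite E" using S(1) by (simp add: E_def)
  have EO: "E \<subseteq> Om"
  proof
    fix e assume "e \<in> E"
    then obtain s where s: "s \<in> S" "e = lo s \<or> e = hi s" by (auto simp: E_def)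
    then have "e \<in> cc s" using lohi[OF s(1)] by auto
    then show "e \<in> Om" using cc_sub by blast
  qed
  \<comment> \<open>The orbits of the end points are added for invariance: a degenerate point may be
    mapped to an end point of an interval, though not into its interior.\<close>
  define Tr where "Tr = (Om - Nd) \<union> (\<Union>n. (F ^^ n) ` E)"
  define T where "T = circ ` Tr"
  have TrO: "Tr \<subseteq> Om" using EO Om_Fk by (auto simp: Tr_def)
  have conn: "\<forall>I\<in>cl ` Nd. sconnected I"
  proof
    fix I assume "I \<in> cl ` Nd"
    then obtain t where t: "I = circ ` cc t" by (auto simp: cl_def)
    have "connected ((\<lambda>t. stereo (circ t)) ` cc t)"
      by (intro connected_continuous_image continuous_stereo_circ cc_conn)
    then show "sconnected I" by (simp add: sconnected_def t image_image)
  qed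
  have TX: "T \<subseteq> circ ` X" using TrO Om_X by (auto simp: T_def)
  have fT: "f ` T \<subseteq> T"
  proof
    fix z assume "z \<in> f ` T"
    then obtain t where t: "t \<in> Tr" "z = circ (F t)" by (auto simp: T_def f_circ)
    show "z \<in> T"
    proof (cases "t \<in> Om - Nd")
      case False
      then obtain n e where "e \<in> E" "t = (F ^^ n) e" using t(1) by (auto simp: Tr_def)
      then have "F t \<in> (F ^^ Suc n) ` E" by auto
      then show ?thesis unfolding T_def Tr_def t(2) by blast
    next
      case True
      show ?thesis
      proof (cases "F t \<in> Nd")
        case False
        then show ?thesis using True Om_F by (auto simp: T_def Tr_def t(2))
      next
        case nd: True
        then obtain s where s: "s \<in> S" "cl s = cl (F t)" using S(3) by blast
        then have "circ (F t) \<in> cl s" using cl_self Nd_Om[OF nd] by simp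
        then obtain m :: int where m: "F t - of_int m \<in> cc s" unfolding circ_in_cl by blast
        have "\<not> (lo s < F t - of_int m \<and> F t - of_int m < hi s)"
          using degenerate_avoids_interiors[of t s "lo s" "hi s" m] True s(1) S(2) lohi by blast
        then have "F t - of_int m = lo s \<or> F t - of_int m = hi s" using m lohi[OF s(1)] by auto
        then have "F t - of_int m \<in> (F ^^ 0) ` E" using s(1) by (auto simp: E_def)
        then have "circ (F t - of_int m) \<in> T" unfolding T_def Tr_def by blast
        then show ?thesis by (simp add: t(2))
      qed
    qed
  qed
  have nw: "nonwandering f (circ ` X) chordal = \<Union>(cl ` Nd) \<union> T"
  proof
    show "nonwandering f (circ ` X) chordal \<subseteq> \<Union>(cl ` Nd) \<union> T"
    proof
      fix z assume z: "z \<in> nonwandering f (circ ` X) chordal"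
      then obtain t where t: "z = circ t" by (auto simp: nonwandering_def)
      then have "t \<in> Om" using z nonwandering_circ by simp
      then show "z \<in> \<Union>(cl ` Nd) \<union> T"
        using cl_self[of t] t by (cases "t \<in> Nd") (auto simp: T_def Tr_def)
    qed
    have "cl t \<subseteq> nonwandering f (circ ` X) chordal" for t
      using cc_sub nonwandering_circ by (auto simp: cl_def)
    moreover have "T \<subseteq> nonwandering f (circ ` X) chordal"
      using TrO nonwandering_circ by (auto simp: T_def)
    ultimately show "\<Union>(cl ` Nd) \<union> T \<subseteq> nonwandering f (circ ` X) chordal" by blast
  qed
  have td: "stotally_disconnected T"
    unfolding stotally_disconnected_def
  proof (intro allI impI)
    fix C assume C: "C \<subseteq> T" "sconnected C"
    show "\<exists>a. C \<subseteq> {a}"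
    proof (rule ccontr)
      assume nsing: "\<not> ?thesis"
      obtain t0 where t0: "t0 \<notin> Om" using Om_ne by blast
      have COm: "x \<in> Om" if "circ x \<in> C" for x
      proof -
        have "circ x \<in> circ ` Tr" using that C(1) T_def by blast
        then obtain y where "y \<in> Tr" "circ x = circ y" by auto
        then show ?thesis using TrO by (auto simp: Om_def)
      qed
      have lift: "\<exists>x. t0 < x \<and> x < t0 + 1 \<and> z = circ x" if z: "z \<in> C" for z
      proof -
        obtain x0 where x0: "z = circ x0" using z C(1) by (auto simp: T_def)
        define x where "x = x0 - of_int \<lfloor>x0 - t0\<rfloor>"
        have "t0 \<le> x" "x < t0 + 1" unfolding x_def by linarith+
        moreover have "z = circ x" by (simp add: x_def x0)
        moreover have "x \<noteq> t0" using COm[of x] z t0 \<open>z = circ x\<close> by auto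
        ultimately show ?thesis by (intro exI[of _ x]) auto
      qed
      obtain z w where zw: "z \<in> C" "w \<in> C" "z \<noteq> w" using nsing by blast
      obtain x y where xy: "t0 < x" "x < t0 + 1" "z = circ x" "t0 < y" "y < t0 + 1" "w = circ y"
        using lift zw by metis
      have "x \<noteq> y" using zw(3) xy by auto
      define s t where "s = min x y" and "t = max x y"
      have st: "t0 < s" "s < t" "t < t0 + 1" "circ s \<in> C" "circ t \<in> C"
        using xy zw \<open>x \<noteq> y\<close> by (auto simp: s_def t_def min_def max_def)
      have Crhat: "C \<subseteq> rhat" using C(1) by (auto simp: T_def)
      have t0C: "circ t0 \<notin> C" using COm t0 by blast
      have arc: "circ u \<in> C" if "s < u" "u < t" for u
        using connected_circle_contains_arc[OF C(2)[unfolded sconnected_def] Crhat t0C st that] .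
      then have arcOm: "{s<..<t} \<subseteq> Om" using COm by auto
      define s' t' where "s' = (2 * s + t) / 3" and "t' = (s + 2 * t) / 3"
      have s't': "s < s'" "s' < t'" "t' < t" using st(2) by (auto simp: s'_def t'_def)
      have arc_Nd: "u \<in> Nd" if "u \<in> {s'..t'}" for u
        using s't' arcOm that by (intro Icc_Nd[of s' t' u]) auto
      have arc_T: "circ u \<in> T" if "u \<in> {s'..t'}" for u using arc C(1) s't' that by auto
      \<comment> \<open>A nondegenerate point of \<open>T\<close> can only stem from the orbit of an
        end point, so an arc inside \<open>T\<close> would be countable.\<close>
      have "\<exists>n. \<exists>e\<in>E. circ u = circ ((F ^^ n) e)" if "u \<in> {s'..t'}" for u
      proof -
        have uT: "circ u \<in> circ ` Tr" using arc_T[OF that] by (simp add: T_def)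
        have uN: "u \<in> Nd" using arc_Nd[OF that] .
        obtain v where v: "v \<in> Tr" "circ u = circ v" using uT by blast
        then obtain m :: int where "v = u + of_int m" by (metis circ_eq_iff)
        then have "v \<in> Nd" using Nd_shift[OF uN] by simp
        then show ?thesis using v by (auto simp: Tr_def)
      qed
      then have "circ ` {s'..t'} \<subseteq> (\<Union>n. (\<lambda>e. circ ((F ^^ n) e)) ` E)" by blast
      moreover have "countable (\<Union>n. (\<lambda>e. circ ((F ^^ n) e)) ` E)"
        using \<open>finite E\<close> by (simp add: countable_finite)
      ultimately have "countable (circ ` {s'..t'})" using countable_subset by blast
      moreover have "inj_on circ {s'..t'}"
      proof (rule inj_onI)
        fix u v assume uv: "u \<in> {s'..t'}" "v \<in> {s'..t'}" "circ u = circ v"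
        then obtain m :: int where "u = v + of_int m" by (auto simp: circ_eq_iff)
        moreover from this have "\<bar>real_of_int m\<bar> < 1" using uv st s't' by auto
        ultimately show "u = v" by simp
      qed
      ultimately have "countable {s'..t'}" by (rule countable_image_inj_on)
      then show False using uncountable_closed_interval[of s' t'] s't' by simp
    qed
  qed
  show ?thesis using finite_intervals conn TX fT td nw by blast
qed

end

section \<open>Gaps of an invariant set\<close>

text \<open>Two initial segments of the same set \<open>R\<close> are nested, so their cardinality
  distinguishes them.\<close>

lemma downclosed_eq_of_card_eq:
  fixes A B :: "nat set"
  assumes fin: "finite A" "finite B" and card: "card A = card B"
    and sub: "A \<subseteq> R" "B \<subseteq> R"
    and A: "\<And>k l. k \<in> A \<Longrightarrow> l \<in> R \<Longrightarrow> l \<le> k \<Longrightarrow> l \<in> A"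
    and B: "\<And>k l. k \<in> B \<Longrightarrow> l \<in> R \<Longrightarrow> l \<le> k \<Longrightarrow> l \<in> B"
  shows "A = B"
proof -
  have "A \<subseteq> B \<or> B \<subseteq> A" using A B sub by (meson nle_le subsetD subsetI)
  then show ?thesis using fin card card_subset_eq by metis
qed

text \<open>Within a residue class modulo \<open>q\<close> the times with value below v form an
  initial segment, so its size suffices. This is the source of the polynomial bound: q (P + 1)
  numbers, each at most n, encode the whole sequence.\<close>

lemma code_eq_of_counts:
  fixes c d :: "nat \<Rightarrow> nat"
  assumes c: "\<And>k. c k \<le> P" "\<And>k. c k \<le> c (k + q)" and d: "\<And>k. d k \<le> P" "\<And>k. d k \<le> d (k + q)"
    and q: "q \<ge> 1"
    and eq: "\<And>r v. r < q \<Longrightarrow> v \<le> P \<Longrightarrow>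
      card {k. k < n \<and> k mod q = r \<and> c k < v} = card {k. k < n \<and> k mod q = r \<and> d k < v}"
    and k: "k < n"
  shows "c k = d k"
proof -
  have mono: "e l \<le> e k" if e: "\<And>k. e k \<le> e (k + q)" and lk: "l mod q = k mod q" "l \<le> k" for e :: "nat \<Rightarrow> nat" and l k
  proof -
    obtain j where j: "k = l + q * j" using lk by (metis mod_eq_nat2E)
    have "e l \<le> e (l + q * j)"
    proof (induction j)
      case (Suc j)
      then show ?case using e[of "l + q * j"] by (simp add: algebra_simps)
    qed simp
    then show ?thesis using j by simp
  qed
  have sets: "{k. k < n \<and> k mod q = r \<and> c k < v} = {k. k < n \<and> k mod q = r \<and> d k < v}" if "r < q" "v \<le> P" for r v
    by (rule downclosed_eq_of_card_eq[where R = "{k. k mod q = r}"])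
      (use eq[OF that] mono[of c] mono[of d] c(2) d(2) in \<open>auto, (metis le_less_trans)+\<close>)
  have r: "k mod q < q" using q by simp
  show ?thesis
  proof (rule linorder_cases[of "c k" "d k"])
    assume "c k < d k"
    then show ?thesis using sets[OF r d(1)[of k]] k by blast
  next
    assume "d k < c k"
    then show ?thesis using sets[OF r c(1)[of k]] k by blast
  qed simp
qed

text \<open>By continuity \<open>no_K_between\<close> forces gaps into gaps. The condition
  \<open>return_monotone\<close> is about second returns because a first return may swap the ends of
  a gap.\<close>

locale gap_system = circle_lift +
  fixes K :: "real set"
  assumes closedK: "closed K" and K_ne: "K \<noteq> {}" and K_shift: "\<And>t m. t + of_int m \<in> K \<longleftrightarrow> t \<in> K"
    and F_K: "\<And>t. t \<in> K \<Longrightarrow> F t \<in> K"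
    and no_K_between: "\<And>s t z. s < t \<Longrightarrow> K \<inter> {s<..<t} = {} \<Longrightarrow> min (F s) (F t) < z \<Longrightarrow> z < max (F s) (F t) \<Longrightarrow> z \<notin> K"
    and return_monotone: "\<And>a b n m. a < b \<Longrightarrow> a \<in> K \<Longrightarrow> b \<in> K \<Longrightarrow> K \<inter> {a<..<b} = {} \<Longrightarrow> n \<ge> 1 \<Longrightarrow>
       (\<lambda>x. (F ^^ n) x - of_int m) ` {a..b} \<subseteq> {a..b} \<Longrightarrow>
       (\<forall>z\<in>X \<inter> {a..b}. z \<le> (F ^^ n) ((F ^^ n) z - of_int m) - of_int m) \<or>
       (\<forall>z\<in>X \<inter> {a..b}. (F ^^ n) ((F ^^ n) z - of_int m) - of_int m \<le> z)"
begin

definition gap :: "real \<times> real \<Rightarrow> bool" where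
  "gap g \<longleftrightarrow> fst g < snd g \<and> fst g \<in> K \<and> snd g \<in> K \<and> K \<inter> {fst g<..<snd g} = {}"

definition sh :: "int \<Rightarrow> real \<times> real \<Rightarrow> real \<times> real" where
  "sh m g = (fst g + of_int m, snd g + of_int m)"

lemma sh_simps [simp]: "fst (sh m g) = fst g + of_int m" "snd (sh m g) = snd g + of_int m"
  by (simp_all add: sh_def)

lemma sh_sh: "sh m (sh n g) = sh (m + n) g"
  by (simp add: sh_def)

lemma sh_0: "sh 0 g = g"
  by (simp add: sh_def)

lemma sh_inj: "sh m g = sh n g \<Longrightarrow> m = n"
  by (simp add: sh_def)

text \<open>The alternative in the last hypothesis admits both a nondegenerate interval whose ends
  may belong to \<open>K\<close> and a single point outside \<open>K\<close>.\<close>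

lemma gap_exists:
  assumes "s \<le> t" "\<And>z. z \<in> K \<Longrightarrow> \<not> (s < z \<and> z < t)" "s < t \<or> s \<notin> K"
  obtains g where "gap g" "fst g \<le> s" "t \<le> snd g"
proof -
  obtain k0 where k0: "k0 \<in> K" using K_ne by blast
  have kl: "k0 - of_int \<lceil>k0 - s\<rceil> \<in> K" "k0 + of_int \<lceil>t - k0\<rceil> \<in> K"
    using K_shift[of k0 "- \<lceil>k0 - s\<rceil>"] K_shift[of k0] k0 by auto
  define a where "a = Sup (K \<inter> {..s})"
  define b where "b = Inf (K \<inter> {t..})"
  have ne: "K \<inter> {..s} \<noteq> {}" "K \<inter> {t..} \<noteq> {}"
  proof -
    have "k0 - of_int \<lceil>k0 - s\<rceil> \<le> s" "t \<le> k0 + of_int \<lceil>t - k0\<rceil>" by linarith+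
    then show "K \<inter> {..s} \<noteq> {}" "K \<inter> {t..} \<noteq> {}" using kl by auto
  qed
  have bd: "bdd_above (K \<inter> {..s})" "bdd_below (K \<inter> {t..})" by auto
  have a: "a \<in> K \<inter> {..s}" unfolding a_def using ne bd closedK by (intro closed_contains_Sup) auto
  have b: "b \<in> K \<inter> {t..}" unfolding b_def using ne bd closedK by (intro closed_contains_Inf) auto
  have "z \<notin> K" if "a < z" "z < b" for z
  proof
    assume z: "z \<in> K"
    have "\<not> z \<le> s" using z that cSup_upper[of z "K \<inter> {..s}"] bd unfolding a_def by force
    moreover have "\<not> t \<le> z" using z that cInf_lower[of z "K \<inter> {t..}"] bd unfolding b_def by force
    ultimately show False using assms(2)[OF z] by simp
  qed
  moreover have "a < b"
  proof (cases "s < t")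
    case False
    then have "a \<noteq> s" using assms(3) a by auto
    then show ?thesis using a b assms(1) by auto
  qed (use a b in auto)
  ultimately have "gap (a, b)" using a b by (auto simp: gap_def)
  then show thesis using that[of "(a, b)"] a b by auto
qed

lemma gap_unique:
  assumes "gap g" "gap h" "x \<le> y" "x < y \<or> x \<notin> K"
    "fst g \<le> x" "y \<le> snd g" "fst h \<le> x" "y \<le> snd h"
  shows "g = h"
proof -
  have "x \<in> K" if "fst g = x \<or> fst h = x" using assms that by (auto simp: gap_def)
  have "fst g = fst h"
  proof (rule ccontr)
    assume "fst g \<noteq> fst h"
    moreover have "fst h < snd g" "fst g < snd h"
      using assms \<open>fst g = x \<or> fst h = x \<Longrightarrow> x \<in> K\<close> by (auto simp: order.order_iff_strict)
    ultimately show False using assms(1,2) unfolding gap_def by (meson disjoint_iff greaterThanLessThan_iff linorder_neqE)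
  qed
  moreover have "snd g = snd h"
  proof (rule ccontr)
    assume "snd g \<noteq> snd h"
    moreover have "fst h < snd g" "fst g < snd h" using assms(1,2) \<open>fst g = fst h\<close> by (auto simp: gap_def)
    ultimately show False using assms(1,2) unfolding gap_def by (meson disjoint_iff greaterThanLessThan_iff linorder_neqE)
  qed
  ultimately show ?thesis by (simp add: prod_eq_iff)
qed

lemma gap_sh: "gap g \<Longrightarrow> gap (sh m g)"
proof -
  assume g: "gap g"
  have "z \<notin> K" if "fst g + of_int m < z" "z < snd g + of_int m" for z
  proof
    assume "z \<in> K"
    then have "z - of_int m \<in> K" using K_shift[of z "- m"] by simp
    moreover have "z - of_int m \<in> {fst g<..<snd g}" using that by auto
    ultimately show False using g unfolding gap_def by blast
  qed
  then show "gap (sh m g)" using g K_shift unfolding gap_def by auto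
qed

definition nxt :: "real \<times> real \<Rightarrow> real \<times> real" where
  "nxt g = (SOME h. gap h \<and> F ` {fst g..snd g} \<subseteq> {fst h..snd h})"

text \<open>By \<open>nonconst\<close> the image of a gap is nondegenerate, and two gaps sharing a
  nondegenerate interval are equal.\<close>

lemma nxt_unique:
  assumes "gap g" "gap h" "gap h'" "F ` {fst g..snd g} \<subseteq> {fst h..snd h}" "F ` {fst g..snd g} \<subseteq> {fst h'..snd h'}"
  shows "h = h'"
proof -
  have ab: "fst g < snd g" using assms(1) by (simp add: gap_def)
  obtain u where u: "u \<in> {fst g..snd g}" "F u \<noteq> F (fst g)" using nonconst[OF ab] by blast
  have "F u \<in> F ` {fst g..snd g}" "F (fst g) \<in> F ` {fst g..snd g}" using u ab by auto
  then have "F u \<in> {fst h..snd h}" "F (fst g) \<in> {fst h..snd h}" "F u \<in> {fst h'..snd h'}" "F (fst g) \<in> {fst h'..snd h'}"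
    using assms by blast+
  then show ?thesis using u(2)
    by (intro gap_unique[OF assms(2,3), of "min (F u) (F (fst g))" "max (F u) (F (fst g))"]) (auto simp: min_def max_def)
qed

lemma nxt:
  assumes "gap g"
  shows "gap (nxt g)" "F ` {fst g..snd g} \<subseteq> {fst (nxt g)..snd (nxt g)}"
proof -
  let ?I = "{fst g..snd g}"
  have ab: "fst g < snd g" using assms by (simp add: gap_def)
  \<comment> \<open>The image of the gap is spanned by the values at a minimum and a maximum point,
    and \<open>no_K_between\<close> is applied to the interval between these two points.\<close>
  obtain x where x: "x \<in> ?I" "\<And>w. w \<in> ?I \<Longrightarrow> F x \<le> F w"
    using continuous_attains_inf[of ?I F] ab contF' by auto
  obtain y where y: "y \<in> ?I" "\<And>w. w \<in> ?I \<Longrightarrow> F w \<le> F y"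
    using continuous_attains_sup[of ?I F] ab contF' by auto
  obtain u where u: "u \<in> ?I" "F u \<noteq> F (fst g)" using nonconst[OF ab] by blast
  have "F x \<le> F u" "F u \<le> F y" "F x \<le> F (fst g)" "F (fst g) \<le> F y" using x y u ab by auto
  then have lt: "F x < F y" using u(2) by linarith
  have between: "z \<notin> K" if z: "F x < z" "z < F y" for z
  proof -
    have "x \<noteq> y" using lt by auto
    have noK: "K \<inter> {min x y<..<max x y} = {}"
      using assms x(1) y(1) unfolding gap_def by (auto simp: min_def max_def split: if_splits)
    show ?thesis
    proof (rule no_K_between[OF _ noK])
      show "min x y < max x y" using \<open>x \<noteq> y\<close> by auto
      show "min (F (min x y)) (F (max x y)) < z" "z < max (F (min x y)) (F (max x y))"
        using z lt by (auto simp: min_def max_def)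
    qed
  qed
  obtain h where h: "gap h" "fst h \<le> F x" "F y \<le> snd h"
    using gap_exists[of "F x" "F y"] lt between by auto
  have "F ` ?I \<subseteq> {fst h..snd h}" using x(2) y(2) h by force
  then have "gap (nxt g) \<and> F ` ?I \<subseteq> {fst (nxt g)..snd (nxt g)}"
    unfolding nxt_def using h(1) by (intro someI_ex[of "\<lambda>h. gap h \<and> F ` ?I \<subseteq> {fst h..snd h}"]) blast
  then show "gap (nxt g)" "F ` ?I \<subseteq> {fst (nxt g)..snd (nxt g)}" by auto
qed

lemma nxt_sh: assumes "gap g" shows "nxt (sh m g) = sh (D * m) (nxt g)"
proof (rule nxt_unique[OF gap_sh[OF assms, of m]])
  show "gap (nxt (sh m g))" "F ` {fst (sh m g)..snd (sh m g)} \<subseteq> {fst (nxt (sh m g))..snd (nxt (sh m g))}"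
    using nxt[OF gap_sh[OF assms]] by blast+
  show "gap (sh (D * m) (nxt g))" using gap_sh nxt assms by blast
  show "F ` {fst (sh m g)..snd (sh m g)} \<subseteq> {fst (sh (D * m) (nxt g))..snd (sh (D * m) (nxt g))}"
  proof
    fix z assume "z \<in> F ` {fst (sh m g)..snd (sh m g)}"
    then obtain w where w: "w \<in> {fst (sh m g)..snd (sh m g)}" "z = F w" by blast
    then have "w - of_int m \<in> {fst g..snd g}" by auto
    then have "F (w - of_int m) \<in> {fst (nxt g)..snd (nxt g)}" using nxt(2)[OF assms] by blast
    moreover have "F w = F (w - of_int m) + of_int (D * m)" using F_shift[of "w - of_int m" m] by simp
    ultimately show "z \<in> {fst (sh (D * m) (nxt g))..snd (sh (D * m) (nxt g))}" using w(2) by auto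
  qed
qed

lemma gap_nxtk: "gap g \<Longrightarrow> gap ((nxt ^^ k) g)"
  by (induction k) (auto intro: nxt)

lemma nxtk: "gap g \<Longrightarrow> (F ^^ k) ` {fst g..snd g} \<subseteq> {fst ((nxt ^^ k) g)..snd ((nxt ^^ k) g)}"
proof (induction k)
  case (Suc k)
  have "(F ^^ Suc k) ` {fst g..snd g} = F ` (F ^^ k) ` {fst g..snd g}" by (simp add: image_comp)
  also have "\<dots> \<subseteq> F ` {fst ((nxt ^^ k) g)..snd ((nxt ^^ k) g)}" using Suc by (intro image_mono) blast
  also have "\<dots> \<subseteq> {fst ((nxt ^^ Suc k) g)..snd ((nxt ^^ Suc k) g)}" using nxt(2)[OF gap_nxtk[OF Suc.prems]] by simp
  finally show ?case .
qed auto

lemma nxtk_sh: "gap g \<Longrightarrow> (nxt ^^ k) (sh m g) = sh (D ^ k * m) ((nxt ^^ k) g)"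
  by (induction k) (auto simp: nxt_sh gap_nxtk mult.assoc)

definition gap_of :: "real \<Rightarrow> real \<times> real" where
  "gap_of x = (SOME g. gap g \<and> fst g \<le> x \<and> x \<le> snd g)"

lemma gap_of: assumes "x \<notin> K" shows "gap (gap_of x)" "x \<in> {fst (gap_of x)..snd (gap_of x)}"
proof -
  obtain g where "gap g" "fst g \<le> x" "x \<le> snd g" using gap_exists[of x x] assms by auto
  then have "gap (gap_of x) \<and> fst (gap_of x) \<le> x \<and> x \<le> snd (gap_of x)" unfolding gap_of_def
    by (intro someI_ex[of "\<lambda>g. gap g \<and> fst g \<le> x \<and> x \<le> snd g"]) blast
  then show "gap (gap_of x)" "x \<in> {fst (gap_of x)..snd (gap_of x)}" by auto
qed

text \<open>Visits are read off the itinerary of the gap around \<open>x\<close>, not off the orbit of \<open>x\<close>, which may land on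
  an end point shared by two gaps.\<close>

definition vis :: "real \<times> real \<Rightarrow> real \<Rightarrow> nat \<Rightarrow> bool" where
  "vis g x k \<longleftrightarrow> x \<notin> K \<and> (\<exists>m. (nxt ^^ k) (gap_of x) = sh m g)"

text \<open>\<open>g\<close> stands for all its integer translates; the iterate is moved back into
  \<open>g\<close> itself, by an integer that is unique thanks to \<open>sh_inj\<close>.\<close>

definition pos :: "real \<times> real \<Rightarrow> real \<Rightarrow> nat \<Rightarrow> real" where
  "pos g x k = (F ^^ k) x - of_int (THE m. (nxt ^^ k) (gap_of x) = sh m g)"

lemma visE:
  assumes "vis g x k"
  obtains m where "x \<notin> K" "(nxt ^^ k) (gap_of x) = sh m g" "pos g x k = (F ^^ k) x - of_int m"
proof -
  obtain m where m: "x \<notin> K" "(nxt ^^ k) (gap_of x) = sh m g" using assms by (auto simp: vis_def)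
  moreover have "(THE m. (nxt ^^ k) (gap_of x) = sh m g) = m" using m(2) sh_inj by (intro the_equality) auto
  ultimately show thesis using that by (simp add: pos_def)
qed

lemma pos_in:
  assumes "vis g x k"
  shows "pos g x k \<in> {fst g..snd g}"
proof -
  obtain m where m: "x \<notin> K" "(nxt ^^ k) (gap_of x) = sh m g" "pos g x k = (F ^^ k) x - of_int m"
    using visE[OF assms] .
  have "(F ^^ k) x \<in> {fst (sh m g)..snd (sh m g)}"
    using nxtk[OF gap_of(1)[OF m(1)], of k] gap_of(2)[OF m(1)] unfolding m(2) by blast
  then show ?thesis unfolding m(3) by auto
qed

lemma pos_X:
  assumes "vis g x k" "x \<in> X"
  shows "pos g x k \<in> X"
  using visE[OF assms(1)] Fk_X X_shift_diff assms(2) by metis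

text \<open>\<open>nxt\<close> commutes with integer translations up to a power of the degree, so
  all visits to \<open>g\<close> share one return map.\<close>

lemma vis_return:
  assumes g: "gap g" and ret: "(nxt ^^ n) g = sh m0 g" and vis: "vis g x k"
  shows "vis g x (k + n)" "pos g x (k + n) = (F ^^ n) (pos g x k) - of_int m0"
proof -
  obtain m where m: "x \<notin> K" "(nxt ^^ k) (gap_of x) = sh m g" "pos g x k = (F ^^ k) x - of_int m"
    using visE[OF vis] .
  have e: "(nxt ^^ (k + n)) (gap_of x) = sh (D ^ n * m + m0) g"
    using m(2) nxtk_sh[OF g, of n m] ret by (simp add: add.commute[of k n] funpow_add sh_sh)
  then show v: "vis g x (k + n)" using m(1) by (auto simp: vis_def)
  obtain m' where m': "(nxt ^^ (k + n)) (gap_of x) = sh m' g" "pos g x (k + n) = (F ^^ (k + n)) x - of_int m'"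
    using visE[OF v] .
  have "m' = D ^ n * m + m0" using e m'(1) sh_inj by metis
  moreover have "(F ^^ (k + n)) x = (F ^^ n) (pos g x k + of_int m)"
    using m(3) by (simp add: add.commute[of k n] funpow_add)
  ultimately show "pos g x (k + n) = (F ^^ n) (pos g x k) - of_int m0"
    using m'(2) Fk_shift[of n "pos g x k" m] by simp
qed

lemma vis_twice_returns:
  assumes g: "gap g" and v: "vis g x j" "vis g x l" and jl: "j < l"
  shows "\<exists>n\<ge>1. \<exists>m. (nxt ^^ n) g = sh m g"
proof -
  obtain m where m: "(nxt ^^ j) (gap_of x) = sh m g" using visE[OF v(1)] .
  obtain m' where m': "(nxt ^^ l) (gap_of x) = sh m' g" using visE[OF v(2)] .
  have "l = (l - j) + j" using jl by simp
  then have "sh m' g = (nxt ^^ (l - j)) (sh m g)" using m m' by (metis comp_apply funpow_add)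
  also have "\<dots> = sh (D ^ (l - j) * m) ((nxt ^^ (l - j)) g)" by (rule nxtk_sh[OF g])
  finally have "sh (m' - D ^ (l - j) * m) g = (nxt ^^ (l - j)) g"
    using sh_sh[of "- (D ^ (l - j) * m)"] by (metis add.commute add.left_inverse diff_conv_add_uminus sh_0)
  then have "(nxt ^^ (l - j)) g = sh (m' - D ^ (l - j) * m) g" ..
  moreover have "l - j \<ge> 1" using jl by simp
  ultimately show ?thesis by blast
qed

end

lemma nat_floor_mono: "\<epsilon> > 0 \<Longrightarrow> v \<le> w \<Longrightarrow> nat \<lfloor>v / \<epsilon>\<rfloor> \<le> nat \<lfloor>w / \<epsilon>\<rfloor>"
  for v w \<epsilon> :: real
  by (intro nat_mono floor_mono divide_right_mono) auto

lemma nat_floor_close: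
  fixes v w \<epsilon> :: real
  assumes "\<epsilon> > 0" "0 \<le> v" "0 \<le> w" "nat \<lfloor>v / \<epsilon>\<rfloor> = nat \<lfloor>w / \<epsilon>\<rfloor>"
  shows "\<bar>v - w\<bar> \<le> \<epsilon>"
proof -
  have "\<lfloor>v / \<epsilon>\<rfloor> = \<lfloor>w / \<epsilon>\<rfloor>" using assms by (simp add: nat_eq_iff)
  then show ?thesis using floor_eq_imp_close[OF assms(1)] by (simp add: less_imp_le)
qed

section \<open>Coding orbits by their visits to long gaps\<close>

context gap_system begin

text \<open>The bound \<open>P\<close> and monotonicity along steps of length \<open>q\<close> are
  what \<open>code_eq_of_counts\<close> requires. The last clause looks at a finite time window
  only, since that is all that separated sets see.\<close>

definition coding :: "real \<times> real \<Rightarrow> real \<Rightarrow> nat \<Rightarrow> nat \<Rightarrow> (real \<Rightarrow> nat \<Rightarrow> nat) \<Rightarrow> bool" where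
  "coding g \<epsilon> q P c \<longleftrightarrow> q \<ge> 1 \<and> (\<forall>x\<in>X. \<forall>k. c x k \<le> P \<and> c x k \<le> c x (k + q)) \<and>
     (\<forall>x\<in>X. \<forall>y\<in>X. \<forall>n. (\<forall>k<n. c x k = c y k) \<longrightarrow>
        (\<forall>k<n. (vis g x k \<longleftrightarrow> vis g y k) \<and> (vis g x k \<longrightarrow> \<bar>pos g x k - pos g y k\<bar> \<le> \<epsilon>)))"

text \<open>The visits of an orbit to a recurrent gap form a sequence of positions that is monotone along
  every second return; a non-recurrent gap is visited at most once.\<close>

lemma coding_exists:
  assumes g: "gap g" and \<epsilon>: "\<epsilon> > 0"
  shows "\<exists>q P c. coding g \<epsilon> q P c"
proof (cases "\<exists>n\<ge>1. \<exists>m. (nxt ^^ n) g = sh m g")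
  case True
  then obtain n m where n: "n \<ge> 1" "(nxt ^^ n) g = sh m g" by blast
  define a b where "a = fst g" and "b = snd g"
  have ab: "a < b" "a \<in> K" "b \<in> K" "K \<inter> {a<..<b} = {}" using g by (auto simp: gap_def a_def b_def)
  define H where "H = (\<lambda>x. (F ^^ n) x - of_int m)"
  have maps: "H ` {a..b} \<subseteq> {a..b}"
  proof
    fix z assume "z \<in> H ` {a..b}"
    then obtain x where x: "x \<in> {fst g..snd g}" "z = H x" by (auto simp: a_def b_def)
    then have "(F ^^ n) x \<in> {fst (sh m g)..snd (sh m g)}" using nxtk[OF g, of n] n(2) by (metis image_subset_iff)
    then show "z \<in> {a..b}" unfolding x(2) H_def a_def b_def by auto
  qed
  have pin: "pos g x k \<in> {a..b}" if "vis g x k" for x k using pos_in[OF that] by (simp add: a_def b_def)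
  have step: "vis g x (k + 2 * n)" "pos g x (k + 2 * n) = H (H (pos g x k))" if "vis g x k" for x k
  proof -
    note 1 = vis_return[OF g n(2) that]
    note 2 = vis_return[OF g n(2) 1(1)]
    have e: "k + 2 * n = (k + n) + n" by simp
    show "vis g x (k + 2 * n)" "pos g x (k + 2 * n) = H (H (pos g x k))"
      unfolding e H_def using 1 2 by auto
  qed
  have dir: "(\<forall>z\<in>X \<inter> {a..b}. z \<le> H (H z)) \<or> (\<forall>z\<in>X \<inter> {a..b}. H (H z) \<le> z)"
    using return_monotone[OF ab n(1) maps[unfolded H_def]] unfolding H_def .
  \<comment> \<open>\<open>h\<close> measures the position from the end of the gap that second
    returns move away from. The value 0 means no visit, and a visit recurs after
    \<open>2 * n\<close> steps, so the code never drops.\<close>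
  have main: "coding g \<epsilon> (2 * n) (Suc (nat \<lfloor>(b - a) / \<epsilon>\<rfloor>)) (\<lambda>x k. if vis g x k then Suc (nat \<lfloor>h (pos g x k) / \<epsilon>\<rfloor>) else 0)"
    if h: "\<And>z. z \<in> {a..b} \<Longrightarrow> 0 \<le> h z \<and> h z \<le> b - a" "\<And>z w. \<bar>h z - h w\<bar> = \<bar>z - w\<bar>"
      "\<And>z. z \<in> X \<inter> {a..b} \<Longrightarrow> h z \<le> h (H (H z))" for h
    unfolding coding_def
  proof (intro conjI ballI allI impI)
    fix x k assume x: "x \<in> X"
    show "(if vis g x k then Suc (nat \<lfloor>h (pos g x k) / \<epsilon>\<rfloor>) else 0) \<le> Suc (nat \<lfloor>(b - a) / \<epsilon>\<rfloor>)"
      using nat_floor_mono[OF \<epsilon>] h(1) pin by auto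
    show "(if vis g x k then Suc (nat \<lfloor>h (pos g x k) / \<epsilon>\<rfloor>) else 0)
        \<le> (if vis g x (k + 2 * n) then Suc (nat \<lfloor>h (pos g x (k + 2 * n)) / \<epsilon>\<rfloor>) else 0)"
      using step[of x k] pin[of x k] pos_X[OF _ x, of g k] h(3)[of "pos g x k"] nat_floor_mono[OF \<epsilon>] by auto
  next
    fix x y :: real and N k :: nat
    assume xy: "x \<in> X" "y \<in> X" and eq: "\<forall>k<N. (if vis g x k then Suc (nat \<lfloor>h (pos g x k) / \<epsilon>\<rfloor>) else 0)
       = (if vis g y k then Suc (nat \<lfloor>h (pos g y k) / \<epsilon>\<rfloor>) else 0)" and k: "k < N"
    show v: "vis g x k \<longleftrightarrow> vis g y k" using eq k by (metis nat.distinct(1))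
    assume vx: "vis g x k"
    then have "nat \<lfloor>h (pos g x k) / \<epsilon>\<rfloor> = nat \<lfloor>h (pos g y k) / \<epsilon>\<rfloor>" using spec[OF eq, of k] k v by simp
    then show "\<bar>pos g x k - pos g y k\<bar> \<le> \<epsilon>"
      using nat_floor_close[OF \<epsilon>] h(1) h(2)[of "pos g x k" "pos g y k"] pin[OF vx] pin[of y k] vx v by metis
  qed (use n(1) in simp)
  from dir show ?thesis
  proof
    assume "\<forall>z\<in>X \<inter> {a..b}. z \<le> H (H z)"
    then show ?thesis using main[of "\<lambda>z. z - a"] by fastforce
  next
    assume "\<forall>z\<in>X \<inter> {a..b}. H (H z) \<le> z"
    then show ?thesis using main[of "\<lambda>z. b - z"] by fastforce
  qed
next
  case False
  then have once: "j = l" if "vis g x j" "vis g x l" for x j l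
    using vis_twice_returns[OF g] that by (metis linorder_neqE_nat)
  define a b where "a = fst g" and "b = snd g"
  have pin: "0 \<le> pos g x k - a" "pos g x k - a \<le> b - a" if "vis g x k" for x k
    using pos_in[OF that] by (auto simp: a_def b_def)
  \<comment> \<open>The code is 0 before the only visit and afterwards keeps the cell of that visit,
    so it is nondecreasing with step 1; the visit is the time of the jump.\<close>
  define c where "c x k = (if \<exists>j\<le>k. vis g x j then Suc (nat \<lfloor>(pos g x (THE j. vis g x j) - a) / \<epsilon>\<rfloor>) else 0)" for x k
  have the: "(THE j. vis g x j) = j" if "vis g x j" for x j
    using once that by blast
  have c_vis: "c x k = Suc (nat \<lfloor>(pos g x j - a) / \<epsilon>\<rfloor>)" if "vis g x j" "j \<le> k" for x j k
    using that the[OF that(1)] unfolding c_def by auto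
  have c_pos: "\<exists>j\<le>k. vis g x j" if "c x k \<noteq> 0" for x k using that unfolding c_def by (auto split: if_splits)
  have "coding g \<epsilon> 1 (Suc (nat \<lfloor>(b - a) / \<epsilon>\<rfloor>)) c"
    unfolding coding_def
  proof (intro conjI ballI allI impI)
    fix x k assume x: "x \<in> X"
    show "c x k \<le> Suc (nat \<lfloor>(b - a) / \<epsilon>\<rfloor>)"
    proof (cases "c x k = 0")
      case False
      then obtain j where "j \<le> k" "vis g x j" using c_pos by blast
      then show ?thesis using c_vis nat_floor_mono[OF \<epsilon>] pin by simp
    qed simp
    show "c x k \<le> c x (k + 1)"
    proof (cases "c x k = 0")
      case False
      then obtain j where j: "j \<le> k" "vis g x j" using c_pos by blast
      then show ?thesis using c_vis[OF j(2), of k] c_vis[OF j(2), of "k + 1"] by simp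
    qed simp
  next
    fix x y :: real and N k :: nat
    assume xy: "x \<in> X" "y \<in> X" and eq: "\<forall>k<N. c x k = c y k" and k: "k < N"
    have *: "vis g w k" if "vis g z k" and e: "\<And>j. j < N \<Longrightarrow> c z j = c w j" for z w
    proof -
      have "c w k \<noteq> 0" using c_vis[OF that(1), of k] e[OF k] by simp
      then obtain j where j: "j \<le> k" "vis g w j" using c_pos by blast
      have "c z j \<noteq> 0" using c_vis[OF j(2), of j] e[of j] j(1) k by simp
      then obtain i where "i \<le> j" "vis g z i" using c_pos by blast
      then have "i = k" using once that(1) by blast
      then show ?thesis using j \<open>i \<le> j\<close> by simp
    qed
    show v: "vis g x k \<longleftrightarrow> vis g y k" using *[of x y] *[of y x] eq by auto
    assume vx: "vis g x k"
    then have vy: "vis g y k" using v by simp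
    have "nat \<lfloor>(pos g x k - a) / \<epsilon>\<rfloor> = nat \<lfloor>(pos g y k - a) / \<epsilon>\<rfloor>"
      using c_vis[OF vx, of k] c_vis[OF vy, of k] eq k by simp
    then have "\<bar>(pos g x k - a) - (pos g y k - a)\<bar> \<le> \<epsilon>"
      using nat_floor_close[OF \<epsilon>] pin(1)[OF vx] pin(1)[OF vy] by blast
    then show "\<bar>pos g x k - pos g y k\<bar> \<le> \<epsilon>" by simp
  qed simp
  then show ?thesis by blast
qed

text \<open>Two gaps of length at least \<open>\<epsilon>\<close> whose left ends lie in the same
  cell of that size overlap, hence coincide.\<close>

lemma finite_large_gaps:
  assumes "\<epsilon> > 0"
  shows "finite {g. gap g \<and> 0 \<le> fst g \<and> fst g < 1 \<and> snd g - fst g \<ge> \<epsilon>}" (is "finite ?L")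
proof -
  have *: "g = h" if "g \<in> ?L" "h \<in> ?L" "\<lfloor>fst g / \<epsilon>\<rfloor> = \<lfloor>fst h / \<epsilon>\<rfloor>" for g h
  proof -
    have d: "\<bar>fst g - fst h\<bar> < \<epsilon>" using floor_eq_imp_close[OF assms that(3)] .
    have "max (fst g) (fst h) < min (snd g) (snd h)" using that(1,2) d unfolding gap_def by auto
    then show ?thesis
      using that(1,2) by (intro gap_unique[of g h "max (fst g) (fst h)" "min (snd g) (snd h)"]) auto
  qed
  have "inj_on (\<lambda>g. \<lfloor>fst g / \<epsilon>\<rfloor>) ?L" using * by (intro inj_onI) blast
  moreover have "(\<lambda>g. \<lfloor>fst g / \<epsilon>\<rfloor>) ` ?L \<subseteq> {0..\<lfloor>1 / \<epsilon>\<rfloor>}"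
    using assms by (auto intro!: floor_mono divide_right_mono)
  ultimately show ?thesis by (meson finite_atLeastAtMost_int finite_imageD finite_subset)
qed

text \<open>During a visit to a long gap two orbits are compared directly. At other times each is
  compared with the orbit of a reference point of \<open>K\<close>, the point itself or the left end
  of its gap, and distinguishing those is left to the separated sets of \<open>K\<close>.\<close>

definition alike :: "real \<Rightarrow> nat \<Rightarrow> real \<Rightarrow> real \<Rightarrow> bool" where
  "alike \<epsilon> k x y \<longleftrightarrow> (\<exists>m::int. \<bar>(F ^^ k) x - (F ^^ k) y - of_int m\<bar> \<le> \<epsilon>) \<or>
         ((x \<in> K \<or> \<bar>(F ^^ k) x - (F ^^ k) (fst (gap_of x))\<bar> < \<epsilon>) \<and> (y \<in> K \<or> \<bar>(F ^^ k) y - (F ^^ k) (fst (gap_of y))\<bar> < \<epsilon>))"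

text \<open>\<open>M\<close> is the number of triples of a long gap, a residue and a threshold; it
  depends on \<open>\<epsilon>\<close> but not on n. Each of the recorded counts has at most n + 1
  values.\<close>

lemma orbit_coding:
  assumes \<epsilon>: "\<epsilon> > 0"
  shows "\<exists>M. \<forall>n. \<exists>(\<Phi> :: real \<Rightarrow> (real \<times> real) \<times> nat \<times> nat \<Rightarrow> nat) T.
     finite T \<and> card T \<le> (n + 1) ^ M \<and> (\<forall>x\<in>X. \<Phi> x \<in> T) \<and>
     (\<forall>x\<in>X. \<forall>y\<in>X. \<Phi> x = \<Phi> y \<longrightarrow> (\<forall>k<n. alike \<epsilon> k x y))"
proof -
  define L where "L = {g. gap g \<and> 0 \<le> fst g \<and> fst g < 1 \<and> snd g - fst g \<ge> \<epsilon>}"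
  have finL: "finite L" unfolding L_def by (rule finite_large_gaps[OF \<epsilon>])
  have "\<forall>g\<in>L. \<exists>q P c. coding g \<epsilon> q P c" using coding_exists[OF _ \<epsilon>] by (auto simp: L_def)
  then obtain q P c where code: "\<And>g. g \<in> L \<Longrightarrow> coding g \<epsilon> (q g) (P g) (c g)" by metis
  define \<Lambda> where "\<Lambda> = (SIGMA g:L. {..<q g} \<times> {..P g})"
  have fin\<Lambda>: "finite \<Lambda>" using finL by (auto simp: \<Lambda>_def)
  have "\<exists>(\<Phi> :: real \<Rightarrow> (real \<times> real) \<times> nat \<times> nat \<Rightarrow> nat) T.
     finite T \<and> card T \<le> (n + 1) ^ card \<Lambda> \<and> (\<forall>x\<in>X. \<Phi> x \<in> T) \<and>
     (\<forall>x\<in>X. \<forall>y\<in>X. \<Phi> x = \<Phi> y \<longrightarrow> (\<forall>k<n. alike \<epsilon> k x y))" for n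
  proof -
    define \<Phi> where "\<Phi> x = (\<lambda>(g, r, v) \<in> \<Lambda>. card {k. k < n \<and> k mod q g = r \<and> c g x k < v})" for x
    define T where "T = PiE \<Lambda> (\<lambda>_. {..n})"
    have "finite T" unfolding T_def using fin\<Lambda> by (intro finite_PiE) auto
    moreover have "card T \<le> (n + 1) ^ card \<Lambda>" unfolding T_def using fin\<Lambda> by (simp add: card_PiE)
    moreover have "\<Phi> x \<in> T" for x
    proof -
      have "card {k. k < n \<and> k mod q g = r \<and> c g x k < v} \<le> n" for g r v
        using card_mono[of "{..<n}" "{k. k < n \<and> k mod q g = r \<and> c g x k < v}"] by auto
      then show ?thesis unfolding \<Phi>_def T_def by auto
    qed
    moreover have "alike \<epsilon> k x y"
      if xy: "x \<in> X" "y \<in> X" "\<Phi> x = \<Phi> y" and k: "k < n" for x y k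
    proof -
      have vp: "(vis g x k \<longleftrightarrow> vis g y k) \<and> (vis g x k \<longrightarrow> \<bar>pos g x k - pos g y k\<bar> \<le> \<epsilon>)" if g: "g \<in> L" for g
      proof -
        note cg = code[OF g, unfolded coding_def]
        have "c g x j = c g y j" if j: "j < n" for j
        proof (rule code_eq_of_counts[where c = "c g x" and d = "c g y" and k = j and q = "q g" and P = "P g" and n = n])
          fix r v assume rv: "r < q g" "v \<le> P g"
          then have "(g, r, v) \<in> \<Lambda>" using g by (simp add: \<Lambda>_def)
          then show "card {k. k < n \<and> k mod q g = r \<and> c g x k < v} = card {k. k < n \<and> k mod q g = r \<and> c g y k < v}"
            using fun_cong[OF xy(3), of "(g, r, v)"] by (simp add: \<Phi>_def)
        qed (use cg xy j in auto)
        then show ?thesis using cg xy k by blast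
      qed
      \<comment> \<open>If no long gap is visited at time \<open>k\<close>, the gap then occupied is
        shorter than \<open>\<epsilon>\<close> and contains both the iterate and the iterate of the
        reference point.\<close>
      have small: "\<bar>(F ^^ k) z - (F ^^ k) (fst (gap_of z))\<bar> < \<epsilon>" if z: "z \<notin> K" "\<And>g. g \<in> L \<Longrightarrow> \<not> vis g z k" for z
      proof -
        define h where "h = (nxt ^^ k) (gap_of z)"
        have h: "gap h" unfolding h_def using gap_nxtk gap_of(1)[OF z(1)] by blast
        define m where "m = \<lfloor>fst h\<rfloor>"
        have hg: "h = sh m (sh (- m) h)" by (simp add: sh_sh sh_0)
        have "sh (- m) h \<notin> L"
          using z(2)[of "sh (- m) h"] z(1) hg unfolding vis_def h_def[symmetric] by blast
        moreover have "gap (sh (- m) h)" using gap_sh[OF h] .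
        moreover have "0 \<le> fst (sh (- m) h)" "fst (sh (- m) h) < 1" unfolding m_def sh_simps by linarith+
        ultimately have "snd h - fst h < \<epsilon>" unfolding L_def by auto
        moreover have "z \<in> {fst (gap_of z)..snd (gap_of z)}" "fst (gap_of z) \<in> {fst (gap_of z)..snd (gap_of z)}"
          using gap_of[OF z(1)] by (auto simp: gap_def)
        then have "(F ^^ k) z \<in> {fst h..snd h}" "(F ^^ k) (fst (gap_of z)) \<in> {fst h..snd h}"
          using nxtk[OF gap_of(1)[OF z(1)], of k] unfolding h_def by blast+
        ultimately show ?thesis by auto
      qed
      show ?thesis
      proof (cases "\<exists>g\<in>L. vis g x k")
        case True
        then obtain g where g: "g \<in> L" "vis g x k" by blast
        then have v: "vis g y k" "\<bar>pos g x k - pos g y k\<bar> \<le> \<epsilon>" using vp by blast+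
        obtain m where m: "pos g x k = (F ^^ k) x - of_int m" using visE[OF g(2)] .
        obtain m' where m': "pos g y k = (F ^^ k) y - of_int m'" using visE[OF v(1)] .
        have "(F ^^ k) x - (F ^^ k) y - of_int (m - m') = pos g x k - pos g y k" using m m' by simp
        then show ?thesis using v(2) unfolding alike_def by metis
      next
        case False
        then have "\<And>g. g \<in> L \<Longrightarrow> \<not> vis g x k" "\<And>g. g \<in> L \<Longrightarrow> \<not> vis g y k" using vp by blast+
        then show ?thesis using small[of x] small[of y] unfolding alike_def by blast
      qed
    qed
    ultimately show ?thesis by blast
  qed
  then show ?thesis by blast
qed

end

section \<open>Entropy relative to an invariant set\<close>

lemma card_separated_le:
  assumes "finite S" "S \<subseteq> Y" "separated f \<rho> n e S" "finite T" "\<And>x. x \<in> Y \<Longrightarrow> h x \<in> T"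
    "\<And>x y k. x \<in> Y \<Longrightarrow> y \<in> Y \<Longrightarrow> h x = h y \<Longrightarrow> k < n \<Longrightarrow> \<rho> ((f ^^ k) x) ((f ^^ k) y) \<le> e"
  shows "card S \<le> card T"
proof (rule card_inj_on_le[where f = h])
  show "inj_on h S"
  proof (rule inj_onI, rule ccontr)
    fix x y assume xy: "x \<in> S" "y \<in> S" "h x = h y" "x \<noteq> y"
    then obtain k where "k < n" "\<rho> ((f ^^ k) x) ((f ^^ k) y) > e" using assms(3) unfolding separated_def by blast
    then show False using assms(6)[of x y k] xy assms(2) by (meson not_le subsetD)
  qed
qed (use assms in auto)

text \<open>\<open>sepnum\<close> is a supremum of natural numbers and carries its meaning only when
  the cardinalities are bounded.\<close>

definition sep_bounded :: "('a \<Rightarrow> 'a) \<Rightarrow> ('a \<Rightarrow> 'a \<Rightarrow> real) \<Rightarrow> 'a set \<Rightarrow> nat \<Rightarrow> real \<Rightarrow> bool" where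
  "sep_bounded f \<rho> Y n e \<longleftrightarrow> (\<exists>N. \<forall>S. finite S \<longrightarrow> S \<subseteq> Y \<longrightarrow> separated f \<rho> n e S \<longrightarrow> card S \<le> N)"

lemma sepnum_le:
  assumes "\<And>S. finite S \<Longrightarrow> S \<subseteq> Y \<Longrightarrow> separated f \<rho> n e S \<Longrightarrow> card S \<le> N"
  shows "sepnum f \<rho> Y n e \<le> N"
  unfolding sepnum_def
proof (rule cSup_least)
  have "card {} \<in> {card S |S. finite S \<and> S \<subseteq> Y \<and> separated f \<rho> n e S}"
    by (intro CollectI exI[of _ "{}"]) (simp add: separated_def)
  then show "{card S |S. finite S \<and> S \<subseteq> Y \<and> separated f \<rho> n e S} \<noteq> {}" by blast
qed (use assms in auto)

lemma sepnum_upper: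
  assumes "sep_bounded f \<rho> Y n e" "finite S" "S \<subseteq> Y" "separated f \<rho> n e S"
  shows "card S \<le> sepnum f \<rho> Y n e"
  unfolding sepnum_def
proof (rule cSup_upper)
  show "bdd_above {card S |S. finite S \<and> S \<subseteq> Y \<and> separated f \<rho> n e S}"
    using assms(1) unfolding sep_bounded_def bdd_above_def by blast
qed (use assms in auto)

lemma sepnum_attained:
  assumes "sep_bounded f \<rho> Y n e"
  obtains S where "finite S" "S \<subseteq> Y" "separated f \<rho> n e S" "card S = sepnum f \<rho> Y n e"
proof -
  let ?C = "{card S |S. finite S \<and> S \<subseteq> Y \<and> separated f \<rho> n e S}"
  have "card {} \<in> ?C" by (intro CollectI exI[of _ "{}"]) (simp add: separated_def)
  then have "?C \<noteq> {}" by blast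
  moreover have "bdd_above ?C" using assms unfolding sep_bounded_def bdd_above_def by blast
  then have "finite ?C" by (simp only: bdd_above_nat)
  ultimately have "Sup ?C \<in> ?C" unfolding Sup_nat_def by (simp only: if_False) (rule Max_in)
  then show thesis using that unfolding sepnum_def by auto
qed

lemma sepnum_pos:
  assumes "sep_bounded f \<rho> Y n e" "Y \<noteq> {}"
  shows "1 \<le> sepnum f \<rho> Y n e"
proof -
  obtain y where "y \<in> Y" using assms(2) by blast
  then show ?thesis using sepnum_upper[OF assms(1), of "{y}"] by (simp add: separated_def)
qed

text \<open>A point not shadowed by the set could be added to it, against maximality.\<close>

lemma maximal_separated_spanning:
  assumes bd: "sep_bounded f \<rho> Y n e" and sym: "\<And>x y. \<rho> x y = \<rho> y x" and refl: "\<And>x. \<rho> x x = 0" and e: "e > 0"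
  obtains S where "finite S" "S \<subseteq> Y" "card S = sepnum f \<rho> Y n e"
    "\<And>a. a \<in> Y \<Longrightarrow> \<exists>s\<in>S. \<forall>k<n. \<rho> ((f ^^ k) a) ((f ^^ k) s) \<le> e"
proof -
  obtain S where S: "finite S" "S \<subseteq> Y" "separated f \<rho> n e S" "card S = sepnum f \<rho> Y n e"
    using sepnum_attained[OF bd] .
  have "\<exists>s\<in>S. \<forall>k<n. \<rho> ((f ^^ k) a) ((f ^^ k) s) \<le> e" if a: "a \<in> Y" for a
  proof (rule ccontr)
    assume no: "\<not> ?thesis"
    have aS: "a \<notin> S" using no refl e by fastforce
    have no': "\<And>s. s \<in> S \<Longrightarrow> \<exists>k<n. \<rho> ((f ^^ k) a) ((f ^^ k) s) > e" using no by (meson not_le)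
    have "separated f \<rho> n e (insert a S)"
      unfolding separated_def
    proof (intro ballI impI)
      fix x y assume "x \<in> insert a S" "y \<in> insert a S" "x \<noteq> y"
      then consider "x \<in> S" "y \<in> S" | "x = a" "y \<in> S" | "y = a" "x \<in> S" by blast
      then show "\<exists>k<n. e < \<rho> ((f ^^ k) x) ((f ^^ k) y)"
      proof cases
        case 1
        then show ?thesis using S(3) \<open>x \<noteq> y\<close> unfolding separated_def by blast
      next
        case 2
        then show ?thesis using no' by simp
      next
        case 3
        then show ?thesis using no'[of x] sym by metis
      qed
    qed
    then have "card (insert a S) \<le> sepnum f \<rho> Y n e" using S a by (intro sepnum_upper[OF bd]) auto
    then show False using S aS by simp
  qed
  then show thesis using that S by blast
qed

text \<open>A polynomial factor contributes M ln (n + 2) / (n + 1) to the exponential growth rate,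
  which tends to 0.\<close>

lemma limsup_growth_le:
  fixes a b :: "nat \<Rightarrow> nat"
  assumes ab: "\<And>n. a n \<le> (n + 1) ^ M * b n" and b: "\<And>n. 1 \<le> b n"
  shows "limsup (\<lambda>n. ereal (ln (real (a (Suc n))) / real (Suc n)))
     \<le> limsup (\<lambda>n. ereal (ln (real (b (Suc n))) / real (Suc n)))"
proof -
  let ?u = "\<lambda>n. real M * (ln (real n + 2) / (real n + 1))"
  have u: "?u \<longlonglongrightarrow> 0" by real_asymp
  have le: "ln (real (a (Suc n))) / real (Suc n) \<le> ?u n + ln (real (b (Suc n))) / real (Suc n)" for n
  proof -
    have b1: "real (b (Suc n)) \<ge> 1" using b[of "Suc n"] by simp
    have "ln (real (a (Suc n))) \<le> real M * ln (real n + 2) + ln (real (b (Suc n)))"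
    proof (cases "a (Suc n) = 0")
      case True
      then show ?thesis using b1 by simp
    next
      case False
      have "real (a (Suc n)) \<le> real ((Suc n + 1) ^ M * b (Suc n))" using ab[of "Suc n"] by (rule of_nat_mono)
      also have "\<dots> = (real n + 2) ^ M * real (b (Suc n))" by (simp add: add.commute)
      finally have "ln (real (a (Suc n))) \<le> ln ((real n + 2) ^ M * real (b (Suc n)))"
        using False by (subst ln_le_cancel_iff) auto
      also have "\<dots> = real M * ln (real n + 2) + ln (real (b (Suc n)))"
        using b1 by (simp add: ln_mult ln_realpow)
      finally show ?thesis .
    qed
    then have "ln (real (a (Suc n))) / real (Suc n) \<le> (real M * ln (real n + 2) + ln (real (b (Suc n)))) / real (Suc n)"
      by (intro divide_right_mono) auto
    then show ?thesis by (simp add: add_divide_distrib add.commute)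
  qed
  have "limsup (\<lambda>n. ereal (ln (real (a (Suc n))) / real (Suc n)))
     \<le> limsup (\<lambda>n. ereal (?u n) + ereal (ln (real (b (Suc n))) / real (Suc n)))"
    by (intro Limsup_mono always_eventually allI) (use le in simp)
  also have "\<dots> = 0 + limsup (\<lambda>n. ereal (ln (real (b (Suc n))) / real (Suc n)))"
    using u by (intro ereal_limsup_lim_add) (auto simp: zero_ereal_def)
  finally show ?thesis by simp
qed

lemma top_entropy_le:
  assumes "Y \<noteq> {}" "Z \<noteq> {}" and bd: "\<And>n e. e > 0 \<Longrightarrow> sep_bounded f \<rho> Z n e"
    and le: "\<And>e. e > 0 \<Longrightarrow> \<exists>M e'. e' > 0 \<and> (\<forall>n. sepnum f \<rho> Y n e \<le> (n + 1) ^ M * sepnum f \<rho> Z n e')"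
  shows "top_entropy f \<rho> Y \<le> top_entropy f \<rho> Z"
proof -
  have "(SUP e\<in>{0<..}. limsup (\<lambda>n. ereal (ln (real (sepnum f \<rho> Y (Suc n) e)) / real (Suc n))))
     \<le> (SUP e\<in>{0<..}. limsup (\<lambda>n. ereal (ln (real (sepnum f \<rho> Z (Suc n) e)) / real (Suc n))))"
  proof (rule SUP_mono)
    fix e :: real assume "e \<in> {0<..}"
    then obtain M e' where M: "e' > 0" "\<And>n. sepnum f \<rho> Y n e \<le> (n + 1) ^ M * sepnum f \<rho> Z n e'" using le[of e] by (metis greaterThan_iff)
    have "limsup (\<lambda>n. ereal (ln (real (sepnum f \<rho> Y (Suc n) e)) / real (Suc n)))
        \<le> limsup (\<lambda>n. ereal (ln (real (sepnum f \<rho> Z (Suc n) e')) / real (Suc n)))"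
      by (rule limsup_growth_le[OF M(2)]) (rule sepnum_pos[OF bd[OF M(1)] assms(2)])
    then show "\<exists>m\<in>{0<..}. limsup (\<lambda>n. ereal (ln (real (sepnum f \<rho> Y (Suc n) e)) / real (Suc n)))
        \<le> limsup (\<lambda>n. ereal (ln (real (sepnum f \<rho> Z (Suc n) m)) / real (Suc n)))"
      using M(1) by auto
  qed
  then show ?thesis using assms(1,2) by (simp add: top_entropy_def)
qed

lemma top_entropy_eq_0:
  assumes "Y \<noteq> {}" and bd: "\<And>n e. e > 0 \<Longrightarrow> sep_bounded f \<rho> Y n e"
    and le: "\<And>e. e > 0 \<Longrightarrow> \<exists>M. \<forall>n. sepnum f \<rho> Y n e \<le> (n + 1) ^ M"
  shows "top_entropy f \<rho> Y = 0"
proof -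
  have "limsup (\<lambda>n. ereal (ln (real (sepnum f \<rho> Y (Suc n) e)) / real (Suc n))) = 0" if e: "e > 0" for e
  proof (rule antisym)
    obtain M where M: "\<And>n. sepnum f \<rho> Y n e \<le> (n + 1) ^ M" using le[OF e] by blast
    then show "limsup (\<lambda>n. ereal (ln (real (sepnum f \<rho> Y (Suc n) e)) / real (Suc n))) \<le> 0"
      using limsup_growth_le[of "\<lambda>n. sepnum f \<rho> Y n e" M "\<lambda>_. 1"] by (simp add: Limsup_const zero_ereal_def)
    have "0 \<le> ln (real (sepnum f \<rho> Y (Suc n) e)) / real (Suc n)" for n
      using sepnum_pos[OF bd[OF e] assms(1), of "Suc n"] by simp
    then show "0 \<le> limsup (\<lambda>n. ereal (ln (real (sepnum f \<rho> Y (Suc n) e)) / real (Suc n)))"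
      by (intro le_Limsup) auto
  qed
  then have "(SUP e\<in>{0<..}. limsup (\<lambda>n. ereal (ln (real (sepnum f \<rho> Y (Suc n) e)) / real (Suc n)))) = (SUP e\<in>{0<..}::real set. 0::ereal)"
    by (intro SUP_cong) auto
  then show ?thesis using assms(1) by (simp add: top_entropy_def greaterThan_non_empty)
qed

section \<open>Separated sets on the circle\<close>

context circle_lift begin

definition lift_pt :: "complex option \<Rightarrow> real" where
  "lift_pt z = (SOME t. 0 \<le> t \<and> t < 1 \<and> z = circ t)"

lemma lift_pt: assumes "z \<in> rhat" shows "0 \<le> lift_pt z" "lift_pt z < 1" "circ (lift_pt z) = z"
proof -
  have "\<exists>t. 0 \<le> t \<and> t < 1 \<and> z = circ t" using circ_surj[OF assms] by metis
  then have "0 \<le> lift_pt z \<and> lift_pt z < 1 \<and> z = circ (lift_pt z)" unfolding lift_pt_def by (rule someI_ex)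
  then show "0 \<le> lift_pt z" "lift_pt z < 1" "circ (lift_pt z) = z" by auto
qed

text \<open>Each iterate of the lift is bounded on a period, so only finitely many itineraries
  through cells of length \<open>e / 8\<close> are possible up to time n.\<close>

lemma sep_bounded_circle:
  assumes e: "e > 0" and Y: "Y \<subseteq> rhat"
  shows "sep_bounded f chordal Y n e"
proof -
  define \<epsilon> where "\<epsilon> = e / 8"
  have \<epsilon>: "\<epsilon> > 0" using e by (simp add: \<epsilon>_def)
  have "\<exists>C. \<forall>t\<in>{0..1}. \<bar>(F ^^ k) t\<bar> \<le> C" for k
  proof -
    have "bounded ((F ^^ k) ` {0..1})" by (intro compact_imp_bounded compact_continuous_image contFk) auto
    then show ?thesis by (auto simp: bounded_iff)
  qed
  then obtain C where C: "\<And>k t. t \<in> {0..1} \<Longrightarrow> \<bar>(F ^^ k) t\<bar> \<le> C k" by metis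
  define h where "h z = (\<lambda>k\<in>{..<n}. \<lfloor>(F ^^ k) (lift_pt z) / \<epsilon>\<rfloor>)" for z
  define T where "T = PiE {..<n} (\<lambda>k. {\<lfloor>- C k / \<epsilon>\<rfloor>..\<lfloor>C k / \<epsilon>\<rfloor>})"
  have "card S \<le> card T" if S: "finite S" "S \<subseteq> Y" "separated f chordal n e S" for S
  proof (rule card_separated_le[OF S, of T h])
    show "finite T" unfolding T_def by (intro finite_PiE) auto
    fix z assume z: "z \<in> Y"
    have "\<lfloor>(F ^^ k) (lift_pt z) / \<epsilon>\<rfloor> \<in> {\<lfloor>- C k / \<epsilon>\<rfloor>..\<lfloor>C k / \<epsilon>\<rfloor>}" for k
    proof -
      have "\<bar>(F ^^ k) (lift_pt z)\<bar> \<le> C k" using lift_pt[of z] z Y by (intro C) auto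
      then have "- C k \<le> (F ^^ k) (lift_pt z)" "(F ^^ k) (lift_pt z) \<le> C k" by (simp_all add: abs_le_iff)
      then have "- C k / \<epsilon> \<le> (F ^^ k) (lift_pt z) / \<epsilon>" "(F ^^ k) (lift_pt z) / \<epsilon> \<le> C k / \<epsilon>"
        using \<epsilon> by (intro divide_right_mono; simp)+
      then show ?thesis unfolding atLeastAtMost_iff by (intro conjI floor_mono)
    qed
    then show "h z \<in> T" unfolding h_def T_def by auto
  next
    fix z w k assume zw: "z \<in> Y" "w \<in> Y" "h z = h w" and k: "k < n"
    have "\<lfloor>(F ^^ k) (lift_pt z) / \<epsilon>\<rfloor> = \<lfloor>(F ^^ k) (lift_pt w) / \<epsilon>\<rfloor>" using fun_cong[OF zw(3), of k] k by (simp add: h_def)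
    then have "\<bar>(F ^^ k) (lift_pt z) - (F ^^ k) (lift_pt w)\<bar> < \<epsilon>" by (rule floor_eq_imp_close[OF \<epsilon>])
    moreover have "(f ^^ k) z = circ ((F ^^ k) (lift_pt z))" "(f ^^ k) w = circ ((F ^^ k) (lift_pt w))"
      using lift_pt(3)[of z] lift_pt(3)[of w] zw Y fk_circ by (metis subsetD)+
    ultimately show "chordal ((f ^^ k) z) ((f ^^ k) w) \<le> e"
      using chordal_circ_le[of "(F ^^ k) (lift_pt z)" "(F ^^ k) (lift_pt w)"] unfolding \<epsilon>_def by simp
  qed
  then show ?thesis unfolding sep_bounded_def by blast
qed

lemma top_entropy_mono:
  assumes "Y \<subseteq> Z" "Z \<subseteq> rhat" "Y \<noteq> {}"
  shows "top_entropy f chordal Y \<le> top_entropy f chordal Z"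
proof (rule top_entropy_le)
  show "\<exists>M e'. e' > 0 \<and> (\<forall>n. sepnum f chordal Y n e \<le> (n + 1) ^ M * sepnum f chordal Z n e')" if e: "e > 0" for e
  proof -
    have "sepnum f chordal Y n e \<le> sepnum f chordal Z n e" for n
      by (rule sepnum_le) (use assms sepnum_upper[OF sep_bounded_circle[OF e assms(2)]] in blast)
    then show ?thesis using e by (intro exI[of _ 0] exI[of _ e]) simp
  qed
qed (use assms sep_bounded_circle in auto)

end

context gap_system begin

text \<open>A point of \<open>X\<close> is described by its code and by a member of a spanning set
  of \<open>K\<close> that shadows its reference point; points with the same description stay within
  \<open>e\<close>.\<close>

lemma sepnum_le_sepnum_K:
  assumes e: "e > 0"
  shows "\<exists>M e'. e' > 0 \<and> (\<forall>n. sepnum f chordal (circ ` X) n e \<le> (n + 1) ^ M * sepnum f chordal (circ ` K) n e')"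
proof -
  \<comment> \<open>A distance of \<open>\<epsilon>\<close> on the line costs at most
    \<open>e / 4\<close> on the sphere. With \<open>e / 4\<close> for the shadowing this is
    \<open>e / 2\<close> for each of the two points compared.\<close>
  define \<epsilon> where "\<epsilon> = e / 32"
  have \<epsilon>: "\<epsilon> > 0" "e / 4 > 0" using e by (auto simp: \<epsilon>_def)
  obtain M where M: "\<And>n. \<exists>(\<Phi> :: real \<Rightarrow> (real \<times> real) \<times> nat \<times> nat \<Rightarrow> nat) T.
     finite T \<and> card T \<le> (n + 1) ^ M \<and> (\<forall>x\<in>X. \<Phi> x \<in> T) \<and>
     (\<forall>x\<in>X. \<forall>y\<in>X. \<Phi> x = \<Phi> y \<longrightarrow> (\<forall>k<n. alike \<epsilon> k x y))"
    using orbit_coding[OF \<epsilon>(1)] by blast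
  have "sepnum f chordal (circ ` X) n e \<le> (n + 1) ^ M * sepnum f chordal (circ ` K) n (e / 4)" for n
  proof -
    obtain \<Phi> :: "real \<Rightarrow> (real \<times> real) \<times> nat \<times> nat \<Rightarrow> nat" and T where \<Phi>: "finite T" "card T \<le> (n + 1) ^ M" "\<And>x. x \<in> X \<Longrightarrow> \<Phi> x \<in> T"
      "\<And>x y k. x \<in> X \<Longrightarrow> y \<in> X \<Longrightarrow> \<Phi> x = \<Phi> y \<Longrightarrow> k < n \<Longrightarrow> alike \<epsilon> k x y"
      using M[of n] by blast
    have bd: "sep_bounded f chordal (circ ` K) n (e / 4)" using \<epsilon>(2) by (intro sep_bounded_circle) auto
    obtain S where S: "finite S" "S \<subseteq> circ ` K" "card S = sepnum f chordal (circ ` K) n (e / 4)"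
      "\<And>a. a \<in> circ ` K \<Longrightarrow> \<exists>s\<in>S. \<forall>k<n. chordal ((f ^^ k) a) ((f ^^ k) s) \<le> e / 4"
      using maximal_separated_spanning[OF bd chordal_commute chordal_self \<epsilon>(2)] by blast
    define a where "a x = (if x \<in> K then x else fst (gap_of x))" for x
    have aK: "a x \<in> K" for x using gap_of(1)[of x] by (auto simp: a_def gap_def)
    then have "\<forall>x. \<exists>s\<in>S. \<forall>k<n. chordal ((f ^^ k) (circ (a x))) ((f ^^ k) s) \<le> e / 4" using S(4) by blast
    then obtain \<sigma> where \<sigma>: "\<And>x. \<sigma> x \<in> S" "\<And>x k. k < n \<Longrightarrow> chordal ((f ^^ k) (circ (a x))) ((f ^^ k) (\<sigma> x)) \<le> e / 4" by metis
    have near: "chordal ((f ^^ k) (circ x)) ((f ^^ k) (\<sigma> x)) \<le> e / 2"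
      if "x \<in> K \<or> \<bar>(F ^^ k) x - (F ^^ k) (fst (gap_of x))\<bar> < \<epsilon>" "k < n" for x k
    proof -
      have "\<bar>(F ^^ k) x - (F ^^ k) (a x)\<bar> \<le> \<epsilon>" using that(1) \<epsilon>(1) by (auto simp: a_def)
      then have "chordal ((f ^^ k) (circ x)) ((f ^^ k) (circ (a x))) \<le> e / 4"
        using chordal_circ_le[of "(F ^^ k) x" "(F ^^ k) (a x)"] by (simp add: fk_circ \<epsilon>_def)
      then show ?thesis using chordal_triangle[of "(f ^^ k) (circ x)" "(f ^^ k) (\<sigma> x)" "(f ^^ k) (circ (a x))"] \<sigma>(2)[OF that(2), of x] by simp
    qed
    define h where "h z = (\<Phi> (lift_pt z), \<sigma> (lift_pt z))" for z
    have "card S' \<le> card (T \<times> S)" if S': "finite S'" "S' \<subseteq> circ ` X" "separated f chordal n e S'" for S'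
    proof (rule card_separated_le[OF S', of "T \<times> S" h])
      show "finite (T \<times> S)" using \<Phi>(1) S(1) by simp
      have lX: "lift_pt z \<in> X" "circ (lift_pt z) = z" if "z \<in> circ ` X" for z
      proof -
        have "z \<in> rhat" using that by auto
        then show "circ (lift_pt z) = z" by (rule lift_pt)
        then show "lift_pt z \<in> X" using that circ_in_X by metis
      qed
      show "h z \<in> T \<times> S" if "z \<in> circ ` X" for z using lX[OF that] \<Phi>(3) \<sigma>(1) by (simp add: h_def)
      fix z w k assume zw: "z \<in> circ ` X" "w \<in> circ ` X" "h z = h w" and k: "k < n"
      define x y where "x = lift_pt z" and "y = lift_pt w"
      have xy: "x \<in> X" "y \<in> X" "z = circ x" "w = circ y" "\<Phi> x = \<Phi> y" "\<sigma> x = \<sigma> y"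
        using lX zw by (auto simp: x_def y_def h_def)
      consider m :: int where "\<bar>(F ^^ k) x - (F ^^ k) y - of_int m\<bar> \<le> \<epsilon>" |
        "x \<in> K \<or> \<bar>(F ^^ k) x - (F ^^ k) (fst (gap_of x))\<bar> < \<epsilon>" "y \<in> K \<or> \<bar>(F ^^ k) y - (F ^^ k) (fst (gap_of y))\<bar> < \<epsilon>"
        using \<Phi>(4)[OF xy(1,2,5) k] unfolding alike_def by blast
      then show "chordal ((f ^^ k) z) ((f ^^ k) w) \<le> e"
      proof cases
        case 1
        have "(f ^^ k) w = circ ((F ^^ k) y + of_int m)" by (simp add: xy fk_circ)
        moreover have "\<bar>(F ^^ k) x - ((F ^^ k) y + of_int m)\<bar> \<le> \<epsilon>" using 1 by (simp add: diff_diff_eq)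
        ultimately show ?thesis using chordal_circ_le[of "(F ^^ k) x" "(F ^^ k) y + of_int m"] e
          by (simp add: xy(3) fk_circ \<epsilon>_def)
      next
        case 2
        have "chordal ((f ^^ k) z) ((f ^^ k) (\<sigma> x)) \<le> e / 2" using near[OF 2(1) k] xy(3) by simp
        moreover have "chordal ((f ^^ k) (\<sigma> x)) ((f ^^ k) w) \<le> e / 2"
          using near[OF 2(2) k] xy(4,6) chordal_commute[of "(f ^^ k) (\<sigma> x)"] by simp
        ultimately show ?thesis
          using chordal_triangle[of "(f ^^ k) z" "(f ^^ k) w" "(f ^^ k) (\<sigma> x)"] by linarith
      qed
    qed
    then have "sepnum f chordal (circ ` X) n e \<le> card (T \<times> S)" by (rule sepnum_le)
    also have "\<dots> \<le> (n + 1) ^ M * sepnum f chordal (circ ` K) n (e / 4)"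
      using \<Phi>(2) S(3) by (simp add: card_cartesian_product)
    finally show ?thesis .
  qed
  then show ?thesis using \<epsilon>(2) by blast
qed

lemma top_entropy_le_K:
  assumes "X \<noteq> {}"
  shows "top_entropy f chordal (circ ` X) \<le> top_entropy f chordal (circ ` K)"
proof (rule top_entropy_le)
  show "sep_bounded f chordal (circ ` K) n e" if "e > 0" for n e
    using that by (intro sep_bounded_circle) auto
qed (use assms K_ne sepnum_le_sepnum_K in \<open>auto simp del: One_nat_def\<close>)

end

section \<open>Circle maps without periodic points\<close>

locale circle_lift_aperiodic = circle_lift +
  assumes aperiodic: "\<And>n t m. n \<ge> 1 \<Longrightarrow> (F ^^ n) t \<noteq> t + of_int m"
begin

text \<open>Over one period F t - t changes by D - 1. If that is not 0, an integer value is
  attained, which is a fixed point on the circle.\<close>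

lemma degree_one: "D = 1"
proof (rule ccontr)
  assume "D \<noteq> 1"
  define \<phi> where "\<phi> t = F t - t" for t
  have c: "continuous_on UNIV \<phi>" unfolding \<phi>_def by (intro continuous_intros contF)
  have "\<phi> 1 = \<phi> 0 + of_int (D - 1)" using F_shift1[of 0] by (simp add: \<phi>_def)
  then have "\<bar>\<phi> 1 - \<phi> 0\<bar> \<ge> 1" using \<open>D \<noteq> 1\<close> by linarith
  then have m: "min (\<phi> 0) (\<phi> 1) \<le> of_int \<lceil>min (\<phi> 0) (\<phi> 1)\<rceil>" "of_int \<lceil>min (\<phi> 0) (\<phi> 1)\<rceil> \<le> max (\<phi> 0) (\<phi> 1)"
    by linarith+
  have "connected (range \<phi>)" using c by (intro connected_continuous_image) auto
  then have "{min (\<phi> 0) (\<phi> 1)..max (\<phi> 0) (\<phi> 1)} \<subseteq> range \<phi>"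
    by (intro connected_contains_Icc) (auto simp: min_def max_def)
  then obtain t where "\<phi> t = of_int \<lceil>min (\<phi> 0) (\<phi> 1)\<rceil>" using m by (metis atLeastAtMost_iff imageE subsetD)
  then have "F t = t + of_int \<lceil>min (\<phi> 0) (\<phi> 1)\<rceil>" by (simp add: \<phi>_def)
  then show False using aperiodic[of 1 t "\<lceil>min (\<phi> 0) (\<phi> 1)\<rceil>"] by simp
qed

lemma Fn_shift: "(F ^^ n) (t + of_int m) = (F ^^ n) t + of_int m"
  using Fk_shift[of n t m] by (simp add: degree_one)

lemma Fn_shift_diff: "(F ^^ n) (t - of_int m) = (F ^^ n) t - of_int m"
  using Fk_shift_diff[of n t m] by (simp add: degree_one)

text \<open>The displacement of an iterate is continuous and never an integer, so it stays on one
  side of each integer.\<close>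

lemma displacement_sign:
  assumes n: "n \<ge> 1"
  shows "(F ^^ n) s > s + of_int m \<longleftrightarrow> (F ^^ n) t > t + of_int m"
proof -
  have *: False if "(F ^^ n) s > s + of_int m" "(F ^^ n) t < t + of_int m" for s t
  proof -
    define \<phi> where "\<phi> t = (F ^^ n) t - t" for t
    have c: "continuous_on UNIV \<phi>" unfolding \<phi>_def by (intro continuous_intros contFk)
    have "connected (range \<phi>)" using c by (intro connected_continuous_image) auto
    then have "{\<phi> t..\<phi> s} \<subseteq> range \<phi>" by (intro connected_contains_Icc) auto
    moreover have "of_int m \<in> {\<phi> t..\<phi> s}" using that by (simp add: \<phi>_def)
    ultimately obtain u where "of_int m = \<phi> u" by blast
    then have "(F ^^ n) u = u + of_int m" by (simp add: \<phi>_def)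
    then show False using aperiodic[OF n] by blast
  qed
  show ?thesis using *[of s t] *[of t s] aperiodic[OF n, of s m] aperiodic[OF n, of t m] by (meson linorder_neqE)
qed

section \<open>The rotation number and its irrationality\<close>

definition fl :: "nat \<Rightarrow> int" where "fl n = \<lfloor>(F ^^ n) 0\<rfloor>"

lemma fl_bounds: assumes "n \<ge> 1" shows "t + of_int (fl n) < (F ^^ n) t" "(F ^^ n) t < t + of_int (fl n) + 1"
proof -
  have "of_int (fl n) < (F ^^ n) 0" "\<not> of_int (fl n + 1) < (F ^^ n) 0"
    using aperiodic[OF assms, of 0 "fl n"] unfolding fl_def by linarith+
  then show "t + of_int (fl n) < (F ^^ n) t" "(F ^^ n) t < t + of_int (fl n) + 1"
    using displacement_sign[OF assms, of 0 "fl n" t] displacement_sign[OF assms, of 0 "fl n + 1" t]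
      aperiodic[OF assms, of t "fl n + 1"] by auto
qed

lemma Fn_mult_ge:
  assumes "\<And>t. (F ^^ n) t \<ge> t + c"
  shows "(F ^^ (n * j)) t \<ge> t + real j * c"
proof (induction j)
  case (Suc j)
  have "(F ^^ (n * Suc j)) t = (F ^^ n) ((F ^^ (n * j)) t)" by (simp add: funpow_add)
  then show ?case using assms[of "(F ^^ (n * j)) t"] Suc by (simp add: algebra_simps)
qed simp

lemma Fn_mult_le:
  assumes "\<And>t. (F ^^ n) t \<le> t + c"
  shows "(F ^^ (n * j)) t \<le> t + real j * c"
proof (induction j)
  case (Suc j)
  have "(F ^^ (n * Suc j)) t = (F ^^ n) ((F ^^ (n * j)) t)" by (simp add: funpow_add)
  then show ?case using assms[of "(F ^^ (n * j)) t"] Suc by (simp add: algebra_simps)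
qed simp

text \<open>The rotation number of the lift, obtained as the supremum of the lower bounds that the
  integer parts give; no limit has to be shown to exist.\<close>

definition \<rho> :: real where "\<rho> = (SUP n\<in>{1..}. of_int (fl n) / real n)"

text \<open>The n-step lower bound iterated j times and the j-step upper bound iterated n times
  estimate the same displacement. Strictness comes from this displacement not being an
  integer.\<close>

lemma fl_compare:
  assumes "n \<ge> 1" "j \<ge> 1"
  shows "of_int (fl n) / real n < (of_int (fl j) + 1) / real j"
proof -
  have "(F ^^ (n * j)) 0 \<ge> 0 + real j * of_int (fl n)"
    using fl_bounds(1)[OF assms(1)] by (intro Fn_mult_ge less_imp_le)
  moreover have "(F ^^ (j * n)) 0 \<le> 0 + real n * (of_int (fl j) + 1)"
    using fl_bounds(2)[OF assms(2)] by (intro Fn_mult_le) (simp add: add.assoc less_imp_le)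
  moreover have "(F ^^ (n * j)) 0 \<noteq> 0 + of_int (int j * fl n)" using assms by (intro aperiodic) simp
  ultimately have "real j * of_int (fl n) < real n * (of_int (fl j) + 1)"
    by (simp add: mult.commute[of j n])
  then show ?thesis using assms by (simp add: field_simps)
qed

lemma rho_bounds:
  assumes n: "n \<ge> 1"
  shows "of_int (fl n) / real n \<le> \<rho>" "\<rho> \<le> (of_int (fl n) + 1) / real n"
proof -
  have bd: "bdd_above ((\<lambda>n. of_int (fl n) / real n) ` {1..})"
    using fl_compare[OF _ order_refl[of 1]] by (intro bdd_aboveI2[of _ _ "(of_int (fl 1) + 1) / real 1"]) (auto intro: less_imp_le)
  show "of_int (fl n) / real n \<le> \<rho>" unfolding \<rho>_def by (rule cSUP_upper[OF _ bd]) (use n in simp)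
  show "\<rho> \<le> (of_int (fl n) + 1) / real n" unfolding \<rho>_def
    by (rule cSUP_least) (use fl_compare[OF _ n] in \<open>auto intro: less_imp_le\<close>)
qed

text \<open>The displacement is periodic and continuous, so it attains its extrema and keeps a
  uniform distance from the two neighbouring integers.\<close>

lemma displacement_gap:
  assumes n: "n \<ge> 1"
  obtains \<eta> where "\<eta> > 0" "\<And>t. (F ^^ n) t \<ge> t + (of_int (fl n) + \<eta>)" "\<And>t. (F ^^ n) t \<le> t + (of_int (fl n) + 1 - \<eta>)"
proof -
  define \<phi> where "\<phi> t = (F ^^ n) t - t - of_int (fl n)" for t
  have c: "continuous_on {0..1} \<phi>" unfolding \<phi>_def by (intro continuous_intros contFk)
  obtain x where x: "x \<in> {0..1}" "\<And>t. t \<in> {0..1} \<Longrightarrow> \<phi> x \<le> \<phi> t" using continuous_attains_inf[OF _ _ c] by auto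
  obtain y where y: "y \<in> {0..1}" "\<And>t. t \<in> {0..1} \<Longrightarrow> \<phi> t \<le> \<phi> y" using continuous_attains_sup[OF _ _ c] by auto
  have per: "\<phi> t = \<phi> (frac t)" for t
    using Fn_shift_diff[of n t "\<lfloor>t\<rfloor>"] by (simp add: \<phi>_def frac_def)
  have fr: "frac t \<in> {0..1}" for t :: real by (simp add: frac_lt_1 less_imp_le)
  have b: "0 < \<phi> x" "\<phi> y < 1" using fl_bounds(1)[OF n, of x] fl_bounds(2)[OF n, of y] by (simp_all add: \<phi>_def)
  show thesis
  proof (rule that[of "min (\<phi> x) (1 - \<phi> y)"])
    fix t
    have "\<phi> x \<le> \<phi> t" "\<phi> t \<le> \<phi> y" using x(2)[OF fr] y(2)[OF fr] per by metis+
    then show "(F ^^ n) t \<ge> t + (of_int (fl n) + min (\<phi> x) (1 - \<phi> y))"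
      "(F ^^ n) t \<le> t + (of_int (fl n) + 1 - min (\<phi> x) (1 - \<phi> y))" unfolding \<phi>_def[of t] by auto
  qed (use b in auto)
qed

text \<open>In case of equality the margin \<eta> accumulates: after j rounds with j \<eta> > 1 the
  displacement has passed another integer, against the nonstrict bound for
  \<open>n * j\<close>.\<close>

lemma rho_strict:
  assumes n: "n \<ge> 1"
  shows "of_int (fl n) < real n * \<rho>" "real n * \<rho> < of_int (fl n) + 1"
proof -
  have n0: "real n > 0" using n by simp
  have le: "of_int (fl n) \<le> real n * \<rho>" "real n * \<rho> \<le> of_int (fl n) + 1"
    using rho_bounds[OF n] n0 by (auto simp: field_simps)
  obtain \<eta> where \<eta>: "\<eta> > 0" "\<And>t. (F ^^ n) t \<ge> t + (of_int (fl n) + \<eta>)" "\<And>t. (F ^^ n) t \<le> t + (of_int (fl n) + 1 - \<eta>)"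
    using displacement_gap[OF n] by metis
  obtain j where j: "real j * \<eta> > 1" using reals_Archimedean3[OF \<eta>(1)] by blast
  have j1: "j \<ge> 1" using j by (cases j) auto
  then have nj: "n * j \<ge> 1" using n by simp
  have "real (n * j) * \<rho> \<noteq> real j * of_int (fl n)"
  proof
    assume e: "real (n * j) * \<rho> = real j * of_int (fl n)"
    have "(F ^^ (n * j)) 0 \<ge> 0 + real j * (of_int (fl n) + \<eta>)" by (rule Fn_mult_ge[OF \<eta>(2)])
    then have "(F ^^ (n * j)) 0 \<ge> real j * of_int (fl n) + real j * \<eta>" by (simp add: distrib_left)
    then have "(F ^^ (n * j)) 0 > of_int (int j * fl n + 1)" using j by simp
    then have "int j * fl n + 1 \<le> fl (n * j)" unfolding fl_def[of "n * j"] by linarith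
    then have "real_of_int (int j * fl n + 1) \<le> of_int (fl (n * j))" by (rule of_int_le_iff[THEN iffD2])
    also have "\<dots> \<le> real (n * j) * \<rho>" using rho_bounds(1)[OF nj] nj by (simp add: field_simps)
    finally have "real j * of_int (fl n) + 1 \<le> real (n * j) * \<rho>" by simp
    then show False using e by linarith
  qed
  moreover have "real (n * j) * \<rho> \<noteq> real j * (of_int (fl n) + 1)"
  proof
    assume e: "real (n * j) * \<rho> = real j * (of_int (fl n) + 1)"
    have "(F ^^ (n * j)) 0 \<le> 0 + real j * (of_int (fl n) + 1 - \<eta>)" by (rule Fn_mult_le[OF \<eta>(3)])
    then have "(F ^^ (n * j)) 0 \<le> real j * (of_int (fl n) + 1) - real j * \<eta>" by (simp add: right_diff_distrib)
    then have "(F ^^ (n * j)) 0 < of_int (int j * (fl n + 1) - 1)" using j by simp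
    then have "fl (n * j) < int j * (fl n + 1) - 1" unfolding fl_def[of "n * j"] by linarith
    then have "fl (n * j) + 1 < int j * (fl n + 1)" by simp
    then have "real_of_int (fl (n * j) + 1) < of_int (int j * (fl n + 1))" by (rule of_int_less_iff[THEN iffD2])
    moreover have "real (n * j) * \<rho> \<le> of_int (fl (n * j) + 1)" using rho_bounds(2)[OF nj] nj by (simp add: field_simps)
    ultimately have "real (n * j) * \<rho> < of_int (int j * (fl n + 1))" by linarith
    then have "real (n * j) * \<rho> < real j * (of_int (fl n) + 1)" by simp
    then show False using e by linarith
  qed
  ultimately show "of_int (fl n) < real n * \<rho>" "real n * \<rho> < of_int (fl n) + 1"
    using le j1 by (auto simp: order.order_iff_strict)
qed

text \<open>Both the displacement and n \<rho> lie strictly between \<open>fl n\<close> and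
  \<open>fl n + 1\<close>, hence on the same side of every integer.\<close>

lemma displacement_rho:
  assumes n: "n \<ge> 1"
  shows "(F ^^ n) t > t + of_int m \<longleftrightarrow> real n * \<rho> > of_int m"
    "(F ^^ n) t < t + of_int m \<longleftrightarrow> real n * \<rho> < of_int m"
proof -
  consider "m \<le> fl n" | "m \<ge> fl n + 1" by linarith
  then have "((F ^^ n) t > t + of_int m \<longleftrightarrow> real n * \<rho> > of_int m) \<and>
    ((F ^^ n) t < t + of_int m \<longleftrightarrow> real n * \<rho> < of_int m)"
  proof cases
    case 1
    then have "real_of_int m \<le> of_int (fl n)" by simp
    then show ?thesis using fl_bounds(1)[OF n, of t] rho_strict(1)[OF n] by linarith
  next
    case 2
    then have "real_of_int m \<ge> of_int (fl n) + 1" by linarith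
    then show ?thesis using fl_bounds(2)[OF n, of t] rho_strict(2)[OF n] by linarith
  qed
  then show "(F ^^ n) t > t + of_int m \<longleftrightarrow> real n * \<rho> > of_int m"
    "(F ^^ n) t < t + of_int m \<longleftrightarrow> real n * \<rho> < of_int m" by auto
qed

text \<open>If n \<rho> were an integer, the displacement of \<open>F ^^ n\<close> could be neither
  above nor below it.\<close>

lemma rho_irrational: "\<rho> \<notin> \<rat>"
proof
  assume "\<rho> \<in> \<rat>"
  then obtain a b where ab: "b > 0" "\<rho> = of_int a / of_int b" using Rats_cases' by metis
  define n where "n = nat b"
  have n: "n \<ge> 1" "real n * \<rho> = of_int a" using ab by (auto simp: n_def)
  then have "\<not> real n * \<rho> > of_int a" "\<not> real n * \<rho> < of_int a" by auto
  then show False using displacement_rho[OF n(1), of 0 a] aperiodic[OF n(1), of 0 a] by (meson linorder_neqE)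
qed

lemma rho_approx:
  assumes "\<delta> > 0"
  shows "\<exists>n\<ge>1. \<exists>m::int. - \<delta> < real n * \<rho> - of_int m \<and> real n * \<rho> - of_int m < 0"
    "\<exists>n\<ge>1. \<exists>m::int. 0 < real n * \<rho> - of_int m \<and> real n * \<rho> - of_int m < \<delta>"
proof -
  have irr: "real n * \<rho> \<noteq> of_int m" if "n > 0" for n m
  proof
    assume "real n * \<rho> = of_int m"
    then have "\<rho> = of_int m / of_nat n" using that by (simp add: field_simps)
    then show False using rho_irrational by simp
  qed
  obtain n where n: "n > 0" "\<bar>frac (real n * \<rho>) - 1\<bar> < \<delta>"
    using Kronecker_approx_1_explicit[OF rho_irrational, of 1 \<delta>] assms by auto
  have "- \<delta> < real n * \<rho> - of_int (\<lfloor>real n * \<rho>\<rfloor> + 1)" "real n * \<rho> - of_int (\<lfloor>real n * \<rho>\<rfloor> + 1) < 0"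
    using n(2) frac_lt_1[of "real n * \<rho>"] by (auto simp: frac_def)
  then show "\<exists>n\<ge>1. \<exists>m::int. - \<delta> < real n * \<rho> - of_int m \<and> real n * \<rho> - of_int m < 0"
    using n(1) by (metis less_eq_Suc_le One_nat_def)
  obtain n where n: "n > 0" "\<bar>frac (real n * \<rho>) - 0\<bar> < \<delta>"
    using Kronecker_approx_1_explicit[OF rho_irrational, of 0 \<delta>] assms by auto
  have "0 < real n * \<rho> - of_int \<lfloor>real n * \<rho>\<rfloor>" "real n * \<rho> - of_int \<lfloor>real n * \<rho>\<rfloor> < \<delta>"
    using n(2) of_int_floor_le[of "real n * \<rho>"] irr[OF n(1), of "\<lfloor>real n * \<rho>\<rfloor>"]
    by (simp_all add: frac_def less_le)
  then show "\<exists>n\<ge>1. \<exists>m::int. 0 < real n * \<rho> - of_int m \<and> real n * \<rho> - of_int m < \<delta>"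
    using n(1) by (metis less_eq_Suc_le One_nat_def)
qed

section \<open>The order of an orbit and the absence of folds\<close>

definition orb :: "nat \<Rightarrow> int \<Rightarrow> real" where "orb i k = (F ^^ i) 0 + of_int k"

definition orbit :: "real set" where "orbit = {orb i k | i k. True}"

text \<open>The later orbit point is an iterate of the earlier one, so the comparison is a question
  about a displacement. Thus the translated orbit of 0 is ordered like that of the rotation by
  \<rho>.\<close>

lemma orb_less: "orb i k < orb j l \<longleftrightarrow> real i * \<rho> + of_int k < real j * \<rho> + of_int l"
proof -
  consider "i = j" | "i < j" | "j < i" by linarith
  then show ?thesis
  proof cases
    case 2
    define n where "n = j - i"
    have n: "n \<ge> 1" "j = n + i" using 2 by (auto simp: n_def)
    have "orb j l - of_int l = (F ^^ n) ((F ^^ i) 0)" by (simp add: orb_def n(2) funpow_add)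
    then have "orb i k < orb j l \<longleftrightarrow> (F ^^ n) ((F ^^ i) 0) > (F ^^ i) 0 + of_int (k - l)" by (auto simp: orb_def)
    also have "\<dots> \<longleftrightarrow> real n * \<rho> > of_int (k - l)" by (rule displacement_rho(1)[OF n(1)])
    finally show ?thesis by (auto simp: n(2) algebra_simps)
  next
    case 3
    define n where "n = i - j"
    have n: "n \<ge> 1" "i = n + j" using 3 by (auto simp: n_def)
    have "orb i k - of_int k = (F ^^ n) ((F ^^ j) 0)" by (simp add: orb_def n(2) funpow_add)
    then have "orb i k < orb j l \<longleftrightarrow> (F ^^ n) ((F ^^ j) 0) < (F ^^ j) 0 + of_int (l - k)" by (auto simp: orb_def)
    also have "\<dots> \<longleftrightarrow> real n * \<rho> < of_int (l - k)" by (rule displacement_rho(2)[OF n(1)])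
    finally show ?thesis by (auto simp: n(2) algebra_simps)
  qed (simp add: orb_def)
qed

lemma F_orb: "F (orb i k) = orb (Suc i) k"
  using Fn_shift[of 1] by (simp add: orb_def)

lemma F_mono_orbit: "q \<in> orbit \<Longrightarrow> r \<in> orbit \<Longrightarrow> q < r \<Longrightarrow> F q < F r"
  by (auto simp: orbit_def F_orb orb_less algebra_simps)

text \<open>Auslander and Katznelson: a fold over two orbit points would force a point to be displaced by an
  iterate in the direction opposite to the common direction of displacement.\<close>

lemma no_fold_left:
  assumes "q \<in> orbit" "r \<in> orbit" "q < r" "y < q"
  shows "F y < F r"
proof (rule ccontr)
  assume "\<not> ?thesis"
  then have "F q \<le> F r" "F r \<le> F y" using F_mono_orbit[OF assms(1-3)] by auto
  then obtain y' where y': "y \<le> y'" "y' \<le> q" "F y' = F r"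
    using IVT2'[of F q "F r" y] contF' assms(4) by auto
  obtain j l i k where q: "q = orb j l" and r: "r = orb i k" using assms(1,2) by (auto simp: orbit_def)
  \<comment> \<open>Choose n \<rho> - m negative but so small that moving \<open>r\<close> by
    \<open>F ^^ n\<close> and -m leaves it to the right of \<open>q\<close>. Since \<open>y'\<close>
    and \<open>r\<close> have the same image, \<open>y'\<close> would be moved to the right as well,
    while n \<rho> < m moves every point to the left.\<close>
  have "real i * \<rho> + of_int k - (real j * \<rho> + of_int l) > 0" using assms(3) unfolding q r orb_less by simp
  then obtain n m where n: "n \<ge> 1" "- (real i * \<rho> + of_int k - (real j * \<rho> + of_int l)) < real n * \<rho> - of_int m"
    "real n * \<rho> < of_int m" using rho_approx(1) by (metis diff_less_0_iff_less)
  have "(F ^^ n) r - of_int m = orb (n + i) (k - m)"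
    unfolding r orb_def using Fn_shift[of n "(F ^^ i) 0" k] by (simp add: funpow_add)
  moreover have "q < orb (n + i) (k - m)" unfolding q orb_less using n(2) by (simp add: algebra_simps)
  moreover have "(F ^^ n) y' = (F ^^ n) r" using y'(3) n(1) by (cases n) (auto simp: funpow_swap1)
  ultimately have "(F ^^ n) y' > y' + of_int m" using y'(2) by simp
  then show False using displacement_rho(1)[OF n(1), of y' m] n(3) by simp
qed

lemma no_fold_right:
  assumes "q \<in> orbit" "r \<in> orbit" "r < q" "q < y"
  shows "F r < F y"
proof (rule ccontr)
  assume "\<not> ?thesis"
  then have "F r \<le> F q" "F y \<le> F r" using F_mono_orbit[OF assms(2,1,3)] by auto
  then obtain y' where y': "q \<le> y'" "y' \<le> y" "F y' = F r"
    using IVT2'[of F y "F r" q] contF' assms(4) by auto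
  obtain j l i k where q: "q = orb j l" and r: "r = orb i k" using assms(1,2) by (auto simp: orbit_def)
  have "real j * \<rho> + of_int l - (real i * \<rho> + of_int k) > 0" using assms(3) unfolding q r orb_less by simp
  then obtain n m where n: "n \<ge> 1" "real n * \<rho> - of_int m < real j * \<rho> + of_int l - (real i * \<rho> + of_int k)"
    "real n * \<rho> > of_int m" using rho_approx(2) by (metis diff_gt_0_iff_gt)
  have "(F ^^ n) r - of_int m = orb (n + i) (k - m)"
    unfolding r orb_def using Fn_shift[of n "(F ^^ i) 0" k] by (simp add: funpow_add)
  moreover have "orb (n + i) (k - m) < q" unfolding q orb_less using n(2) by (simp add: algebra_simps)
  moreover have "(F ^^ n) y' = (F ^^ n) r" using y'(3) n(1) by (cases n) (auto simp: funpow_swap1)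
  ultimately have "(F ^^ n) y' < y' + of_int m" using y'(1) by simp
  then show False using displacement_rho(2)[OF n(1), of y' m] n(3) by simp
qed

text \<open>The lift of the limit set of the orbit of 0. The base point need not lie in
  \<open>X\<close>: the gap argument compares orbits of \<open>X\<close> with the set
  \<open>K\<close>, without placing \<open>K\<close> inside \<open>X\<close>.\<close>

definition Lim :: "real set" where "Lim = {z. z islimpt orbit}"

lemma Lim_near: "z \<in> Lim \<Longrightarrow> e > 0 \<Longrightarrow> \<exists>q\<in>orbit. q \<noteq> z \<and> dist q z < e"
  unfolding Lim_def islimpt_approachable by simp

lemma Lim_closed: "closed Lim"
  unfolding Lim_def by (rule closed_limpts)

lemma orb_inj: "orb i k = orb j l \<Longrightarrow> i = j \<and> k = l"
proof -
  assume e: "orb i k = orb j l"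
  then have "\<not> orb i k < orb j l" "\<not> orb j l < orb i k" by auto
  then have eq: "real i * \<rho> + of_int k = real j * \<rho> + of_int l" unfolding orb_less by simp
  have "i = j"
  proof (rule ccontr)
    assume "i \<noteq> j"
    then have "\<rho> = of_int (l - k) / of_int (int i - int j)" using eq by (simp add: field_simps)
    then show False using rho_irrational by (metis Rats_divide Rats_of_int)
  qed
  then show ?thesis using eq by simp
qed

lemma Lim_F: assumes "z \<in> Lim" shows "F z \<in> Lim"
  unfolding Lim_def mem_Collect_eq islimpt_approachable
proof (intro allI impI)
  fix e :: real assume "e > 0"
  then obtain \<delta> where \<delta>: "\<delta> > 0" "\<And>u. \<bar>u - z\<bar> < \<delta> \<Longrightarrow> \<bar>F u - F z\<bar> < e" using Fk_near[of e z 1] by auto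
  \<comment> \<open>Two orbit points with different images are taken, because one image could
    coincide with \<open>F z\<close> and would then not count for a limit point.\<close>
  have "infinite (orbit \<inter> ball z \<delta>)" using assms \<delta>(1) unfolding Lim_def by (simp add: islimpt_eq_infinite_ball)
  then obtain q1 where q1: "q1 \<in> orbit \<inter> ball z \<delta>" by (metis ex_in_conv finite.emptyI)
  have "infinite (orbit \<inter> ball z \<delta> - {q1})" using \<open>infinite (orbit \<inter> ball z \<delta>)\<close> by simp
  then obtain q2 where q2: "q2 \<in> orbit \<inter> ball z \<delta> - {q1}" by (metis ex_in_conv finite.emptyI)
  have "F q1 \<noteq> F q2" using F_mono_orbit[of q1 q2] F_mono_orbit[of q2 q1] q1 q2 by (cases "q1 < q2") auto
  moreover have "F q1 \<in> orbit" "F q2 \<in> orbit" using q1 q2 F_orb by (auto simp: orbit_def)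
  moreover have "dist (F q1) (F z) < e" "dist (F q2) (F z) < e"
    using \<delta>(2)[of q1] \<delta>(2)[of q2] q1 q2 by (auto simp: dist_real_def abs_minus_commute)
  ultimately show "\<exists>x'\<in>orbit. x' \<noteq> F z \<and> dist x' (F z) < e" by metis
qed

lemma Lim_shift: "z + of_int m \<in> Lim \<longleftrightarrow> z \<in> Lim"
proof -
  have *: "z + of_int m \<in> Lim" if z: "z \<in> Lim" for z m
    unfolding Lim_def mem_Collect_eq islimpt_approachable
  proof (intro allI impI)
    fix e :: real assume "e > 0"
    then obtain q where q: "q \<in> orbit" "q \<noteq> z" "dist q z < e" using Lim_near[OF z] by metis
    obtain i k where "q = orb i k" using q(1) by (auto simp: orbit_def)
    then have "q + of_int m = orb i (k + m)" by (simp add: orb_def)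
    then have "q + of_int m \<in> orbit" by (auto simp: orbit_def)
    then show "\<exists>x'\<in>orbit. x' \<noteq> z + of_int m \<and> dist x' (z + of_int m) < e"
      using q by (intro bexI[of _ "q + of_int m"]) auto
  qed
  show ?thesis using *[of z m] *[of "z + of_int m" "- m"] by auto
qed

lemma Lim_ne: "Lim \<noteq> {}"
proof -
  have "inj (\<lambda>i. orb i (- \<lfloor>(F ^^ i) 0\<rfloor>))" using orb_inj by (intro injI) blast
  then have "infinite (range (\<lambda>i. orb i (- \<lfloor>(F ^^ i) 0\<rfloor>)))" by (simp add: finite_image_iff)
  moreover have sub: "range (\<lambda>i. orb i (- \<lfloor>(F ^^ i) 0\<rfloor>)) \<subseteq> {0..1} \<inter> orbit"
  proof
    fix z assume "z \<in> range (\<lambda>i. orb i (- \<lfloor>(F ^^ i) 0\<rfloor>))"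
    then obtain i where i: "z = orb i (- \<lfloor>(F ^^ i) 0\<rfloor>)" by blast
    have "0 \<le> z" "z \<le> 1" unfolding i orb_def by simp_all linarith
    then show "z \<in> {0..1} \<inter> orbit" using i by (auto simp: orbit_def)
  qed
  ultimately have "infinite ({0..1} \<inter> orbit)" using finite_subset by blast
  then obtain z where "z islimpt ({0..1} \<inter> orbit)" using Heine_Borel_imp_Bolzano_Weierstrass[of "{0..1::real}" "{0..1} \<inter> orbit"] by auto
  then have "z islimpt orbit" by (rule islimpt_subset) auto
  then show ?thesis by (auto simp: Lim_def)
qed

lemma F_mono_Lim: assumes "z \<in> Lim" "w \<in> Lim" "z \<le> w" shows "F z \<le> F w"
proof (rule ccontr)
  assume "\<not> ?thesis"
  then have gt: "F w < F z" by simp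
  then have "z < w" using assms(3) by (cases "z = w") auto
  define e where "e = (F z - F w) / 2"
  have e: "e > 0" using gt by (simp add: e_def)
  obtain d1 where d1: "d1 > 0" "\<And>u. \<bar>u - z\<bar> < d1 \<Longrightarrow> \<bar>F u - F z\<bar> < e" using Fk_near[OF e, of z 1] by auto
  obtain d2 where d2: "d2 > 0" "\<And>u. \<bar>u - w\<bar> < d2 \<Longrightarrow> \<bar>F u - F w\<bar> < e" using Fk_near[OF e, of w 1] by auto
  define d where "d = (w - z) / 2"
  have d: "d > 0" using \<open>z < w\<close> by (simp add: d_def)
  obtain q where q: "q \<in> orbit" "dist q z < min d1 d" using Lim_near[OF assms(1), of "min d1 d"] d1(1) d by auto
  obtain r where r: "r \<in> orbit" "dist r w < min d2 d" using Lim_near[OF assms(2), of "min d2 d"] d2(1) d by auto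
  have "q < r" using q(2) r(2) unfolding d_def dist_real_def by (auto simp: abs_if split: if_splits)
  then have "F q < F r" using F_mono_orbit q r by blast
  moreover have "\<bar>F q - F z\<bar> < e" "\<bar>F r - F w\<bar> < e" using d1(2) d2(2) q(2) r(2) by (auto simp: dist_real_def)
  ultimately show False unfolding e_def abs_less_iff by (simp add: field_simps)
qed

lemma Fk_mono_Lim: assumes "z \<in> Lim" "w \<in> Lim" "z \<le> w" shows "(F ^^ k) z \<le> (F ^^ k) w"
proof -
  have "(F ^^ k) z \<in> Lim \<and> (F ^^ k) w \<in> Lim \<and> (F ^^ k) z \<le> (F ^^ k) w"
    by (induction k) (use assms Lim_F F_mono_Lim in auto)
  then show ?thesis by blast
qed

lemma finite_if_no_two_less:
  fixes A :: "real set"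
  assumes "\<And>q q'. q \<in> A \<Longrightarrow> q' \<in> A \<Longrightarrow> q < q' \<Longrightarrow> False"
  shows "finite A"
proof (cases "A = {}")
  case False
  then obtain a where "a \<in> A" by blast
  then have "A \<subseteq> {a}" using assms by (metis insertI1 linorder_neqE subsetI)
  then show ?thesis using finite_subset by blast
qed simp

text \<open>Infinitely many orbit points have images close to \<open>z\<close>. If
  \<open>F s < F t\<close>, the absence of folds leaves at most one of them to the left of
  \<open>s\<close> and one to the right of \<open>t\<close>, so the others accumulate in the
  interval, necessarily at an end, whose image is away from \<open>z\<close>. If
  \<open>F t < F s\<close>, the same count leaves no room at all.\<close>

lemma no_Lim_between:
  assumes st: "s < t" and no: "Lim \<inter> {s<..<t} = {}" and z: "min (F s) (F t) < z" "z < max (F s) (F t)"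
  shows "z \<notin> Lim"
proof
  assume zL: "z \<in> Lim"
  define e where "e = min (z - min (F s) (F t)) (max (F s) (F t) - z) / 2"
  have e: "e > 0" using z by (simp add: e_def)
  define Q where "Q = {q \<in> orbit. F q \<in> ball z e}"
  have Qrange: "min (F s) (F t) + e \<le> F q \<and> F q \<le> max (F s) (F t) - e" if "q \<in> Q" for q
  proof -
    have "2 * e \<le> z - min (F s) (F t)" "2 * e \<le> max (F s) (F t) - z" by (simp_all add: e_def)
    moreover have "z - e < F q" "F q < z + e" using that by (auto simp: Q_def dist_real_def abs_less_iff)
    ultimately show ?thesis by linarith
  qed
  have infQ: "infinite Q"
  proof
    assume "finite Q"
    \<comment> \<open>Only the points \<open>orb 0 k\<close> are not provided with a preimage in the
      orbit, and finitely many of them are near \<open>z\<close>.\<close>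
    have "orbit \<inter> ball z e \<subseteq> F ` Q \<union> (\<lambda>k. orb 0 k) ` {\<lfloor>z - e\<rfloor>..\<lceil>z + e\<rceil>}"
    proof
      fix r assume r: "r \<in> orbit \<inter> ball z e"
      then obtain i k where ik: "r = orb i k" by (auto simp: orbit_def)
      show "r \<in> F ` Q \<union> (\<lambda>k. orb 0 k) ` {\<lfloor>z - e\<rfloor>..\<lceil>z + e\<rceil>}"
      proof (cases i)
        case 0
        then have "r = of_int k" using ik by (simp add: orb_def)
        moreover have "z - e < r" "r < z + e" using r by (auto simp: dist_real_def abs_if split: if_splits)
        ultimately have "k \<in> {\<lfloor>z - e\<rfloor>..\<lceil>z + e\<rceil>}" by (auto simp: floor_le_iff le_ceiling_iff)
        then show ?thesis using ik 0 by blast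
      next
        case (Suc j)
        then have "r = F (orb j k)" using ik F_orb by simp
        moreover have "orb j k \<in> Q" using r calculation by (auto simp: Q_def orbit_def)
        ultimately show ?thesis by blast
      qed
    qed
    moreover have "finite (F ` Q \<union> (\<lambda>k. orb 0 k) ` {\<lfloor>z - e\<rfloor>..\<lceil>z + e\<rceil>})" using \<open>finite Q\<close> by simp
    ultimately have "finite (orbit \<inter> ball z e)" using finite_subset by blast
    moreover have "infinite (orbit \<inter> ball z e)" using zL e unfolding Lim_def by (simp add: islimpt_eq_infinite_ball)
    ultimately show False by blast
  qed
  have QO: "Q \<subseteq> orbit" by (auto simp: Q_def)
  show False
  proof (cases "F s < F t")
    case True
    have "finite {q \<in> Q. q < s}"
    proof (rule finite_if_no_two_less)
      fix q q' assume q: "q \<in> {q \<in> Q. q < s}" "q' \<in> {q \<in> Q. q < s}" "q < q'"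
      then have "F q < F s" using no_fold_right[of q' q s] QO by auto
      then show False using Qrange[of q] q e True by auto
    qed
    moreover have "finite {q \<in> Q. q > t}"
    proof (rule finite_if_no_two_less)
      fix q q' assume q: "q \<in> {q \<in> Q. q > t}" "q' \<in> {q \<in> Q. q > t}" "q < q'"
      then have "F t < F q'" using no_fold_left[of q q' t] QO by auto
      then show False using Qrange[of q'] q e True by auto
    qed
    moreover have "Q \<subseteq> {q \<in> Q. q < s} \<union> {q \<in> Q. q > t} \<union> (Q \<inter> {s..t})" by auto
    ultimately have "infinite (Q \<inter> {s..t})" using infQ by (meson finite_Un finite_subset)
    then obtain w where w: "w \<in> {s..t}" "w islimpt (Q \<inter> {s..t})"
      using Heine_Borel_imp_Bolzano_Weierstrass[of "{s..t}" "Q \<inter> {s..t}"] by auto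
    then have "w islimpt orbit" using QO islimpt_subset by blast
    then have "w \<in> Lim" by (simp add: Lim_def)
    then have ws: "w = s \<or> w = t" using no w(1) by fastforce
    obtain \<delta> where \<delta>: "\<delta> > 0" "\<And>u. \<bar>u - w\<bar> < \<delta> \<Longrightarrow> \<bar>F u - F w\<bar> < e" using Fk_near[OF e, of w 1] by auto
    obtain q where q: "q \<in> Q" "dist q w < \<delta>" using w(2) \<delta>(1) unfolding islimpt_approachable by blast
    have "\<bar>F q - F w\<bar> < e" using \<delta>(2) q(2) by (simp add: dist_real_def)
    then show False using Qrange[OF q(1)] ws True by auto
  next
    case False
    then have gt: "F t < F s" using z by auto
    have "finite {q \<in> Q. q < t}"
    proof (rule finite_if_no_two_less)
      fix q q' assume q: "q \<in> {q \<in> Q. q < t}" "q' \<in> {q \<in> Q. q < t}" "q < q'"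
      then have "F q < F t" using no_fold_right[of q' q t] QO by auto
      then show False using Qrange[of q] q e gt by auto
    qed
    moreover have "finite {q \<in> Q. q > s}"
    proof (rule finite_if_no_two_less)
      fix q q' assume q: "q \<in> {q \<in> Q. q > s}" "q' \<in> {q \<in> Q. q > s}" "q < q'"
      then have "F s < F q'" using no_fold_left[of q q' s] QO by auto
      then show False using Qrange[of q'] q e gt by auto
    qed
    moreover have "Q \<subseteq> {q \<in> Q. q < t} \<union> {q \<in> Q. q > s}" using st by auto
    ultimately show False using infQ by (meson finite_Un finite_subset)
  qed
qed

sublocale rotation: gap_system f F D X Lim
proof
  show "closed Lim" by (rule Lim_closed)
  show "Lim \<noteq> {}" by (rule Lim_ne)
  show "\<And>t m. t + real_of_int m \<in> Lim \<longleftrightarrow> t \<in> Lim" by (rule Lim_shift)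
  show "\<And>t. t \<in> Lim \<Longrightarrow> F t \<in> Lim" by (rule Lim_F)
  show "\<And>s t z. s < t \<Longrightarrow> Lim \<inter> {s<..<t} = {} \<Longrightarrow> min (F s) (F t) < z \<Longrightarrow> z < max (F s) (F t) \<Longrightarrow> z \<notin> Lim"
    by (rule no_Lim_between)
  fix a b :: real and n :: nat and m :: int
  assume ab: "a < b" "a \<in> Lim" "b \<in> Lim" "Lim \<inter> {a<..<b} = {}" "1 \<le> n"
    and maps: "(\<lambda>x. (F ^^ n) x - real_of_int m) ` {a..b} \<subseteq> {a..b}"
  define H where "H x = (F ^^ n) x - of_int m" for x
  have "(F ^^ n) x \<in> Lim" if "x \<in> Lim" for x using that by (induction n) (auto simp: Lim_F)
  then have HL: "H x \<in> Lim" if "x \<in> Lim" for x using that Lim_shift[of "(F ^^ n) x" "- m"] by (simp add: H_def)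
  have "H a \<in> H ` {a..b}" "H b \<in> H ` {a..b}" using ab(1) by auto
  then have "H a \<in> {a..b}" "H b \<in> {a..b}" using maps unfolding H_def by blast+
  then have e: "H a = a \<or> H a = b" "H b = a \<or> H b = b" using HL[OF ab(2)] HL[OF ab(3)] ab(4) by fastforce+
  \<comment> \<open>A returning gap would have its ends fixed or swapped, which makes
    \<open>a\<close> periodic. So no gap of \<open>Lim\<close> returns and the required monotonicity
    is vacuous.\<close>
  have no: "(F ^^ n) x \<noteq> x + of_int m" "(F ^^ n) ((F ^^ n) x) \<noteq> x + of_int (m + m)" for x
    using aperiodic[of n x m] aperiodic[of "n + n" x "m + m"] ab(5) by (auto simp: funpow_add)
  have "H (H a) = a" using e no(1)[of a] no(1)[of b] by (auto simp: H_def)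
  then have "(F ^^ n) ((F ^^ n) a) = a + of_int (m + m)" using Fn_shift_diff[of n "(F ^^ n) a" m] by (simp add: H_def)
  then show "(\<forall>z\<in>X \<inter> {a..b}. z \<le> (F ^^ n) ((F ^^ n) z - real_of_int m) - real_of_int m) \<or>
       (\<forall>z\<in>X \<inter> {a..b}. (F ^^ n) ((F ^^ n) z - real_of_int m) - real_of_int m \<le> z)"
    using no(2) by blast
qed

text \<open>Every iterate is monotone on \<open>Lim\<close>, hence so is the sum of the cell numbers
  along an orbit segment, and two points with equal sums have equal cells at each time. Over one
  period the sum grows by at most n N, so the count is linear in n.\<close>

lemma sepnum_Lim_le:
  assumes e: "e > 0"
  shows "\<exists>M. \<forall>n. sepnum f chordal (circ ` Lim) n e \<le> (n + 1) ^ M"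
proof -
  define \<epsilon> where "\<epsilon> = e / 8"
  have \<epsilon>: "\<epsilon> > 0" using e by (simp add: \<epsilon>_def)
  obtain z0 where z0: "z0 \<in> Lim" using Lim_ne by blast
  then have z1: "z0 + 1 \<in> Lim" using Lim_shift[of z0 1] by simp
  define N where "N = nat \<lceil>1 / \<epsilon>\<rceil>"
  have "sepnum f chordal (circ ` Lim) n e \<le> (n + 1) ^ N" for n
  proof -
    define S where "S t = (\<Sum>k<n. \<lfloor>(F ^^ k) t / \<epsilon>\<rfloor>)" for t
    have Sk: "\<lfloor>(F ^^ k) s / \<epsilon>\<rfloor> \<le> \<lfloor>(F ^^ k) t / \<epsilon>\<rfloor>" if "s \<in> Lim" "t \<in> Lim" "s \<le> t" for s t k
      using Fk_mono_Lim[OF that, of k] \<epsilon> by (intro floor_mono divide_right_mono) auto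
    have S_mono: "S s \<le> S t" if "s \<in> Lim" "t \<in> Lim" "s \<le> t" for s t
      unfolding S_def by (intro sum_mono Sk that)
    have S_eq: "\<lfloor>(F ^^ k) s / \<epsilon>\<rfloor> = \<lfloor>(F ^^ k) t / \<epsilon>\<rfloor>" if "s \<in> Lim" "t \<in> Lim" "s \<le> t" "S s = S t" "k < n" for s t k
      using sum_mono_inv[of "\<lambda>k. \<lfloor>(F ^^ k) s / \<epsilon>\<rfloor>" "{..<n}" "\<lambda>k. \<lfloor>(F ^^ k) t / \<epsilon>\<rfloor>" k] that Sk[OF that(1-3)]
      by (simp add: S_def)
    have "S (z0 + 1) \<le> (\<Sum>k<n. \<lfloor>(F ^^ k) z0 / \<epsilon>\<rfloor> + int N)"
      unfolding S_def
    proof (rule sum_mono)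
      fix k
      have "(F ^^ k) (z0 + 1) = (F ^^ k) z0 + 1" using Fn_shift[of k z0 1] by simp
      then have "(F ^^ k) (z0 + 1) / \<epsilon> = (F ^^ k) z0 / \<epsilon> + 1 / \<epsilon>" by (simp add: add_divide_distrib)
      also have "\<dots> \<le> (F ^^ k) z0 / \<epsilon> + of_int (int N)" using real_nat_ceiling_ge[of "1 / \<epsilon>"] unfolding N_def by (intro add_left_mono) (simp only: of_int_of_nat_eq)
      finally have "\<lfloor>(F ^^ k) (z0 + 1) / \<epsilon>\<rfloor> \<le> \<lfloor>(F ^^ k) z0 / \<epsilon> + of_int (int N)\<rfloor>" by (rule floor_mono)
      then show "\<lfloor>(F ^^ k) (z0 + 1) / \<epsilon>\<rfloor> \<le> \<lfloor>(F ^^ k) z0 / \<epsilon>\<rfloor> + int N" by (simp only: floor_add_int)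
    qed
    then have S1: "S (z0 + 1) \<le> S z0 + int (n * N)" by (simp add: S_def sum.distrib)
    define l where "l z = lift_pt z - of_int \<lfloor>lift_pt z - z0\<rfloor>" for z
    have l: "circ (l z) = z" "l z \<in> Lim" "z0 \<le> l z" "l z \<le> z0 + 1" if z: "z \<in> circ ` Lim" for z
    proof -
      obtain t where t: "t \<in> Lim" "z = circ t" using z by blast
      have "circ (lift_pt z) = z" using lift_pt(3)[of z] t(2) by simp
      then show c: "circ (l z) = z" by (simp add: l_def)
      then obtain m :: int where "l z = t + of_int m" using t(2) by (metis circ_eq_iff)
      then show "l z \<in> Lim" using t(1) Lim_shift by simp
      show "z0 \<le> l z" "l z \<le> z0 + 1" unfolding l_def by linarith+
    qed
    have "card A \<le> card {S z0..S z0 + int (n * N)}"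
      if A: "finite A" "A \<subseteq> circ ` Lim" "separated f chordal n e A" for A
    proof (rule card_separated_le[OF A, of _ "\<lambda>z. S (l z)"])
      show "S (l z) \<in> {S z0..S z0 + int (n * N)}" if "z \<in> circ ` Lim" for z
        using S_mono[OF z0 l(2)[OF that] l(3)[OF that]] S_mono[OF l(2)[OF that] z1 l(4)[OF that]] S1 by simp
      fix z w k assume zw: "z \<in> circ ` Lim" "w \<in> circ ` Lim" "S (l z) = S (l w)" and k: "k < n"
      have "\<lfloor>(F ^^ k) (l z) / \<epsilon>\<rfloor> = \<lfloor>(F ^^ k) (l w) / \<epsilon>\<rfloor>"
      proof (cases "l z \<le> l w")
        case True
        then show ?thesis by (rule S_eq[OF l(2)[OF zw(1)] l(2)[OF zw(2)] _ zw(3) k])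
      next
        case False
        then have "l w \<le> l z" by simp
        then show ?thesis by (rule S_eq[OF l(2)[OF zw(2)] l(2)[OF zw(1)] _ zw(3)[symmetric] k, symmetric])
      qed
      then have "\<bar>(F ^^ k) (l z) - (F ^^ k) (l w)\<bar> < \<epsilon>" by (rule floor_eq_imp_close[OF \<epsilon>])
      then have "chordal (circ ((F ^^ k) (l z))) (circ ((F ^^ k) (l w))) \<le> e"
        using chordal_circ_le[of "(F ^^ k) (l z)" "(F ^^ k) (l w)"] unfolding \<epsilon>_def by simp
      then show "chordal ((f ^^ k) z) ((f ^^ k) w) \<le> e"
        unfolding fk_circ[symmetric] l(1)[OF zw(1)] l(1)[OF zw(2)] .
    qed simp
    then have "sepnum f chordal (circ ` Lim) n e \<le> card {S z0..S z0 + int (n * N)}" by (rule sepnum_le)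
    also have "\<dots> = 1 + N * n" by (simp add: nat_add_distrib nat_mult_distrib mult.commute)
    also have "\<dots> \<le> (n + 1) ^ N"
    proof (induction N)
      case (Suc N)
      have "1 + Suc N * n \<le> (n + 1) * (1 + N * n)" by (simp add: algebra_simps)
      also have "\<dots> \<le> (n + 1) * (n + 1) ^ N" using Suc by (rule mult_le_mono2)
      finally show ?case by simp
    qed simp
    finally show ?thesis .
  qed
  then show ?thesis by blast
qed

lemma top_entropy_X_eq_0:
  assumes "X \<noteq> {}"
  shows "top_entropy f chordal (circ ` X) = 0"
proof (rule top_entropy_eq_0)
  show "sep_bounded f chordal (circ ` X) n e" if "e > 0" for n e
    using that by (intro sep_bounded_circle) auto
  fix e :: real assume "e > 0"
  then obtain M e' where M: "e' > 0" "\<And>n. sepnum f chordal (circ ` X) n e \<le> (n + 1) ^ M * sepnum f chordal (circ ` Lim) n e'"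
    using rotation.sepnum_le_sepnum_K by metis
  obtain M' where M': "\<And>n. sepnum f chordal (circ ` Lim) n e' \<le> (n + 1) ^ M'" using sepnum_Lim_le[OF M(1)] by blast
  have "sepnum f chordal (circ ` X) n e \<le> (n + 1) ^ (M + M')" for n
    unfolding power_add by (rule order_trans[OF M(2) mult_le_mono2[OF M']])
  then show "\<exists>M. \<forall>n. sepnum f chordal (circ ` X) n e \<le> (n + 1) ^ M" by blast
qed (use assms in simp)

end

section \<open>The closure of the preperiodic points\<close>

lemma preperiodic_step: "preperiodic g (g x) \<longleftrightarrow> preperiodic g x"
proof
  assume "preperiodic g (g x)"
  then obtain m n where "n > 0" "(g ^^ (m + n)) (g x) = (g ^^ m) (g x)" by (auto simp: preperiodic_def)
  then have "n > 0" "(g ^^ (Suc m + n)) x = (g ^^ Suc m) x" by (simp_all add: funpow_swap1)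
  then show "preperiodic g x" unfolding preperiodic_def by blast
next
  assume "preperiodic g x"
  then obtain m n where mn: "n > 0" "(g ^^ (m + n)) x = (g ^^ m) x" by (auto simp: preperiodic_def)
  then have "(g ^^ (m + n)) (g x) = (g ^^ m) (g x)" by (simp flip: funpow_swap1)
  then show "preperiodic g (g x)" using mn(1) unfolding preperiodic_def by blast
qed

text \<open>\<open>g ^^ n\<close> maps a set of at most two points into itself; this is the
  situation at the ends of an interval mapped into itself.\<close>

lemma preperiodic_pair:
  assumes n: "n \<ge> 1" and x: "(g ^^ n) x = x \<or> (g ^^ n) x = y" and y: "(g ^^ n) y = x \<or> (g ^^ n) y = y"
  shows "preperiodic g x"
proof -
  have nn: "(g ^^ (n + n)) x = (g ^^ n) ((g ^^ n) x)" by (simp add: funpow_add)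
  consider "(g ^^ n) x = x" | "(g ^^ n) x = y" "(g ^^ n) y = y" | "(g ^^ n) x = y" "(g ^^ n) y = x" using x y by blast
  then have "(g ^^ (0 + n)) x = (g ^^ 0) x \<or> (g ^^ (n + n)) x = (g ^^ n) x \<or> (g ^^ (0 + (n + n))) x = (g ^^ 0) x"
    by cases (auto simp: nn)
  then show ?thesis using n unfolding preperiodic_def by (metis add_pos_pos less_eq_Suc_le One_nat_def)
qed

section \<open>Fatou intervals and gaps of the preperiodic points\<close>

context circle_lift begin

definition Prep :: "real set" where "Prep = {t \<in> X. preperiodic f (circ t)}"

lemma Prep_F: "F t \<in> Prep \<longleftrightarrow> t \<in> Prep"
  using preperiodic_step[of f "circ t"] by (simp add: Prep_def F_X f_circ)

lemma Prep_shift: "t + of_int m \<in> Prep \<longleftrightarrow> t \<in> Prep"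
  by (simp add: Prep_def X_shift)

lemma periodic_in_Prep: "t \<in> X \<Longrightarrow> n \<ge> 1 \<Longrightarrow> (F ^^ n) t = t + of_int m \<Longrightarrow> t \<in> Prep"
proof -
  assume t: "t \<in> X" "n \<ge> 1" "(F ^^ n) t = t + of_int m"
  then have "n > 0" "(f ^^ (0 + n)) (circ t) = (f ^^ 0) (circ t)" using fk_circ[of n t] by auto
  then show "t \<in> Prep" using t(1) unfolding Prep_def preperiodic_def by blast
qed

lemma X_gap:
  assumes "c \<notin> X" "lo \<in> X" "lo \<le> c" "hi \<in> X" "c \<le> hi"
  obtains u v where "lo \<le> u" "u < c" "c < v" "v \<le> hi" "u \<in> X" "v \<in> X" "X \<inter> {u<..<v} = {}"
proof -
  define u where "u = Sup (X \<inter> {lo..c})"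
  define v where "v = Inf (X \<inter> {c..hi})"
  have bd: "bdd_above (X \<inter> {lo..c})" "bdd_below (X \<inter> {c..hi})" by auto
  have u: "u \<in> X \<inter> {lo..c}" unfolding u_def using assms closedX bd by (intro closed_contains_Sup) auto
  have v: "v \<in> X \<inter> {c..hi}" unfolding v_def using assms closedX bd by (intro closed_contains_Inf) auto
  have "z \<notin> X" if "u < z" "z < v" for z
  proof
    assume z: "z \<in> X"
    have "\<not> z \<le> c" using z that u cSup_upper[of z "X \<inter> {lo..c}"] bd unfolding u_def by force
    moreover have "\<not> c \<le> z" using z that v cInf_lower[of z "X \<inter> {c..hi}"] bd unfolding v_def by force
    ultimately show False by simp
  qed
  then have "X \<inter> {u<..<v} = {}" by auto
  moreover have "u < c" "c < v" using u v assms(1) by (auto simp: order.order_iff_strict)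
  ultimately show thesis using that u v by auto
qed

lemma connected_image_Icc:
  "{min (F s) (F t)..max (F s) (F t)} \<subseteq> F ` {min s t..max s t}"
  using connected_contains_Icc[OF connected_continuous_image[OF contF' connected_Icc, of "min s t" "max s t"]]
  by (auto simp: min_def max_def)

text \<open>The image of the interval under the translated iterate is connected, avoids
  \<open>X\<close> by complete invariance and contains \<open>c\<close>, so it stays in the
  interval. By continuity the closed interval is mapped into itself, and its ends, the only points
  of \<open>X\<close> there, go to ends.\<close>

lemma fatou_interval_ends_preperiodic:
  assumes n: "n \<ge> 1" and fix': "(F ^^ n) c = c + of_int m" and cX: "c \<notin> X"
    and uv: "u < c" "c < v" "u \<in> X" "v \<in> X" "X \<inter> {u<..<v} = {}"
  shows "u \<in> Prep" "v \<in> Prep"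
proof -
  define H where "H = (\<lambda>x. (F ^^ n) x - of_int m)"
  have Hc: "H c = c" using fix' by (simp add: H_def)
  have HX: "H x \<in> X \<longleftrightarrow> x \<in> X" for x by (simp add: H_def X_shift_diff Fk_X)
  have cont: "continuous_on S H" for S unfolding H_def by (intro continuous_intros contFk)
  have "H ` {u<..<v} \<subseteq> {u..v}"
  proof
    fix y assume "y \<in> H ` {u<..<v}"
    then obtain w where w: "u < w" "w < v" "y = H w" by auto
    define I where "I = {min w c..max w c}"
    have I: "I \<subseteq> {u<..<v}" using w uv by (auto simp: I_def)
    have "H ` I \<inter> X = {}" using I uv(5) HX by auto
    have "connected (H ` I)" unfolding I_def by (intro connected_continuous_image cont) auto
    moreover have "w \<in> I" "c \<in> I" by (auto simp: I_def)
    then have "y \<in> H ` I" "c \<in> H ` I" using w(3) Hc by (metis imageI)+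
    ultimately have "{min y c..max y c} \<subseteq> H ` I"
      by (intro connected_contains_Icc) (auto simp: min_def max_def)
    then have "u \<notin> {min y c..max y c}" "v \<notin> {min y c..max y c}" using uv \<open>H ` I \<inter> X = {}\<close> by blast+
    then show "y \<in> {u..v}" using uv by (auto simp: min_def max_def split: if_splits)
  qed
  then have "H ` closure {u<..<v} \<subseteq> {u..v}" by (intro image_closure_subset cont) auto
  then have "H ` {u..v} \<subseteq> {u..v}" using uv by simp
  moreover have "u \<in> {u..v}" "v \<in> {u..v}" using uv by auto
  ultimately have "H u \<in> {u..v}" "H v \<in> {u..v}" by blast+
  moreover have "H u \<in> X" "H v \<in> X" using HX uv by auto
  ultimately have "H u = u \<or> H u = v" "H v = u \<or> H v = v" using uv(5) by fastforce+
  moreover have "(f ^^ n) (circ x) = circ (H x)" for x by (simp add: H_def fk_circ)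
  ultimately have "(f ^^ n) (circ u) = circ u \<or> (f ^^ n) (circ u) = circ v" "(f ^^ n) (circ v) = circ u \<or> (f ^^ n) (circ v) = circ v"
    by auto
  then have "preperiodic f (circ u)" "preperiodic f (circ v)" using preperiodic_pair[OF n] by metis+
  then show "u \<in> Prep" "v \<in> Prep" using uv by (auto simp: Prep_def)
qed

text \<open>A periodic point outside \<open>X\<close> would lie between two points of
  \<open>X\<close> with preperiodic ends of the complementary interval. So periodic points are
  excluded on the whole line.\<close>

lemma aperiodic_if_no_Prep:
  assumes "Prep = {}" "X \<noteq> {}"
  shows "circle_lift_aperiodic f F D X"
proof unfold_locales
  fix n t m assume n: "(n::nat) \<ge> 1"
  show "(F ^^ n) t \<noteq> t + of_int m"
  proof
    assume e: "(F ^^ n) t = t + of_int m"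
    have "t \<notin> X" using periodic_in_Prep[OF _ n e] assms(1) by blast
    obtain x where x: "x \<in> X" using assms(2) by blast
    have "x - of_int \<lceil>x - t\<rceil> \<in> X" "x + of_int \<lceil>t - x\<rceil> \<in> X" using x X_shift X_shift_diff by auto
    moreover have "x - of_int \<lceil>x - t\<rceil> \<le> t" "t \<le> x + of_int \<lceil>t - x\<rceil>" by linarith+
    ultimately obtain u v where uv: "u < t" "t < v" "u \<in> X" "v \<in> X" "X \<inter> {u<..<v} = {}"
      using X_gap[OF \<open>t \<notin> X\<close>] by metis
    then show False using fatou_interval_ends_preperiodic(1)[OF n e \<open>t \<notin> X\<close>] assms(1) by blast
  qed
qed

lemma closure_Prep_X: "closure Prep \<subseteq> X"
  using closedX by (intro closure_minimal) (auto simp: Prep_def)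

lemma F_closure_Prep: "t \<in> closure Prep \<Longrightarrow> F t \<in> closure Prep"
proof -
  have "F ` closure Prep \<subseteq> closure Prep"
    by (rule image_closure_subset[OF contF']) (use Prep_F closure_subset in auto)
  then show "t \<in> closure Prep \<Longrightarrow> F t \<in> closure Prep" by blast
qed

lemma closure_Prep_shift: "t + of_int m \<in> closure Prep \<longleftrightarrow> t \<in> closure Prep"
proof -
  have *: "t + of_int m \<in> closure Prep" if "t \<in> closure Prep" for t m
  proof -
    have "(\<lambda>t. t + of_int m) ` closure Prep \<subseteq> closure Prep"
      by (rule image_closure_subset) (use Prep_shift closure_subset in \<open>auto intro!: continuous_intros\<close>)
    then show ?thesis using that by blast
  qed
  show ?thesis using *[of t m] *[of "t + of_int m" "- m"] by auto
qed

lemma closure_Prep_gap_system: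
  assumes "Prep \<noteq> {}"
  shows "gap_system f F D X (closure Prep)"
proof unfold_locales
  show "closed (closure Prep)" "closure Prep \<noteq> {}" using assms by auto
  show "t + of_int m \<in> closure Prep \<longleftrightarrow> t \<in> closure Prep" for t m by (rule closure_Prep_shift)
  show "F t \<in> closure Prep" if "t \<in> closure Prep" for t using F_closure_Prep that .
next
  fix s t z assume st: "s < t" and no: "closure Prep \<inter> {s<..<t} = {}" and z: "min (F s) (F t) < z" "z < max (F s) (F t)"
  show "z \<notin> closure Prep"
  proof
    assume "z \<in> closure Prep"
    then have "{min (F s) (F t)<..<max (F s) (F t)} \<inter> closure Prep \<noteq> {}" using z by auto
    \<comment> \<open>A point of \<open>Prep\<close> itself is needed here, since
      \<open>Prep_F\<close> makes its preimage preperiodic; the backward step is available for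
      \<open>Prep\<close>, not for its closure.\<close>
    then obtain z' where z': "z' \<in> Prep" "min (F s) (F t) < z'" "z' < max (F s) (F t)"
      using open_Int_closure_eq_empty[of "{min (F s) (F t)<..<max (F s) (F t)}" Prep] by auto
    then have "z' \<in> F ` {min s t..max s t}" using connected_image_Icc[of s t] by auto
    then obtain w where w: "w \<in> {s..t}" "z' = F w" using st by (auto simp: min_def max_def)
    then have "w \<noteq> s" "w \<noteq> t" using z' by (auto simp: min_def max_def split: if_splits)
    then have "w \<in> {s<..<t}" using w by auto
    moreover have "w \<in> closure Prep" using Prep_F[of w] z'(1) w(2) closure_subset by blast
    ultimately show False using no by blast
  qed
next
  fix a b n m
  assume ab: "a < b" "a \<in> closure Prep" "b \<in> closure Prep" "closure Prep \<inter> {a<..<b} = {}" and n: "(1::nat) \<le> n"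
    and maps': "(\<lambda>x. (F ^^ n) x - real_of_int m) ` {a..b} \<subseteq> {a..b}"
  define H where "H = (\<lambda>x. (F ^^ n) x - of_int m)"
  have maps: "H ` {a..b} \<subseteq> {a..b}" using maps' unfolding H_def .
  have cont: "continuous_on S H" for S unfolding H_def by (intro continuous_intros contFk)
  have abX: "a \<in> X" "b \<in> X" using ab closure_Prep_X by auto
  have "(F ^^ n) x \<in> closure Prep" if "x \<in> closure Prep" for x using that by (induction n) (auto simp: F_closure_Prep)
  then have HK: "H x \<in> closure Prep" if "x \<in> closure Prep" for x
    using that closure_Prep_shift[of "(F ^^ n) x" "- m"] by (simp add: H_def)
  have "a \<in> {a..b}" "b \<in> {a..b}" using ab(1) by auto
  then have Hab: "H a \<in> {a..b}" "H b \<in> {a..b}" using maps by blast+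
  then have e: "H a = a \<or> H a = b" "H b = a \<or> H b = b" using HK[OF ab(2)] HK[OF ab(3)] ab(4) by fastforce+
  have "(\<forall>z\<in>X \<inter> {a..b}. z \<le> H (H z)) \<or> (\<forall>z\<in>X \<inter> {a..b}. H (H z) \<le> z)"
  \<comment> \<open>If \<open>X\<close> meets the gap only in its ends, \<open>H\<close> may swap
    them, hence the second return. Otherwise \<open>H\<close> has no fixed point inside and moves
    all points in one direction.\<close>
  proof (cases "X \<inter> {a<..<b} = {}")
    case True
    have zab: "z = a \<or> z = b" if "z \<in> X \<inter> {a..b}" for z
    proof -
      have "z \<notin> {a<..<b}" using that True by blast
      then show ?thesis using that by auto
    qed
    show ?thesis
    proof (cases "H (H b) = b")
      case True
      then have "z \<le> H (H z)" if "z \<in> X \<inter> {a..b}" for z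
        using zab[OF that] e ab(1) by auto
      then show ?thesis by blast
    next
      case False
      then have "H b = a" "H a = a" using e by auto
      then have "H (H z) \<le> z" if "z \<in> X \<inter> {a..b}" for z
        using zab[OF that] ab(1) by auto
      then show ?thesis by blast
    qed
  next
    case False
    have ne: "H c \<noteq> c" if c: "c \<in> {a<..<b}" for c
    proof
      assume "H c = c"
      then have fc: "(F ^^ n) c = c + of_int m" by (simp add: H_def)
      have "c \<notin> X" using periodic_in_Prep[OF _ n fc] ab(4) c closure_subset by blast
      then obtain u v where uv: "a \<le> u" "u < c" "c < v" "v \<le> b" "u \<in> X" "v \<in> X" "X \<inter> {u<..<v} = {}"
        using X_gap[of c a b] abX c by auto
      have "u \<in> Prep" "v \<in> Prep" using fatou_interval_ends_preperiodic[OF n fc \<open>c \<notin> X\<close> uv(2,3,5,6,7)] by auto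
      then have "u \<notin> {a<..<b}" "v \<notin> {a<..<b}" using ab(4) closure_subset by blast+
      then have "u = a" "v = b" using uv c by auto
      then show False using uv(7) False by blast
    qed
    have sign: "(\<forall>z\<in>{a<..<b}. z \<le> H z) \<or> (\<forall>z\<in>{a<..<b}. H z \<le> z)"
    proof (rule ccontr)
      assume "\<not> ?thesis"
      then obtain z w where zw: "z \<in> {a<..<b}" "w \<in> {a<..<b}" "H z < z" "w < H w" by (auto simp: not_le)
      define \<phi> where "\<phi> x = H x - x" for x
      have "connected (\<phi> ` {a<..<b})" unfolding \<phi>_def by (intro connected_continuous_image continuous_intros cont) auto
      then have "{\<phi> z..\<phi> w} \<subseteq> \<phi> ` {a<..<b}" using zw by (intro connected_contains_Icc) auto
      then have "0 \<in> \<phi> ` {a<..<b}" using zw by (auto simp: \<phi>_def subset_iff)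
      then show False using ne by (auto simp: \<phi>_def)
    qed
    have cl: "closure {a<..<b} = {a..b}" using ab(1) by simp
    from sign show ?thesis
    proof
      assume s: "\<forall>z\<in>{a<..<b}. z \<le> H z"
      have "0 \<le> H z - z" if "z \<in> {a..b}" for z
        by (rule continuous_ge_on_closure[of "{a<..<b}" "\<lambda>z. H z - z"]) (use s that cl in \<open>auto intro!: continuous_intros cont\<close>)
      then have le: "z \<le> H z" if "z \<in> {a..b}" for z using that by force
      have "z \<le> H (H z)" if "z \<in> {a..b}" for z
        using le[OF that] le[of "H z"] maps that by (meson image_subset_iff order_trans)
      then show ?thesis by blast
    next
      assume s: "\<forall>z\<in>{a<..<b}. H z \<le> z"
      have "H z - z \<le> 0" if "z \<in> {a..b}" for z
        by (rule continuous_le_on_closure[of "{a<..<b}" "\<lambda>z. H z - z"]) (use s that cl in \<open>auto intro!: continuous_intros cont\<close>)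
      then have le: "H z \<le> z" if "z \<in> {a..b}" for z using that by force
      have "H (H z) \<le> z" if "z \<in> {a..b}" for z
        using le[OF that] le[of "H z"] maps that by (meson image_subset_iff order_trans)
      then show ?thesis by blast
    qed
  qed
  then show "(\<forall>z\<in>X \<inter> {a..b}. z \<le> (F ^^ n) ((F ^^ n) z - real_of_int m) - real_of_int m) \<or>
       (\<forall>z\<in>X \<inter> {a..b}. (F ^^ n) ((F ^^ n) z - real_of_int m) - real_of_int m \<le> z)"
    unfolding H_def .
qed

theorem preperiodic_subsystem:
  "\<exists>K. K \<subseteq> circ ` X \<and> f ` K \<subseteq> K \<and> sclosed K \<and>
      top_entropy f chordal K = top_entropy f chordal (circ ` X) \<and>
      sdense_in {x\<in>K. preperiodic f x} K"
proof (intro exI conjI)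
  let ?K = "circ ` closure Prep"
  show sub: "?K \<subseteq> circ ` X" using closure_Prep_X by blast
  show "f ` ?K \<subseteq> ?K" using F_closure_Prep by (auto simp: f_circ)
  \<comment> \<open>The closure of \<open>Prep\<close> is unbounded on the line; compactness of its
    image comes from restricting to one period.\<close>
  have "stereo ` ?K = (\<lambda>t. stereo (circ t)) ` (closure Prep \<inter> {0..1})"
  proof
    show "stereo ` ?K \<subseteq> (\<lambda>t. stereo (circ t)) ` (closure Prep \<inter> {0..1})"
    proof
      fix y assume "y \<in> stereo ` ?K"
      then obtain t where t: "t \<in> closure Prep" "y = stereo (circ t)" by auto
      have "frac t \<in> closure Prep" using closure_Prep_shift[of t "- \<lfloor>t\<rfloor>"] t(1) by (simp add: frac_def)
      moreover have "frac t \<in> {0..1}" by (simp add: less_imp_le[OF frac_lt_1])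
      moreover have "y = stereo (circ (frac t))" using t(2) by (simp add: frac_def)
      ultimately show "y \<in> (\<lambda>t. stereo (circ t)) ` (closure Prep \<inter> {0..1})" by blast
    qed
  qed auto
  moreover have "compact ((\<lambda>t. stereo (circ t)) ` (closure Prep \<inter> {0..1}))"
    by (intro compact_continuous_image continuous_stereo_circ closed_Int_compact) auto
  ultimately show "sclosed ?K" unfolding sclosed_def by (simp add: compact_imp_closed)
  have "(\<lambda>t. stereo (circ t)) ` closure Prep \<subseteq> closure (stereo ` {x \<in> ?K. preperiodic f x})"
  proof (rule image_closure_subset[OF continuous_stereo_circ closed_closure])
    have "Prep \<subseteq> closure Prep" by (rule closure_subset)
    then have "(\<lambda>t. stereo (circ t)) ` Prep \<subseteq> stereo ` {x \<in> ?K. preperiodic f x}" by (auto simp: Prep_def)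
    then show "(\<lambda>t. stereo (circ t)) ` Prep \<subseteq> closure (stereo ` {x \<in> ?K. preperiodic f x})"
      using closure_subset by blast
  qed
  then show "sdense_in {x \<in> ?K. preperiodic f x} ?K" unfolding sdense_in_def by (auto simp: image_image)
  show "top_entropy f chordal ?K = top_entropy f chordal (circ ` X)"
  proof (cases "X = {}")
    case True
    then show ?thesis using closure_Prep_X by auto
  next
    case Xne: False
    show ?thesis
    proof (cases "Prep = {}")
      case True
      interpret circle_lift_aperiodic f F D X by (rule aperiodic_if_no_Prep[OF True Xne])
      \<comment> \<open>Here the subsystem is empty, and \<open>top_entropy\<close> assigns the
        value 0 to the empty set.\<close>
      show ?thesis using top_entropy_X_eq_0[OF Xne] True by (simp add: top_entropy_def)
    next
      case False
      interpret gap_system f F D X "closure Prep" by (rule closure_Prep_gap_system[OF False])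
      show ?thesis using top_entropy_le_K[OF Xne] top_entropy_mono[OF sub] False
        by (intro antisym) (auto simp: image_subset_iff)
    qed
  qed
qed

end

section \<open>Application to rational maps\<close>

lemma (in rational_map) circle_lift_julia:
  obtains F :: "real \<Rightarrow> real" and D :: int
  where "circle_lift f F D {t. circ t \<in> julia f}"
proof -
  obtain F :: "real \<Rightarrow> real" and D :: int
    where F: "continuous_on UNIV F" "\<And>t. f (circ t) = circ (F t)" "\<And>t. F (t + 1) = F t + of_int D"
    using circle_lift_exists by metis
  have "circle_lift f F D {t. circ t \<in> julia f}"
  proof
    have "open {t. circ t \<in> fatou f}"
      unfolding open_dist
    proof
      fix t assume "t \<in> {t. circ t \<in> fatou f}"
      then obtain r where r: "r > 0" "{u. chordal u (circ t) < r} \<subseteq> fatou f" using fatou_open[of "circ t"] by auto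
      have "circ s \<in> fatou f" if "dist s t < r / 8" for s
        using chordal_circ_le[of s t] that r(2) by (auto simp: dist_real_def)
      then show "\<exists>e>0. \<forall>y. dist y t < e \<longrightarrow> y \<in> {t. circ t \<in> fatou f}"
        using r(1) by (intro exI[of _ "r / 8"]) auto
    qed
    moreover have "{t. circ t \<in> julia f} = - {t. circ t \<in> fatou f}" by (auto simp: julia_def)
    ultimately show "closed {t. circ t \<in> julia f}" by (simp add: closed_Compl)
    show "t + 1 \<in> {t. circ t \<in> julia f} \<longleftrightarrow> t \<in> {t. circ t \<in> julia f}" for t
      using circ_add_int[of t 1] by simp
    show "F t \<in> {t. circ t \<in> julia f} \<longleftrightarrow> t \<in> {t. circ t \<in> julia f}" for t
      using julia_iff[of "circ t"] by (simp add: F(2))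
    show "\<exists>u\<in>{s..t}. F u \<noteq> F s" if "s < t" for s t
      using lift_nonconst[OF F(2) that] .
  qed (use F in auto)
  then show thesis by (rule that)
qed

theorem theoremA1:
  fixes p q :: "real poly" and d :: nat
  assumes "coprime p q" and "q \<noteq> 0"
    and "d = max (degree p) (degree q)" and "d \<ge> 2"
  defines "f \<equiv> rat_map p q"
    and "JR \<equiv> julia (rat_map p q) \<inter> rhat"
  shows "(nonwandering f JR chordal = rhat \<or>
          (\<exists>\<I> T. finite \<I> \<and> (\<forall>I\<in>\<I>. sconnected I) \<and>
                 T \<subseteq> JR \<and> f ` T \<subseteq> T \<and> stotally_disconnected T \<and>
                 nonwandering f JR chordal = \<Union>\<I> \<union> T))
       \<and> (\<exists>K. K \<subseteq> JR \<and> f ` K \<subseteq> K \<and> sclosed K \<and>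
              top_entropy f chordal K = top_entropy f chordal JR \<and>
              sdense_in {x\<in>K. preperiodic f x} K)"
proof -
  interpret rational_map p q d using assms(1-4) by unfold_locales
  define X where "X = {t. circ t \<in> julia (rat_map p q)}"
  obtain F D where L: "circle_lift (rat_map p q) F D X"
    using circle_lift_julia unfolding X_def by metis
  interpret circle_lift "rat_map p q" F D X by (rule L)
  have JR: "JR = circ ` X" unfolding JR_def X_def using circ_surj by (auto simp: image_iff)
  have "nonwandering f JR chordal = rhat \<or>
          (\<exists>\<I> T. finite \<I> \<and> (\<forall>I\<in>\<I>. sconnected I) \<and>
                 T \<subseteq> JR \<and> f ` T \<subseteq> T \<and> stotally_disconnected T \<and>
                 nonwandering f JR chordal = \<Union>\<I> \<union> T)"
  proof (cases "Om = UNIV")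
    case True
    have "nonwandering f JR chordal = rhat"
    proof
      show "nonwandering f JR chordal \<subseteq> rhat" by (auto simp: nonwandering_def JR_def)
      show "rhat \<subseteq> nonwandering f JR chordal"
      proof
        fix z assume "z \<in> rhat"
        then obtain t where "z = circ t" using circ_surj by blast
        then show "z \<in> nonwandering f JR chordal" using True unfolding Om_def JR f_def by auto
      qed
    qed
    then show ?thesis ..
  next
    case False
    interpret circle_lift_critical "rat_map p q" F D X critical
    proof
      show "finite critical" by (rule finite_critical)
      show "inj_on F {s..t}" if "circ ` {s..t} \<inter> critical = {}" for s t
        using lift_inj_off_critical[OF f_circ that] .
      show "\<exists>u\<in>{s..t}. (rat_map p q ^^ n) (circ u) \<noteq> circ u" if "1 \<le> n" "s < t" "s \<in> X" for n s t
        using iterate_not_id_on_julia[OF contF f_circ that(1,2)] that(3) by (simp add: X_def)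
    qed (rule False)
    show ?thesis using nonwandering_decomposition unfolding JR f_def by blast
  qed
  moreover have "\<exists>K. K \<subseteq> JR \<and> f ` K \<subseteq> K \<and> sclosed K \<and>
              top_entropy f chordal K = top_entropy f chordal JR \<and>
              sdense_in {x\<in>K. preperiodic f x} K"
    using preperiodic_subsystem unfolding JR f_def .
  ultimately show ?thesis ..
qed

end
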